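(* Let $u=u(x,t)$ be a nonnegative ancient solution to the heat equation $\Delta u-\partial_t u=0$ in $\mathbb{R}^n\times(-\infty,0]$. Then, for each $x\in\mathbb{R}^n$, $u(x,-t)$ is a completely monotone function of $t$. Moreover, there exist a family of nonnegative Borel measures $\mu=\mu(\cdot,s)$, $s\in[0,\infty)$, on the unit sphere $S^{n-1}\subset\mathbb{R}^n$, and a Borel measure $\rho=\rho(s)$ on $[0,\infty)$, such that $$u(x,t)=\int_0^\infty\int_{S^{n-1}} e^{ts+\sqrt{s}\,x\cdot\xi}\,d\mu(\xi,s)\,d\rho(s)$$ for $(x,t)\in\mathbb{R}^n\times(-\infty,0]$.
   Context: An ancient solution is a (smooth, classical) solution of the heat equation whose time interval of existence contains $(-\infty,0)$; here it is defined on $\mathbb{R}^n\times(-\infty,0]$. A function $f$ on $(0,\infty)$ is completely monotone (in the sense of Bernstein) if it is smooth and $(-1)^k f^{(k)}(t)\ge 0$ for all $t>0$ and all integers $k\ge 0$. The integral over $s$ is over $[0,\infty)$ (including a possible atom of $\rho$ at $s=0$), and $x\cdot\xi$ is the Euclidean inner product. *)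

theory Defs
  imports "HOL-Analysis.Analysis"
begin

text \<open>
  On a set such as \<open>UNIV \<times> {..0}\<close> (convex with nonempty interior) the derivative within the set
  is unique, so the witness \<open>f'\<close> below is determined on \<open>S\<close>; at boundary points the derivatives
  are one-sided.
\<close>
fun Ck_on :: "nat \<Rightarrow> 'a::euclidean_space set \<Rightarrow> ('a \<Rightarrow> real) \<Rightarrow> bool" where
  "Ck_on 0 S f \<longleftrightarrow> continuous_on S f"
| "Ck_on (Suc k) S f \<longleftrightarrow>
     (\<exists>f'. (\<forall>z\<in>S. (f has_derivative f' z) (at z within S)) \<and>
           (\<forall>b\<in>Basis. Ck_on k S (\<lambda>z. f' z b)))"

definition smooth_on :: "'a::euclidean_space set \<Rightarrow> ('a \<Rightarrow> real) \<Rightarrow> bool" where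
  "smooth_on S f \<longleftrightarrow> (\<forall>k. Ck_on k S f)"

definition laplacian :: "('a::euclidean_space \<Rightarrow> real) \<Rightarrow> 'a \<Rightarrow> real" where
  "laplacian f x = (\<Sum>b\<in>Basis. deriv (deriv (\<lambda>h. f (x + h *\<^sub>R b))) 0)"

text \<open>The time derivative at \<open>t = 0\<close> is the left derivative.\<close>
definition ancient_heat_solution :: "('a::euclidean_space \<Rightarrow> real \<Rightarrow> real) \<Rightarrow> bool" where
  "ancient_heat_solution u \<longleftrightarrow>
     smooth_on (UNIV \<times> {..0}) (\<lambda>(x, t). u x t) \<and>
     (\<forall>x. \<forall>t\<le>0. laplacian (\<lambda>y. u y t) x - vector_derivative (u x) (at t within {..0}) = 0)"

text \<open>
  Since \<open>{0<..}\<close> is open, the iterated \<open>deriv\<close> at points of \<open>{0<..}\<close> does not depend on the values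
  of \<open>f\<close> outside it.
\<close>
definition completely_monotone :: "(real \<Rightarrow> real) \<Rightarrow> bool" where
  "completely_monotone f \<longleftrightarrow>
     (\<forall>k. \<forall>t>0. (deriv ^^ k) f differentiable (at t) \<and> (- 1) ^ k * (deriv ^^ k) f t \<ge> 0)"

definition borel_measure_on :: "'a::topological_space set \<Rightarrow> 'a measure \<Rightarrow> bool" where
  "borel_measure_on S M \<longleftrightarrow> space M = S \<and> sets M = sets (restrict_space borel S)"

end

theory Submission
  imports Defs "HOL-Complex_Analysis.Great_Picard"
begin

text \<open>
  Let \<open>G\<close> be the heat kernel and \<open>c\<close> its mass (it is not normalised here). Differentiating
  \<open>\<integral> \<beta>(G(y - x, \<theta>)) u(y, t - \<theta>) dy\<close> in \<open>\<theta>\<close>, where \<open>\<beta>\<close> is convex and vanishes near \<open>0\<close> (so that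
  \<open>\<beta>(G)\<close> has compact support), gives \<open>- \<integral> \<beta>''(G) |\<nabla>G|\<^sup>2 u \<le> 0\<close>. Hence
  \<open>\<integral> G(y - x, \<theta>) u(y, t - \<theta>) dy \<le> c u(x, t)\<close>. Applied at a later time, this bound shows that the
  dissipation vanishes as \<open>\<beta>\<close> tends to the identity, so for \<open>t < 0\<close> equality holds (Widder).
  Taking \<open>\<theta> = T + t\<close> and \<open>y = 2Tz\<close>, the identity says that the exponentials \<open>exp(t|z|\<^sup>2 + x \<bullet> z)\<close>
  integrate to nearly \<open>c u(x, t)\<close> against measures of mass at most \<open>c u(0, 0)\<close>. A vague limit
  \<open>\<nu>\<close> as \<open>T \<rightarrow> \<infinity>\<close> satisfies \<open>u(x, t) = \<integral> exp(t|z|\<^sup>2 + x \<bullet> z) d\<nu>(z)\<close> up to the constant; complete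
  monotonicity is read off, and disintegrating \<open>\<nu>\<close> along \<open>s = |z|\<^sup>2\<close> gives the representation.
\<close>


section \<open>Derivatives of an ancient solution\<close>

text \<open>Nothing is known about the growth of \<open>u\<close>, so at the start neither the
  convergence of \<integral> G u nor the vanishing of boundary terms is available. Hence the kernel
  is cut off by its own value; convexity of \<beta> and nonnegativity of \<open>u\<close> give the
  error a sign. The choice \<beta>(g) = max(0, g - e)^3 / g^2 is C^2 for g > 0, lies below g, and
  satisfies \<beta>''(g) g^2 \<le> 6 e^a g^(1-a) for 0 \<le> a \<le> 1. A slightly lowered power of
  G(r, \<theta>), even times |r|^2, is dominated by G(r, \<theta> + h). With h = - t this wider
  kernel looks at the same slice of \<open>u\<close> from time 0, where the upper bound already
  holds. This is where t < 0 is spent; t = 0 is recovered at the end by monotone convergence. A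
  vague limit may lose mass at infinity, which does no harm since for t < 0 the exponentials vanish
  there. The limit measure and the conditional measures come from one device: weights on nested
  cells, realised by Lebesgue measure on an interval.\<close>

lemma has_derivative_line:
  fixes f :: "'a::real_normed_vector \<times> real \<Rightarrow> real"
  assumes "(f has_derivative D) (at (x, t) within UNIV \<times> {..0})" "t \<le> 0"
  shows "((\<lambda>h. f (x + h *\<^sub>R b, t)) has_real_derivative D (b, 0)) (at 0)"
proof -
  let ?g = "\<lambda>h::real. (x + h *\<^sub>R b, t)"
  have "(f has_derivative D) (at (?g 0) within range ?g)"
    using assms by (auto intro: has_derivative_subset)
  moreover have "(?g has_derivative (\<lambda>h. (h *\<^sub>R b, 0))) (at 0)"
    by (auto intro!: derivative_eq_intros)
  ultimately have "((\<lambda>h. f (?g h)) has_derivative (\<lambda>h. D (h *\<^sub>R b, 0))) (at 0)"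
    using has_derivative_in_compose by blast
  moreover have "D (h *\<^sub>R b, 0) = D (b, 0) * h" for h
  proof -
    have "linear D" using assms(1) by (rule has_derivative_linear)
    from linear_scale[OF this, of h "(b, 0)"] show ?thesis by simp
  qed
  ultimately show ?thesis by (simp add: has_field_derivative_def)
qed

lemma has_derivative_time:
  fixes f :: "'a::real_normed_vector \<times> real \<Rightarrow> real"
  assumes "(f has_derivative D) (at (x, t) within UNIV \<times> {..0})" "t \<le> 0"
  shows "((\<lambda>s. f (x, s)) has_real_derivative D (0, 1)) (at t within {..0})"
proof -
  let ?g = "\<lambda>s::real. (x, s)"
  have "(f has_derivative D) (at (?g t) within ?g ` {..0})"
    using assms by (auto intro: has_derivative_subset)
  moreover have "(?g has_derivative (\<lambda>h. (0, h))) (at t within {..0})"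
    by (auto intro!: derivative_eq_intros)
  ultimately have "((\<lambda>h. f (?g h)) has_derivative (\<lambda>h. D (0, h))) (at t within {..0})"
    using has_derivative_in_compose by blast
  moreover have "(\<lambda>h. D (0, h)) = (*) (D (0, 1))"
  proof
    fix h
    have "linear D" using assms(1) by (rule has_derivative_linear)
    from linear_scale[OF this, of h "(0, 1)"] show "D (0, h) = D (0, 1) * h" by simp
  qed
  ultimately show ?thesis unfolding has_field_derivative_def by metis
qed

text \<open>\<open>p b\<close> and \<open>q b\<close> are the first and second space derivatives in
  direction \<open>b\<close>. The heat equation is built into \<open>deriv_t\<close>, whose
  derivative is the Laplacian and is one-sided at time 0.\<close>

locale ancient_heat =
  fixes u :: "'a::euclidean_space \<Rightarrow> real \<Rightarrow> real" and p q
  assumes cont_u: "continuous_on (UNIV \<times> {..0}) (\<lambda>(x, t). u x t)"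
    and cont_p: "b \<in> Basis \<Longrightarrow> continuous_on (UNIV \<times> {..0}) (\<lambda>(x, t). p b x t)"
    and cont_q: "b \<in> Basis \<Longrightarrow> continuous_on (UNIV \<times> {..0}) (\<lambda>(x, t). q b x t)"
    and deriv_u: "b \<in> Basis \<Longrightarrow> t \<le> 0 \<Longrightarrow>
      ((\<lambda>h. u (x + h *\<^sub>R b) t) has_real_derivative p b x t) (at 0)"
    and deriv_p: "b \<in> Basis \<Longrightarrow> t \<le> 0 \<Longrightarrow>
      ((\<lambda>h. p b (x + h *\<^sub>R b) t) has_real_derivative q b x t) (at 0)"
    and deriv_t: "t \<le> 0 \<Longrightarrow> (u x has_real_derivative (\<Sum>b\<in>Basis. q b x t)) (at t within {..0})"
    and nonneg: "t \<le> 0 \<Longrightarrow> u x t \<ge> 0"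

text \<open>The vectors \<open>(b, 0)\<close> belong to the basis of the product space, so unfolding
  \<open>Ck_on\<close> twice yields the iterated space derivatives together with their continuity up
  to time 0. The equation then identifies the time derivative.\<close>

lemma ancient_heat_solution_imp_ancient_heat:
  fixes u :: "'a::euclidean_space \<Rightarrow> real \<Rightarrow> real"
  assumes "ancient_heat_solution u" and nonneg: "\<And>x t. t \<le> 0 \<Longrightarrow> u x t \<ge> 0"
  obtains p q where "ancient_heat u p q"
proof -
  let ?S = "UNIV \<times> {..0} :: ('a \<times> real) set"
  let ?U = "\<lambda>(x, t). u x t"
  have "Ck_on (Suc (Suc 0)) ?S ?U"
    using assms unfolding ancient_heat_solution_def smooth_on_def by blast
  then have "\<exists>D. (\<forall>z\<in>?S. (?U has_derivative D z) (at z within ?S)) \<and>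
      (\<forall>b\<in>Basis. Ck_on (Suc 0) ?S (\<lambda>z. D z b))"
    unfolding Ck_on.simps(2)[of "Suc 0"] .
  then obtain D where D: "\<And>z. z \<in> ?S \<Longrightarrow> (?U has_derivative D z) (at z within ?S)"
    and D2: "\<And>b. b \<in> Basis \<Longrightarrow> Ck_on (Suc 0) ?S (\<lambda>z. D z b)"
    by blast
  have "\<forall>b\<in>Basis. \<exists>E. (\<forall>z\<in>?S. ((\<lambda>z. D z b) has_derivative E z) (at z within ?S)) \<and>
           (\<forall>b'\<in>Basis. continuous_on ?S (\<lambda>z. E z b'))"
    using D2 unfolding Ck_on.simps by blast
  then obtain E where E: "\<And>b z. b \<in> Basis \<Longrightarrow> z \<in> ?S \<Longrightarrow> ((\<lambda>z. D z b) has_derivative E b z) (at z within ?S)"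
    and E2: "\<And>b b'. b \<in> Basis \<Longrightarrow> b' \<in> Basis \<Longrightarrow> continuous_on ?S (\<lambda>z. E b z b')"
    by metis
  define p where "p b x t = D (x, t) (b, 0)" for b x t
  define q where "q b x t = E (b, 0) (x, t) (b, 0)" for b x t
  have B: "(b, 0) \<in> Basis" if "b \<in> Basis" for b :: 'a
    using that by (auto simp: Basis_prod_def)
  have c0: "continuous_on ?S ?U"
    by (rule has_derivative_continuous_on) (rule D)
  have c1: "continuous_on ?S (\<lambda>(x, t). p b x t)" if "b \<in> Basis" for b
  proof -
    have "continuous_on ?S (\<lambda>z. D z (b, 0))"
      by (rule has_derivative_continuous_on) (rule E[OF B[OF that]])
    then show ?thesis unfolding p_def split_beta by simp
  qed
  have c2: "continuous_on ?S (\<lambda>(x, t). q b x t)" if "b \<in> Basis" for b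
    using E2[OF B[OF that] B[OF that]] unfolding q_def split_beta by simp
  have d1: "((\<lambda>h. u (x + h *\<^sub>R b) t) has_real_derivative p b x t) (at 0)" if "t \<le> 0" for b x t
    using has_derivative_line[OF D that, of x b] that by (simp add: p_def)
  have d2: "((\<lambda>h. p b (x + h *\<^sub>R b) t) has_real_derivative q b x t) (at 0)" if "t \<le> 0" "b \<in> Basis" for b x t
    using has_derivative_line[OF E[OF B[OF that(2)]] that(1), of x b] that by (simp add: p_def q_def)
  have d3: "(u x has_real_derivative (\<Sum>b\<in>Basis. q b x t)) (at t within {..0})" if "t \<le> 0" for x t
  proof -
    have 1: "(u x has_real_derivative D (x, t) (0, 1)) (at t within {..0})"
      using has_derivative_time[OF D that, of x] that by simp
    \<comment> \<open>\<open>{..0}\<close> accumulates at \<open>t\<close> from the left, also for t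
      = 0, so the derivative within it is unique.\<close>
    have "at_left t \<le> at t within {..0}"
      using that by (intro at_le) auto
    then have "at t within {..0} \<noteq> bot"
      using trivial_limit_at_left_real[of t] by (metis bot.extremum_uniqueI)
    then have "vector_derivative (u x) (at t within {..0}) = D (x, t) (0, 1)"
      using vector_derivative_within[of t "{..0}"] 1
      by (simp add: has_real_derivative_iff_has_vector_derivative)
    moreover have "deriv (deriv (\<lambda>h. u (x + h *\<^sub>R b) t)) 0 = q b x t" if b: "b \<in> Basis" for b
    proof -
      have "deriv (\<lambda>h. u (x + h *\<^sub>R b) t) k = p b (x + k *\<^sub>R b) t" for k
      proof -
        have "((\<lambda>h. u (x + k *\<^sub>R b + h *\<^sub>R b) t) has_real_derivative p b (x + k *\<^sub>R b) t) (at 0)"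
          by (rule d1) fact
        then have "((\<lambda>h. u (x + h *\<^sub>R b) t) has_real_derivative p b (x + k *\<^sub>R b) t) (at k)"
          using DERIV_shift[of "\<lambda>h. u (x + h *\<^sub>R b) t" _ 0 k] by (simp add: scaleR_add_left ac_simps)
        then show ?thesis by (rule DERIV_imp_deriv)
      qed
      then have "deriv (\<lambda>h. u (x + h *\<^sub>R b) t) = (\<lambda>k. p b (x + k *\<^sub>R b) t)" by auto
      then show ?thesis using DERIV_imp_deriv[OF d2[OF \<open>t \<le> 0\<close> b]] by simp
    qed
    moreover have "laplacian (\<lambda>y. u y t) x = vector_derivative (u x) (at t within {..0})"
      using assms that unfolding ancient_heat_solution_def by simp
    ultimately have "(\<Sum>b\<in>Basis. q b x t) = D (x, t) (0, 1)"
      unfolding laplacian_def by simp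
    with 1 show ?thesis by simp
  qed
  have "ancient_heat u p q"
    by (rule ancient_heat.intro[OF c0 c1 c2 d1 d2 d3 nonneg])
  then show ?thesis by (rule that)
qed

section \<open>The heat kernel and its truncations\<close>

definition heat_kernel :: "real \<Rightarrow> 'a::euclidean_space \<Rightarrow> real" where
  "heat_kernel \<theta> r = exp (- (norm r)\<^sup>2 / (4 * \<theta>)) / sqrt \<theta> ^ DIM('a)"

lemma heat_kernel_pos: "\<theta> > 0 \<Longrightarrow> heat_kernel \<theta> r > 0"
  by (simp add: heat_kernel_def)

lemma heat_kernel_deriv_space:
  fixes r b :: "'a::euclidean_space"
  assumes "\<theta> > 0"
  shows "((\<lambda>h. heat_kernel \<theta> (r + h *\<^sub>R b)) has_real_derivative
    - (r \<bullet> b) / (2 * \<theta>) * heat_kernel \<theta> r) (at 0)"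
proof -
  have n: "(norm (r + h *\<^sub>R b))\<^sup>2 = r \<bullet> r + 2 * h * (r \<bullet> b) + h\<^sup>2 * (b \<bullet> b)" for h
    unfolding power2_norm_eq_inner
    by (simp add: inner_add_left inner_add_right inner_commute power2_eq_square algebra_simps)
  show ?thesis
    unfolding heat_kernel_def n using assms
    by (auto intro!: derivative_eq_intros simp: power2_norm_eq_inner field_simps)
qed

lemma heat_kernel_deriv2_space:
  fixes r b :: "'a::euclidean_space"
  assumes "\<theta> > 0" "b \<in> Basis"
  shows "((\<lambda>h. - ((r + h *\<^sub>R b) \<bullet> b) / (2 * \<theta>) * heat_kernel \<theta> (r + h *\<^sub>R b)) has_real_derivative
    ((r \<bullet> b)\<^sup>2 / (4 * \<theta>\<^sup>2) - 1 / (2 * \<theta>)) * heat_kernel \<theta> r) (at 0)"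
proof -
  have i: "(r + h *\<^sub>R b) \<bullet> b = r \<bullet> b + h" for h
    using assms by (simp add: inner_add_left)
  show ?thesis
    unfolding i using assms
    by (auto intro!: derivative_eq_intros heat_kernel_deriv_space simp: power2_eq_square field_simps)
qed

text \<open>The factor is the sum over \<open>Basis\<close> of those in
  \<open>heat_kernel_deriv2_space\<close>: the kernel solves the heat equation in \<theta>. The
  Green identity below uses it in this form.\<close>

lemma heat_kernel_deriv_time:
  fixes r :: "'a::euclidean_space"
  assumes "\<theta> > 0"
  shows "((\<lambda>\<theta>. heat_kernel \<theta> r) has_real_derivative
    ((norm r)\<^sup>2 / (4 * \<theta>\<^sup>2) - DIM('a) / (2 * \<theta>)) * heat_kernel \<theta> r) (at \<theta>)"
proof -
  have s: "((\<lambda>\<theta>. sqrt \<theta> ^ DIM('a)) has_real_derivative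
      DIM('a) / (2 * \<theta>) * sqrt \<theta> ^ DIM('a)) (at \<theta>)"
  proof -
    obtain m where m: "DIM('a) = Suc m" using DIM_positive[where 'a='a] gr0_implies_Suc by blast
    have "((\<lambda>\<theta>. sqrt \<theta> ^ Suc m) has_real_derivative
      (1 + real m) * sqrt \<theta> ^ m * (inverse (sqrt \<theta>) / 2)) (at \<theta>)"
      using assms by (intro DERIV_cong[OF DERIV_power[OF DERIV_real_sqrt]]) auto
    also have "(1 + real m) * sqrt \<theta> ^ m * (inverse (sqrt \<theta>) / 2) = (1 + real m) / (2 * (sqrt \<theta> * sqrt \<theta>)) * sqrt \<theta> ^ Suc m"
      using assms by (simp add: field_simps del: real_sqrt_mult_self)
    finally show ?thesis using assms unfolding m by simp
  qed
  have e: "((\<lambda>\<theta>. exp (- (norm r)\<^sup>2 / (4 * \<theta>))) has_real_derivative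
      exp (- (norm r)\<^sup>2 / (4 * \<theta>)) * ((norm r)\<^sup>2 / (4 * \<theta>\<^sup>2))) (at \<theta>)"
    using assms by (auto intro!: derivative_eq_intros simp: power2_eq_square)
  show ?thesis
    unfolding heat_kernel_def
    by (rule DERIV_cong[OF DERIV_divide[OF e s]]) (use assms in \<open>auto simp: field_simps\<close>)
qed

lemma continuous_on_heat_kernel [continuous_intros]:
  fixes g :: "'b::topological_space \<Rightarrow> 'a::euclidean_space"
  assumes "continuous_on S f" "continuous_on S g" "\<And>x. x \<in> S \<Longrightarrow> f x > 0"
  shows "continuous_on S (\<lambda>x. heat_kernel (f x) (g x))"
  unfolding heat_kernel_def
  by (intro continuous_intros assms) (use assms(3) in force)+

text \<open>Equal to g (1 - e/g)^3 for g > e and to 0 for 0 < g \<le> e. The cube makes the function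
  twice continuously differentiable across g = e; dividing by g^2 brings it back to the size of g
  for large g.\<close>

definition trunc :: "real \<Rightarrow> real \<Rightarrow> real" where
  "trunc e g = (max 0 (g - e)) ^ 3 / g\<^sup>2"

definition trunc1 :: "real \<Rightarrow> real \<Rightarrow> real" where
  "trunc1 e g = 3 * (max 0 (g - e))\<^sup>2 / g\<^sup>2 - 2 * (max 0 (g - e)) ^ 3 / g ^ 3"

text \<open>For g > e the squared bracket is (e/g)^2, so the value is 6 e^2 (g - e) / g^4. The
  written form shows the sign, and the factor e^2 is the source of the smallness of the
  dissipation.\<close>

definition trunc2 :: "real \<Rightarrow> real \<Rightarrow> real" where
  "trunc2 e g = 6 * max 0 (g - e) * (1 - max 0 (g - e) / g)\<^sup>2 / g\<^sup>2"

lemma trunc_eq_0: "g \<le> e \<Longrightarrow> trunc e g = 0" "g \<le> e \<Longrightarrow> trunc1 e g = 0" "g \<le> e \<Longrightarrow> trunc2 e g = 0"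
  by (simp_all add: trunc_def trunc1_def trunc2_def)

lemma trunc2_nonneg: "trunc2 e g \<ge> 0"
  by (simp add: trunc2_def)

lemma trunc_nonneg: "trunc e g \<ge> 0"
  by (simp add: trunc_def)

text \<open>Away from 0 the function is locally a monomial or zero. At 0 the difference quotient is
  at most |h|^(k+1), which tends to 0 because the exponent of the power is at least two.\<close>

lemma DERIV_max_power:
  fixes x :: real
  shows "((\<lambda>x. (max 0 x) ^ Suc (Suc k)) has_real_derivative (Suc (Suc k)) * (max 0 x) ^ Suc k) (at x)"
proof -
  consider "x > 0" | "x < 0" | "x = 0" by linarith
  then show ?thesis
  proof cases
    case 1
    have "((\<lambda>x::real. x ^ Suc (Suc k)) has_real_derivative (Suc (Suc k)) * (max 0 x) ^ Suc k) (at x)"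
      using 1 DERIV_pow[of "Suc (Suc k)" x] by simp
    then show ?thesis
      by (rule has_field_derivative_transform_within_open[where S="{0<..}"]) (use 1 in auto)
  next
    case 2
    have "((\<lambda>x::real. 0) has_real_derivative (Suc (Suc k)) * (max 0 x) ^ Suc k) (at x)"
      using 2 by (auto intro!: derivative_eq_intros)
    then show ?thesis
      by (rule has_field_derivative_transform_within_open[where S="{..<0}"]) (use 2 in auto)
  next
    case 3
    have "((\<lambda>h::real. (max 0 h) ^ Suc (Suc k) / h) \<longlongrightarrow> 0) (at 0)"
    proof (rule Lim_null_comparison)
      show "eventually (\<lambda>h::real. norm ((max 0 h) ^ Suc (Suc k) / h) \<le> \<bar>h\<bar> ^ Suc k) (at 0)"
        by (rule always_eventually) (auto simp: max_def abs_mult mult_nonpos_nonneg)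
      show "((\<lambda>h::real. \<bar>h\<bar> ^ Suc k) \<longlongrightarrow> 0) (at 0)"
        by (rule tendsto_eq_rhs[OF tendsto_power[OF tendsto_rabs[OF tendsto_ident_at]]]) simp
    qed
    then show ?thesis using 3 by (simp add: DERIV_def)
  qed
qed

lemma DERIV_max_power2: "((\<lambda>g::real. (max 0 (g - e))\<^sup>2) has_real_derivative 2 * max 0 (g - e)) (at g)"
proof -
  have "((\<lambda>g. g - e) has_real_derivative 1) (at g)"
    by (auto intro!: derivative_eq_intros)
  from DERIV_chain2[where f="\<lambda>x::real. (max 0 x) ^ Suc (Suc 0)" and g="\<lambda>g. g - e" and x=g, OF DERIV_max_power this]
  show ?thesis by (simp add: numeral_eq_Suc)
qed

lemma DERIV_max_power3: "((\<lambda>g::real. (max 0 (g - e)) ^ 3) has_real_derivative 3 * (max 0 (g - e))\<^sup>2) (at g)"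
proof -
  have "((\<lambda>g. g - e) has_real_derivative 1) (at g)"
    by (auto intro!: derivative_eq_intros)
  from DERIV_chain2[where f="\<lambda>x::real. (max 0 x) ^ Suc (Suc 1)" and g="\<lambda>g. g - e" and x=g, OF DERIV_max_power this]
  show ?thesis by (simp add: numeral_eq_Suc)
qed

lemma DERIV_trunc:
  assumes "g > 0"
  shows "(trunc e has_real_derivative trunc1 e g) (at g)"
proof -
  define P where "P = max 0 (g - e)"
  have "((\<lambda>g. (max 0 (g - e)) ^ 3 / g\<^sup>2) has_real_derivative
      ((3 * P\<^sup>2) * g\<^sup>2 - P ^ 3 * (2 * g)) / (g\<^sup>2 * g\<^sup>2)) (at g)"
    unfolding P_def
    by (rule DERIV_divide[OF DERIV_max_power3]) (use assms in \<open>auto intro!: derivative_eq_intros\<close>)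
  also have "((3 * P\<^sup>2) * g\<^sup>2 - P ^ 3 * (2 * g)) / (g\<^sup>2 * g\<^sup>2) = trunc1 e g"
    unfolding trunc1_def P_def[symmetric] using assms
    by (simp add: field_simps power2_eq_square power3_eq_cube)
  finally show ?thesis unfolding trunc_def .
qed

lemma DERIV_trunc1:
  assumes "g > 0"
  shows "(trunc1 e has_real_derivative trunc2 e g) (at g)"
proof -
  define P where "P = max 0 (g - e)"
  have "((\<lambda>g. 3 * (max 0 (g - e))\<^sup>2 / g\<^sup>2 - 2 * (max 0 (g - e)) ^ 3 / g ^ 3) has_real_derivative
      (3 * (2 * P) * g\<^sup>2 - 3 * P\<^sup>2 * (2 * g)) / (g\<^sup>2 * g\<^sup>2) -
      (2 * (3 * P\<^sup>2) * g ^ 3 - 2 * P ^ 3 * (3 * g\<^sup>2)) / (g ^ 3 * g ^ 3)) (at g)"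
    unfolding P_def
    by (intro DERIV_divide DERIV_diff DERIV_cmult DERIV_max_power3 DERIV_max_power2)
      (use assms in \<open>auto intro!: derivative_eq_intros\<close>)
  also have "(3 * (2 * P) * g\<^sup>2 - 3 * P\<^sup>2 * (2 * g)) / (g\<^sup>2 * g\<^sup>2) -
      (2 * (3 * P\<^sup>2) * g ^ 3 - 2 * P ^ 3 * (3 * g\<^sup>2)) / (g ^ 3 * g ^ 3) = trunc2 e g"
    unfolding trunc2_def P_def[symmetric] using assms
    by (simp add: field_simps eval_nat_numeral)
  finally show ?thesis unfolding trunc1_def .
qed

lemma continuous_on_trunc [continuous_intros]:
  assumes "continuous_on S g" "\<And>x. x \<in> S \<Longrightarrow> g x > 0"
  shows "continuous_on S (\<lambda>x. trunc e (g x))" "continuous_on S (\<lambda>x. trunc1 e (g x))"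
    "continuous_on S (\<lambda>x. trunc2 e (g x))"
  unfolding trunc_def trunc1_def trunc2_def
  by (intro continuous_intros assms; use assms(2) in force)+

text \<open>Integration by parts reduces to translation invariance of the Lebesgue measure.\<close>

lemma integral_directional_derivative_eq_0:
  fixes V W :: "'a::euclidean_space \<Rightarrow> real"
  assumes V: "continuous_on UNIV V" and W: "continuous_on UNIV W"
    and d: "\<And>y. ((\<lambda>h. V (y + h *\<^sub>R b)) has_real_derivative W y) (at 0)"
    and b: "norm b \<le> 1"
    and z: "\<And>y. dist y x0 > R \<Longrightarrow> V y = 0"
    and box: "cball x0 (R + 1) \<subseteq> cbox a c"
  shows "integral (cbox a c) W = 0"
proof -
  define I where "I h = integral (cbox a c) (\<lambda>y. V (y + h *\<^sub>R b))" for h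
  have Vc: "continuous_on S (\<lambda>y. V (y + h *\<^sub>R b))" for h S
    by (rule continuous_on_compose2[OF V]) (auto intro!: continuous_intros)
  \<comment> \<open>The unit margin between R and R + 1 keeps the shifted support inside the box for
    |h| \<le> 1, so the box integral is an integral over the whole space and is translation
    invariant.\<close>
  have I: "I h = I 0" if h: "h \<in> {-1..1}" for h
  proof -
    have zero: "V (y + h *\<^sub>R b) = 0" if "y \<notin> cbox a c" "h \<in> {-1..1}" for y h
    proof (rule z)
      have "R + 1 < dist y x0" using that(1) box by (force simp: dist_commute)
      moreover have "dist y x0 \<le> dist (y + h *\<^sub>R b) x0 + norm (h *\<^sub>R b)"
        by (metis add_diff_cancel_left' dist_commute dist_norm dist_triangle3 add.commute)
      moreover have "norm (h *\<^sub>R b) \<le> 1" using that(2) b by (auto intro!: mult_le_one)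
      ultimately show "R < dist (y + h *\<^sub>R b) x0" by linarith
    qed
    have "I h = (LINT y|lborel. V (y + h *\<^sub>R b))" if "h \<in> {-1..1}" for h
    proof -
      have "set_integrable lborel (cbox a c) (\<lambda>y. V (y + h *\<^sub>R b))"
        unfolding set_integrable_def
        by (rule borel_integrable_compact) (auto intro: Vc)
      then have "I h = (LINT y:cbox a c|lborel. V (y + h *\<^sub>R b))"
        unfolding I_def by (simp add: set_borel_integral_eq_integral)
      also have "\<dots> = (LINT y|lborel. V (y + h *\<^sub>R b))"
        unfolding set_lebesgue_integral_def
        by (rule Bochner_Integration.integral_cong) (use zero[OF _ that] in \<open>auto simp: indicator_def\<close>)
      finally show ?thesis .
    qed
    moreover have "(LINT y|lborel. V (y + h *\<^sub>R b)) = (LINT y|lborel. V y)" for h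
    proof -
      have "(LINT y|lborel. V y) = (LINT y|distr lborel borel ((+) (h *\<^sub>R b)). V y)"
        by (simp add: lborel_distr_plus)
      also have "\<dots> = (LINT y|lborel. V (y + h *\<^sub>R b))"
        using V by (subst integral_distr) (auto intro: borel_measurable_continuous_onI simp: add.commute)
      finally show ?thesis by simp
    qed
    ultimately show ?thesis using h by simp
  qed
  have D: "((\<lambda>h. V (y + h *\<^sub>R b)) has_real_derivative W (y + h *\<^sub>R b)) (at h within S)" for h y S
  proof -
    have "((\<lambda>k. V ((y + h *\<^sub>R b) + k *\<^sub>R b)) has_real_derivative W (y + h *\<^sub>R b)) (at 0)"
      by (rule d)
    then have "((\<lambda>h. V (y + h *\<^sub>R b)) has_real_derivative W (y + h *\<^sub>R b)) (at h)"
      using DERIV_shift[of "\<lambda>h. V (y + h *\<^sub>R b)" _ 0 h] by (simp add: scaleR_add_left ac_simps)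
    then show ?thesis by (rule has_field_derivative_at_within)
  qed
  \<comment> \<open>Differentiation under the integral sign: the derivative of the constant function
    \<open>I\<close> at 0 is the integral of \<open>W\<close>.\<close>
  have "(I has_real_derivative integral (cbox a c) (\<lambda>y. W (y + 0 *\<^sub>R b))) (at 0 within {-1..1})"
    unfolding I_def
    by (rule leibniz_rule_field_derivative[where f="\<lambda>h y. V (y + h *\<^sub>R b)" and fx="\<lambda>h y. W (y + h *\<^sub>R b)"])
      (auto intro!: D integrable_continuous Vc continuous_on_compose2[OF W] continuous_intros simp: split_beta)
  then have "(I has_real_derivative integral (cbox a c) W) (at 0)"
    using at_within_interior[of 0 "{-1..1::real}"] by simp
  moreover have "(I has_real_derivative 0) (at 0)"
    by (rule has_field_derivative_transform_within_open[where S="{-1<..<1}" and f="\<lambda>_. I 0"])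
      (auto intro: I[symmetric])
  ultimately show ?thesis by (rule DERIV_unique)
qed

section \<open>Gaussian mass and decay of the heat kernel\<close>

lemma power_le_exp:
  fixes x :: real
  assumes "x \<ge> 0" "n > 0"
  shows "(x / n) ^ n \<le> exp x"
proof -
  have "(x / n) ^ n \<le> (1 + x / n) ^ n" using assms by (intro power_mono) auto
  also have "\<dots> \<le> exp x" using assms by (intro exp_ge_one_plus_x_over_n_power_n) auto
  finally show ?thesis .
qed

text \<open>The Gaussian is bounded by C / (1 + |w|)^(n+2). Replacing |w| by its integer part k and
  using the ball of radius 1 + k, whose volume is of order (1 + k)^n, leaves a multiple of the sum
  of 1 / (1 + k)^2.\<close>

lemma gaussian_finite:
  "(\<integral>\<^sup>+ w. ennreal (exp (- (norm (w::'a::euclidean_space))\<^sup>2 / 4)) \<partial>lborel) < \<infinity>"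
proof -
  define N where "N = DIM('a) + 2"
  \<comment> \<open>The factor 8 N stems from 1 + r \<le> 2 (1 + r^2) and from
    \<open>power_le_exp\<close> at (1 + r^2) / 4, which also leaves the factor exp (1/4).\<close>
  define C where "C = exp (1/4) * (8 * real N) ^ N"
  have C: "C > 0" by (simp add: C_def N_def)
  have bound: "exp (- (norm w)\<^sup>2 / 4) \<le> C / (1 + norm w) ^ N" for w :: 'a
  proof -
    let ?r = "norm w"
    have "((1 + ?r) / (8 * real N)) ^ N \<le> ((1 + ?r\<^sup>2) / 4 / N) ^ N"
    proof (rule power_mono)
      have "0 \<le> (1/2 - ?r)\<^sup>2" by simp
      then have "?r \<le> ?r\<^sup>2 + 1 / 4" by (simp add: power2_eq_square algebra_simps)
      also have "\<dots> \<le> 1 + 2 * ?r\<^sup>2" by simp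
      finally have "1 + ?r \<le> 2 * (1 + ?r\<^sup>2)" by simp
      then have "(1 + ?r) / (8 * real N) \<le> 2 * (1 + ?r\<^sup>2) / (8 * real N)"
        by (rule divide_right_mono) simp
      moreover have "2 * X / (8 * n) = X / 4 / n" for X n :: real by simp
      ultimately show "(1 + ?r) / (8 * real N) \<le> (1 + ?r\<^sup>2) / 4 / N" by metis
    qed auto
    also have "\<dots> \<le> exp ((1 + ?r\<^sup>2) / 4)" by (intro power_le_exp) (auto simp: N_def)
    also have "\<dots> = exp (1/4) * exp (?r\<^sup>2 / 4)" by (simp add: exp_add[symmetric] add_divide_distrib)
    finally have "(1 + ?r) ^ N / (8 * real N) ^ N \<le> exp (1/4) * exp (?r\<^sup>2 / 4)"
      by (simp only: power_divide)
    moreover have "(8 * real N) ^ N > 0" by (simp add: N_def)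
    ultimately have "(1 + ?r) ^ N \<le> C * exp (?r\<^sup>2 / 4)"
      by (simp add: C_def pos_divide_le_eq ac_simps)
    moreover have "1 + ?r > 0" using norm_ge_zero[of w] by linarith
    ultimately show ?thesis by (simp add: exp_minus field_simps)
  qed
  have "(\<integral>\<^sup>+ w. ennreal (exp (- (norm (w::'a))\<^sup>2 / 4)) \<partial>lborel)
    \<le> (\<integral>\<^sup>+ w. (\<Sum>k. ennreal (C / (1 + real k) ^ N) * indicator (cball (0::'a) (1 + real k)) w) \<partial>lborel)"
  proof (rule nn_integral_mono)
    fix w :: 'a
    define k where "k = nat \<lfloor>norm w\<rfloor>"
    define g where "g j = ennreal (C / (1 + real j) ^ N) * indicator (cball 0 (1 + real j)) w" for j
    have k: "real k \<le> norm w" "norm w \<le> 1 + real k" unfolding k_def using norm_ge_zero[of w] by linarith+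
    have "ennreal (exp (- (norm w)\<^sup>2 / 4)) \<le> ennreal (C / (1 + norm w) ^ N)"
      using bound by (intro ennreal_leI)
    also have "\<dots> \<le> g k"
      unfolding g_def using k C by (auto intro!: ennreal_leI divide_left_mono power_mono mult_pos_pos zero_less_power)
    also have "\<dots> = sum g {k}" by simp
    also have "\<dots> \<le> suminf g" by (intro sum_le_suminf) auto
    also have "\<dots> = (\<Sum>k. ennreal (C / (1 + real k) ^ N) * indicator (cball 0 (1 + real k)) w)"
      unfolding g_def ..
    finally show "ennreal (exp (- (norm w)\<^sup>2 / 4)) \<le> \<dots>" .
  qed
  also have "\<dots> = (\<Sum>k. ennreal (C / (1 + real k) ^ N) * emeasure lborel (cball (0::'a) (1 + real k)))"
  proof -
    have [measurable]: "cball (0::'a) r \<in> sets borel" for r by simp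
    show ?thesis by (subst nn_integral_suminf) (measurable, simp add: nn_integral_cmult_indicator)
  qed
  also have "\<dots> = (\<Sum>k. ennreal (C * unit_ball_vol (real DIM('a)) * inverse ((real (Suc k))\<^sup>2)))"
  proof (intro suminf_cong)
    fix k
    have "ennreal (C / (1 + real k) ^ N) * emeasure lborel (cball (0::'a) (1 + real k)) =
      ennreal (C / (1 + real k) ^ N * (unit_ball_vol (real DIM('a)) * (1 + real k) ^ DIM('a)))"
    proof -
      have "emeasure lborel (cball (0::'a) (1 + real k)) = ennreal (unit_ball_vol (real DIM('a)) * (1 + real k) ^ DIM('a))"
        by (rule emeasure_cball) simp
      then show ?thesis using C by (simp only: ennreal_mult'[symmetric] less_imp_le divide_nonneg_nonneg zero_le_power add_nonneg_nonneg zero_le_one of_nat_0_le_iff)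
    qed
    also have "C / (1 + real k) ^ N * (unit_ball_vol (real DIM('a)) * (1 + real k) ^ DIM('a)) =
       C * unit_ball_vol (real DIM('a)) * inverse ((real (Suc k))\<^sup>2)"
    proof -
      have "C / (a ^ m * a\<^sup>2) * (v * a ^ m) = C * v * inverse (a\<^sup>2)" if "a > 0" for a v :: real and m
        using that by (simp add: field_simps)
      note * = this
      show ?thesis unfolding N_def power_add of_nat_Suc by (rule *) simp
    qed
    finally show "ennreal (C / (1 + real k) ^ N) * emeasure lborel (cball (0::'a) (1 + real k)) = ennreal \<dots>" .
  qed
  also have "\<dots> < \<infinity>"
  proof -
    have "summable (\<lambda>k. C * unit_ball_vol (real DIM('a)) * inverse ((real (Suc k))\<^sup>2))"
      using inverse_power_summable[of 2, where 'a=real] summable_Suc_iff[of "\<lambda>k. inverse (real k ^ 2)"]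
      by (intro summable_mult) auto
    then show ?thesis
      using C by (subst suminf_ennreal2) (auto simp: less_top[symmetric])
  qed
  finally show ?thesis .
qed

text \<open>The number (4 \<pi>)^(n/2), kept symbolic and divided out in
  \<open>exponential_representation\<close>. The type argument carries the dimension.\<close>

definition gaussian_mass :: "'a::euclidean_space itself \<Rightarrow> real" where
  "gaussian_mass _ = enn2real (\<integral>\<^sup>+ w. ennreal (exp (- (norm (w::'a))\<^sup>2 / 4)) \<partial>lborel)"

lemma nn_integral_gaussian:
  "(\<integral>\<^sup>+ w. ennreal (exp (- (norm (w::'a::euclidean_space))\<^sup>2 / 4)) \<partial>lborel) = ennreal (gaussian_mass TYPE('a))"
  unfolding gaussian_mass_def using gaussian_finite[where 'a='a] by (simp add: ennreal_enn2real)

lemma nn_integral_gaussian_times: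
  assumes "c \<ge> 0"
  shows "(\<integral>\<^sup>+ w. ennreal (exp (- (norm (w::'a::euclidean_space))\<^sup>2 / 4) * c) \<partial>lborel) =
    ennreal (gaussian_mass TYPE('a) * c)"
proof -
  have "(\<integral>\<^sup>+ w. ennreal (exp (- (norm (w::'a))\<^sup>2 / 4) * c) \<partial>lborel) =
    (\<integral>\<^sup>+ w. ennreal (exp (- (norm (w::'a))\<^sup>2 / 4)) * ennreal c \<partial>lborel)"
    using assms by (simp add: ennreal_mult')
  also have "\<dots> = (\<integral>\<^sup>+ w. ennreal (exp (- (norm (w::'a))\<^sup>2 / 4)) \<partial>lborel) * ennreal c"
    by (rule nn_integral_multc) simp
  also have "\<dots> = ennreal (gaussian_mass TYPE('a) * c)"
    unfolding nn_integral_gaussian using assms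
    by (intro ennreal_mult[symmetric]) (auto simp: gaussian_mass_def)
  finally show ?thesis .
qed

lemma gaussian_mass_pos: "gaussian_mass TYPE('a::euclidean_space) > 0"
proof -
  have "(\<integral>\<^sup>+ w. ennreal (exp (- (norm (w::'a))\<^sup>2 / 4)) \<partial>lborel) \<noteq> 0"
  proof
    assume "(\<integral>\<^sup>+ w. ennreal (exp (- (norm (w::'a))\<^sup>2 / 4)) \<partial>lborel) = 0"
    then have "AE w in lborel. ennreal (exp (- (norm (w::'a))\<^sup>2 / 4)) = 0"
      by (subst (asm) nn_integral_0_iff_AE) auto
    then have "AE w in (lborel :: 'a measure). False" by eventually_elim (simp add: ennreal_eq_0_iff not_le)
    then have "emeasure (lborel :: 'a measure) (space lborel) = 0"
      unfolding eventually_False ae_filter_eq_bot_iff .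
    then show False by simp
  qed
  then show ?thesis
    unfolding nn_integral_gaussian by (simp add: ennreal_eq_0_iff not_le)
qed

lemma nn_integral_lborel_rescale:
  fixes x0 :: "'a::euclidean_space"
  assumes "f \<in> borel_measurable borel" "s > 0"
  shows "(\<integral>\<^sup>+ y. f y \<partial>lborel) = (\<integral>\<^sup>+ w. ennreal (s ^ DIM('a)) * f (x0 + s *\<^sub>R w) \<partial>lborel)"
proof -
  have "(\<integral>\<^sup>+ y. f y \<partial>lborel) =
    (\<integral>\<^sup>+ y. f y \<partial>density (distr lborel borel (\<lambda>x. x0 + s *\<^sub>R x)) (\<lambda>_. \<bar>s\<bar> ^ DIM('a)))"
    using lborel_affine[of s x0] assms by simp
  also have "\<dots> = (\<integral>\<^sup>+ w. ennreal (s ^ DIM('a)) * f (x0 + s *\<^sub>R w) \<partial>lborel)"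
    using assms by (simp add: nn_integral_density nn_integral_distr)
  finally show ?thesis .
qed

text \<open>The substitution y = x0 + sqrt \<theta> w turns kernel and volume factor into a Gaussian
  free of \<theta>, so limits as \<theta> tends to 0 become limits of integrands against a fixed
  weight.\<close>

lemma heat_kernel_rescale:
  fixes w :: "'a::euclidean_space"
  assumes "\<theta> > 0"
  shows "sqrt \<theta> ^ DIM('a) * heat_kernel \<theta> (sqrt \<theta> *\<^sub>R w) = exp (- (norm w)\<^sup>2 / 4)"
  using assms by (simp add: heat_kernel_def power_mult_distrib)

text \<open>One radius has to serve all \<theta> down to 0, where the prefactor \<theta>^(-n/2)
  blows up. Bounding the exponential by (4 n \<theta> / r^2)^n turns it into \<theta>^(n/2), which
  increases with \<theta>. Hence the truncated kernels of a whole range of \<theta> live in one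
  ball.\<close>

lemma heat_kernel_le_far_uniform:
  assumes "e > 0"
  obtains R where "R > 0" "\<And>(r::'a::euclidean_space) \<theta>. 0 < \<theta> \<Longrightarrow> \<theta> \<le> \<theta>2 \<Longrightarrow> norm r > R \<Longrightarrow> heat_kernel \<theta> r \<le> e"
proof -
  let ?n = "DIM('a)"
  \<comment> \<open>The summand 1 gives r > 1, hence r \<le> r^(2n). The other is the bound (4n)^n
    \<theta>^(n/2) with \<theta> replaced by |\<open>\<theta>2\<close>|, divided by the target
    \<open>e\<close>.\<close>
  define R where "R = 1 + (4 * real ?n) ^ ?n * sqrt \<bar>\<theta>2\<bar> ^ ?n / e"
  have R1: "R \<ge> 1" using assms by (simp add: R_def)
  show ?thesis
  proof (rule that[of R])
    show "R > 0" using R1 by simp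
    fix r :: 'a and \<theta> :: real
    assume th: "0 < \<theta>" "\<theta> \<le> \<theta>2" and r: "norm r > R"
    have rp: "norm r > 1" using r R1 by linarith
    have "((norm r)\<^sup>2 / (4 * \<theta>) / ?n) ^ ?n \<le> exp ((norm r)\<^sup>2 / (4 * \<theta>))"
      using th by (intro power_le_exp) auto
    then have "inverse (exp ((norm r)\<^sup>2 / (4 * \<theta>))) \<le> inverse (((norm r)\<^sup>2 / (4 * \<theta>) / ?n) ^ ?n)"
      using th rp by (intro le_imp_inverse_le zero_less_power divide_pos_pos mult_pos_pos) auto
    also have "inverse (((norm r)\<^sup>2 / (4 * \<theta>) / ?n) ^ ?n) = (4 * real ?n * \<theta> / (norm r)\<^sup>2) ^ ?n"
      by (simp add: power_inverse[symmetric] ac_simps)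
    finally have "exp (- (norm r)\<^sup>2 / (4 * \<theta>)) \<le> (4 * real ?n * \<theta> / (norm r)\<^sup>2) ^ ?n"
      by (simp add: exp_minus)
    then have "heat_kernel \<theta> r \<le> (4 * real ?n * \<theta> / (norm r)\<^sup>2) ^ ?n / sqrt \<theta> ^ ?n"
      unfolding heat_kernel_def using th by (intro divide_right_mono) auto
    also have "\<dots> = (4 * real ?n) ^ ?n * (\<theta> / sqrt \<theta>) ^ ?n / ((norm r)\<^sup>2) ^ ?n"
      by (simp add: power_mult_distrib power_divide)
    also have "\<dots> = (4 * real ?n) ^ ?n * sqrt \<theta> ^ ?n / ((norm r)\<^sup>2) ^ ?n"
      using th by (simp add: real_div_sqrt)
    also have "\<dots> \<le> (4 * real ?n) ^ ?n * sqrt \<bar>\<theta>2\<bar> ^ ?n / norm r"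
    proof (rule frac_le)
      have "norm r = norm r ^ 1" by simp
      also have "\<dots> \<le> norm r ^ (2 * ?n)"
        using rp DIM_positive[where 'a='a] by (intro power_increasing) (auto simp: Suc_leI)
      finally show "norm r \<le> ((norm r)\<^sup>2) ^ ?n" by (simp add: power_mult)
    qed (use th rp in \<open>auto intro!: mult_left_mono power_mono\<close>)
    also have "\<dots> \<le> e"
    proof -
      have "(4 * real ?n) ^ ?n * sqrt \<bar>\<theta>2\<bar> ^ ?n / e \<le> norm r" using r by (simp add: R_def)
      moreover have "0 < norm r" using rp by linarith
      ultimately show ?thesis using assms by (simp add: pos_divide_le_eq mult.commute)
    qed
    finally show "heat_kernel \<theta> r \<le> e" .
  qed
qed

lemma trunc_le:
  assumes "g > 0" "e > 0"
  shows "trunc e g \<le> g"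
proof -
  have "(max 0 (g - e)) ^ 3 \<le> g ^ 3" using assms by (intro power_mono) auto
  then show ?thesis unfolding trunc_def using assms by (simp add: divide_simps power3_eq_cube power2_eq_square)
qed

lemma tendsto_trunc:
  assumes "g > 0"
  shows "((\<lambda>e. trunc e g) \<longlongrightarrow> g) (at_right 0)"
proof -
  have "((\<lambda>e. (max 0 (g - e)) ^ 3 / g\<^sup>2) \<longlongrightarrow> (max 0 (g - 0)) ^ 3 / g\<^sup>2) (at_right 0)"
    using assms by (intro tendsto_intros) auto
  then show ?thesis using assms unfolding trunc_def by (simp add: max_def power3_eq_cube power2_eq_square)
qed

text \<open>Interpolation: for g > e the left side is 6 (g - e) (e/g)^2, and e/g < 1 allows the
  exponent 2 to be lowered to \<open>a\<close>. A positive power of \<open>e\<close> is bought by an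
  exponent of \<open>g\<close> below 1, a loss that \<open>heat_kernel_powr_le\<close>
  covers.\<close>

lemma trunc2_times_square_le:
  assumes "g > 0" "e > 0" "0 \<le> a" "a \<le> 1"
  shows "trunc2 e g * g\<^sup>2 \<le> 6 * e powr a * g powr (1 - a)"
proof (cases "g \<le> e")
  case True
  then show ?thesis using assms by (simp add: trunc_eq_0)
next
  case False
  have "trunc2 e g * g\<^sup>2 = 6 * (g - e) * (e / g)\<^sup>2"
    using False assms by (simp add: trunc2_def field_simps)
  also have "\<dots> \<le> 6 * g * (e / g)\<^sup>2" using assms False by (intro mult_right_mono) auto
  also have "(e / g)\<^sup>2 = (e / g) powr 2" using assms by (simp add: powr_numeral)
  also have "6 * g * (e / g) powr 2 \<le> 6 * g * (e / g) powr a"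
    using assms False by (intro mult_left_mono powr_mono') auto
  also have "\<dots> = 6 * e powr a * (g / g powr a)" using assms by (simp add: powr_divide)
  also have "g / g powr a = g powr (1 - a)" using assms by (simp add: powr_diff)
  finally show ?thesis .
qed

text \<open>Enlarging \<theta> by \<open>h\<close> slows the Gaussian decay, which leaves room both
  for the exponent 1 - a and for the factor |r|^2. The decay is still strictly faster as long as a <
  h / (\<theta> + h); \<open>a\<close> is half of this threshold at
  \<open>\<theta>2\<close>.\<close>

lemma heat_kernel_powr_le:
  assumes "0 < \<theta>1" "\<theta>1 \<le> \<theta>2" "h > 0"
  defines "a \<equiv> h / (2 * (\<theta>2 + h))"
  obtains C where "C > 0" "\<And>(r::'a::euclidean_space) \<theta>. \<theta> \<in> {\<theta>1..\<theta>2} \<Longrightarrow>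
    heat_kernel \<theta> r powr (1 - a) * (norm r / (2 * \<theta>))\<^sup>2 \<le> C * heat_kernel (\<theta> + h) r"
proof -
  let ?n = "DIM('a)"
  \<comment> \<open>The surplus in the Gaussian exponent, from (1 - a) (\<theta> + h) - \<theta>
    \<ge> h/2. The factor exp (- \<open>\<kappa>\<close> |r|^2) absorbs |r|^2.\<close>
  define \<kappa> where "\<kappa> = h / (8 * \<theta>2 * (\<theta>2 + h))"
  \<comment> \<open>A lower bound for \<theta>^(n/2) raised to 1 - a: the minimum with 1 ensures
    that lowering the exponent from 1 to 1 - a does not decrease the power of
    \<open>s1\<close>.\<close>
  define s1 where "s1 = min 1 (sqrt \<theta>1 ^ ?n)"
  define C where "C = (1 / s1) * (1 / \<kappa> / (2 * \<theta>1)\<^sup>2) * sqrt (\<theta>2 + h) ^ ?n"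
  have \<kappa>: "\<kappa> > 0" and s1: "s1 > 0" "s1 \<le> 1" using assms by (auto simp: \<kappa>_def s1_def)
  have a: "0 < a" "a < 1" using assms by (auto simp: a_def field_simps)
  have "C > 0" using assms \<kappa> s1 by (simp add: C_def)
  moreover have "heat_kernel \<theta> r powr (1 - a) * (norm r / (2 * \<theta>))\<^sup>2 \<le> C * heat_kernel (\<theta> + h) r"
    if th: "\<theta> \<in> {\<theta>1..\<theta>2}" for r :: 'a and \<theta>
  proof -
    let ?r = "(norm r)\<^sup>2"
    have pos: "\<theta> > 0" "\<theta> \<ge> \<theta>1" "\<theta> \<le> \<theta>2" using th assms by auto
    have s: "s1 \<le> (sqrt \<theta> ^ ?n) powr (1 - a)"
    proof -
      have "s1 = s1 powr 1" using s1 by simp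
      also have "\<dots> \<le> s1 powr (1 - a)" using s1 a by (intro powr_mono') auto
      also have "\<dots> \<le> (sqrt \<theta> ^ ?n) powr (1 - a)"
      proof (rule powr_mono2)
        have "sqrt \<theta>1 ^ ?n \<le> sqrt \<theta> ^ ?n" using pos assms by (intro power_mono) auto
        then show "s1 \<le> sqrt \<theta> ^ ?n" by (simp add: s1_def)
      qed (use a s1 in auto)
      finally show ?thesis .
    qed
    have ex: "(1 - a) / (4 * \<theta>) \<ge> \<kappa> + 1 / (4 * (\<theta> + h))"
    proof -
      have "a * (\<theta> + h) \<le> h / 2"
      proof -
        have "a * (\<theta> + h) \<le> a * (\<theta>2 + h)" using a pos by (intro mult_left_mono) auto
        also have "\<dots> = h / 2"
        proof -
          have "h / (2 * d) * d = h / 2" if "d \<noteq> 0" for d using that by simp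
          then show ?thesis using assms unfolding a_def by (metis add_pos_pos less_le_trans less_numeral_extra(3))
        qed
        finally show ?thesis .
      qed
      then have 1: "(1 - a) * (\<theta> + h) - \<theta> \<ge> h / 2" by (simp add: algebra_simps)
      have "\<kappa> \<le> h / (8 * \<theta> * (\<theta> + h))"
        unfolding \<kappa>_def using assms pos by (intro divide_left_mono mult_mono) auto
      also have "\<dots> = (h / 2) / (4 * \<theta> * (\<theta> + h))" by simp
      also have "\<dots> \<le> ((1 - a) * (\<theta> + h) - \<theta>) / (4 * \<theta> * (\<theta> + h))"
        using 1 assms pos by (intro divide_right_mono) auto
      also have "\<dots> = (1 - a) / (4 * \<theta>) - 1 / (4 * (\<theta> + h))"
        using assms pos by (simp add: diff_divide_distrib)
      finally show ?thesis by linarith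
    qed
    have "heat_kernel \<theta> r powr (1 - a) = exp (- ((1 - a) / (4 * \<theta>)) * ?r) / (sqrt \<theta> ^ ?n) powr (1 - a)"
      unfolding heat_kernel_def using pos
      by (subst powr_divide) (auto simp: exp_powr_real powr_def algebra_simps)
    also have "\<dots> \<le> exp (- (\<kappa> + 1 / (4 * (\<theta> + h))) * ?r) / s1"
    proof (rule frac_le)
      have "- ((1 - a) / (4 * \<theta>)) * ?r \<le> - (\<kappa> + 1 / (4 * (\<theta> + h))) * ?r"
        using ex by (intro mult_right_mono) auto
      then show "exp (- ((1 - a) / (4 * \<theta>)) * ?r) \<le> exp (- (\<kappa> + 1 / (4 * (\<theta> + h))) * ?r)"
        unfolding exp_le_cancel_iff .
    qed (use s s1 in auto)
    also have "exp (- (\<kappa> + 1 / (4 * (\<theta> + h))) * ?r) = exp (- (\<kappa> * ?r)) * exp (- ?r / (4 * (\<theta> + h)))"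
      by (simp add: exp_add[symmetric] algebra_simps add_divide_distrib)
    finally have 1: "heat_kernel \<theta> r powr (1 - a) \<le> exp (- (\<kappa> * ?r)) * exp (- ?r / (4 * (\<theta> + h))) / s1" .
    have 2: "(norm r / (2 * \<theta>))\<^sup>2 * exp (- (\<kappa> * ?r)) \<le> 1 / \<kappa> / (2 * \<theta>1)\<^sup>2"
    proof -
      have "\<kappa> * ?r \<le> exp (\<kappa> * ?r)" using exp_ge_add_one_self[of "\<kappa> * ?r"] by linarith
      then have "?r * exp (- (\<kappa> * ?r)) \<le> 1 / \<kappa>" using \<kappa> by (simp add: exp_minus field_simps)
      then have "?r * exp (- (\<kappa> * ?r)) / (2 * \<theta>)\<^sup>2 \<le> 1 / \<kappa> / (2 * \<theta>1)\<^sup>2"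
        using pos assms \<kappa> by (intro frac_le) auto
      then show ?thesis by (simp add: power_divide)
    qed
    have "heat_kernel \<theta> r powr (1 - a) * (norm r / (2 * \<theta>))\<^sup>2
      \<le> (exp (- (\<kappa> * ?r)) * exp (- ?r / (4 * (\<theta> + h))) / s1) * (norm r / (2 * \<theta>))\<^sup>2"
      by (rule mult_right_mono[OF 1]) simp
    also have "\<dots> = (1 / s1) * ((norm r / (2 * \<theta>))\<^sup>2 * exp (- (\<kappa> * ?r))) * exp (- ?r / (4 * (\<theta> + h)))" by simp
    also have "\<dots> \<le> (1 / s1) * (1 / \<kappa> / (2 * \<theta>1)\<^sup>2) * exp (- ?r / (4 * (\<theta> + h)))"
      using s1 by (intro mult_right_mono mult_left_mono 2) auto
    also have "\<dots> = (1 / s1) * (1 / \<kappa> / (2 * \<theta>1)\<^sup>2) * sqrt (\<theta> + h) ^ ?n * heat_kernel (\<theta> + h) r"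
      using pos assms by (simp add: heat_kernel_def)
    also have "\<dots> \<le> C * heat_kernel (\<theta> + h) r"
      unfolding C_def using pos assms s1 \<kappa>
      by (intro mult_right_mono mult_left_mono power_mono less_imp_le[OF heat_kernel_pos]) auto
    finally show ?thesis .
  qed
  ultimately show ?thesis using that by blast
qed

section \<open>The heat semigroup identity\<close>

context ancient_heat
begin

lemma continuous_on_compose_spacetime:
  assumes "continuous_on (UNIV \<times> {..0}) (\<lambda>(x, t). v x t)"
    and "continuous_on S f" "continuous_on S g" "\<And>z. z \<in> S \<Longrightarrow> g z \<le> (0::real)"
  shows "continuous_on S (\<lambda>z. v (f z) (g z))"
  using continuous_on_compose2[OF assms(1), of S "\<lambda>z. (f z, g z)"] assms(2-4)
  by (auto intro!: continuous_intros)

lemmas continuous_on_u = continuous_on_compose_spacetime[OF cont_u]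
lemmas continuous_on_p = continuous_on_compose_spacetime[OF cont_p]
lemmas continuous_on_q = continuous_on_compose_spacetime[OF cont_q]

text \<open>Green's identity. The sum of the \<open>W b\<close> is the divergence of the flux,
  \<beta>''(K) |\<nabla>K|^2 u + \<beta>'(K) \<Delta>K u - \<beta>(K) \<Delta>u, and integrates to 0
  since \<beta>(K) vanishes far out. The heat equation for the kernel gives \<Delta>K the form in
  the statement, and |\<nabla>K| is |y - x0| K / (2 \<theta>).\<close>

lemma integral_heat_operator_truncated_kernel:
  fixes x0 :: 'a
  assumes "\<theta> > 0" "t \<le> 0"
    and far: "\<And>r::'a. norm r > R \<Longrightarrow> heat_kernel \<theta> r \<le> e"
    and box: "cball x0 (R + 1) \<subseteq> cbox a c"
  defines "K \<equiv> \<lambda>y. heat_kernel \<theta> (y - x0)"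
  shows "integral (cbox a c) (\<lambda>y.
      trunc1 e (K y) * (((norm (y - x0))\<^sup>2 / (4 * \<theta>\<^sup>2) - DIM('a) / (2 * \<theta>)) * K y) * u y t
        - trunc e (K y) * (\<Sum>b\<in>Basis. q b y t)) =
    - integral (cbox a c) (\<lambda>y. trunc2 e (K y) * (norm (y - x0) / (2 * \<theta>) * K y)\<^sup>2 * u y t)"
proof -
  define Kb where "Kb b y = - ((y - x0) \<bullet> b) / (2 * \<theta>) * K y" for b y
  define Kbb where "Kbb b y = (((y - x0) \<bullet> b)\<^sup>2 / (4 * \<theta>\<^sup>2) - 1 / (2 * \<theta>)) * K y" for b y
  \<comment> \<open>The flux \<beta>'(K) \<partial>K u - \<beta>(K) \<partial>u. In its derivative
    \<open>W\<close> the mixed terms \<beta>'(K) \<partial>K \<partial>u cancel.\<close>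
  define V where "V b y = trunc1 e (K y) * Kb b y * u y t - trunc e (K y) * p b y t" for b y
  define W where "W b y = (trunc2 e (K y) * (Kb b y)\<^sup>2 + trunc1 e (K y) * Kbb b y) * u y t
     - trunc e (K y) * q b y t" for b y
  define Q where "Q y = trunc2 e (K y) * (norm (y - x0) / (2 * \<theta>) * K y)\<^sup>2 * u y t" for y
  have Kpos: "K y > 0" for y unfolding K_def using assms heat_kernel_pos by blast
  have contK: "continuous_on S K" for S
    unfolding K_def using assms by (intro continuous_intros) auto
  have contu: "continuous_on S (\<lambda>y. u y t)" for S
    using assms by (intro continuous_on_u continuous_intros) auto
  have contp: "b \<in> Basis \<Longrightarrow> continuous_on S (\<lambda>y. p b y t)" for S b
    using assms by (intro continuous_on_p continuous_intros) auto
  have contq: "b \<in> Basis \<Longrightarrow> continuous_on S (\<lambda>y. q b y t)" for S b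
    using assms by (intro continuous_on_q continuous_intros) auto
  have contKb: "continuous_on S (Kb b)" "continuous_on S (Kbb b)" for S b
    unfolding Kb_def Kbb_def using assms by (auto intro!: continuous_intros contK)
  have contW: "b \<in> Basis \<Longrightarrow> continuous_on S (W b)" for S b
    unfolding W_def by (intro continuous_intros contK contu contq contKb Kpos) auto
  have contV: "b \<in> Basis \<Longrightarrow> continuous_on S (V b)" for S b
    unfolding V_def by (intro continuous_intros contK contu contp contKb Kpos) auto
  have contQ: "continuous_on S Q" for S
    unfolding Q_def using assms by (intro continuous_intros contK contu contKb Kpos) auto
  have dK: "((\<lambda>h. K (y + h *\<^sub>R b)) has_real_derivative Kb b y) (at 0)" if "b \<in> Basis" for b y
    using heat_kernel_deriv_space[OF assms(1), of "y - x0" b]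
    by (simp add: K_def Kb_def algebra_simps)
  have dKb: "((\<lambda>h. Kb b (y + h *\<^sub>R b)) has_real_derivative Kbb b y) (at 0)" if "b \<in> Basis" for b y
  proof -
    have "y + h *\<^sub>R b - x0 = (y - x0) + h *\<^sub>R b" for h by simp
    then show ?thesis
      using heat_kernel_deriv2_space[OF assms(1) that, of "y - x0"]
      by (simp only: K_def Kb_def Kbb_def)
  qed
  have dT: "((\<lambda>h. trunc e (K (y + h *\<^sub>R b))) has_real_derivative trunc1 e (K y) * Kb b y) (at 0)"
    if "b \<in> Basis" for b y
    using DERIV_chain2[where f="trunc e" and g="\<lambda>h. K (y + h *\<^sub>R b)" and x=0, OF _ dK[OF that]]
      DERIV_trunc[OF Kpos] by simp
  have dT1: "((\<lambda>h. trunc1 e (K (y + h *\<^sub>R b))) has_real_derivative trunc2 e (K y) * Kb b y) (at 0)"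
    if "b \<in> Basis" for b y
    using DERIV_chain2[where f="trunc1 e" and g="\<lambda>h. K (y + h *\<^sub>R b)" and x=0, OF _ dK[OF that]]
      DERIV_trunc1[OF Kpos] by simp
  have dV: "((\<lambda>h. V b (y + h *\<^sub>R b)) has_real_derivative W b y) (at 0)" if b: "b \<in> Basis" for b y
    unfolding V_def
    by (rule DERIV_cong[OF DERIV_diff[OF DERIV_mult[OF DERIV_mult[OF dT1[OF b] dKb[OF b]] deriv_u[OF b assms(2)]]
          DERIV_mult[OF dT[OF b] deriv_p[OF b assms(2)]]]])
      (simp add: W_def algebra_simps power2_eq_square)
  have IW: "integral (cbox a c) (W b) = 0" if b: "b \<in> Basis" for b
  proof (rule integral_directional_derivative_eq_0[where V="V b" and b=b and ?x0.0=x0 and R=R])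
    show "V b y = 0" if "R < dist y x0" for y
      using far[of "y - x0"] that by (simp add: V_def K_def dist_norm trunc_eq_0)
  qed (use b contV contW dV box in auto)
  have sq: "(\<Sum>b\<in>Basis. ((y - x0) \<bullet> b)\<^sup>2) = (norm (y - x0))\<^sup>2" for y
    unfolding power2_norm_eq_inner using euclidean_inner[of "y - x0" "y - x0"] by (simp add: power2_eq_square)
  have S1: "(\<Sum>b\<in>Basis. (Kb b y)\<^sup>2) = (norm (y - x0) / (2 * \<theta>) * K y)\<^sup>2" for y
    unfolding Kb_def power_mult_distrib power_divide power2_minus
    by (simp add: sum_distrib_right[symmetric] sum_divide_distrib[symmetric] sq)
  have S2: "(\<Sum>b\<in>Basis. Kbb b y) = ((norm (y - x0))\<^sup>2 / (4 * \<theta>\<^sup>2) - DIM('a) / (2 * \<theta>)) * K y" for y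
    unfolding Kbb_def
    by (simp add: sum_distrib_right[symmetric] sum_subtractf sum_divide_distrib[symmetric] sq)
  have "trunc1 e (K y) * (((norm (y - x0))\<^sup>2 / (4 * \<theta>\<^sup>2) - DIM('a) / (2 * \<theta>)) * K y) * u y t
        - trunc e (K y) * (\<Sum>b\<in>Basis. q b y t) = (\<Sum>b\<in>Basis. W b y) - Q y" for y
  proof -
    have "(\<Sum>b\<in>Basis. W b y) = (trunc2 e (K y) * (\<Sum>b\<in>Basis. (Kb b y)\<^sup>2) + trunc1 e (K y) * (\<Sum>b\<in>Basis. Kbb b y)) * u y t
       - trunc e (K y) * (\<Sum>b\<in>Basis. q b y t)"
      unfolding W_def by (simp add: sum_subtractf sum_distrib_left sum_distrib_right sum.distrib algebra_simps)
    then show ?thesis unfolding S1 S2 Q_def by (simp add: algebra_simps)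
  qed
  then have "integral (cbox a c) (\<lambda>y.
      trunc1 e (K y) * (((norm (y - x0))\<^sup>2 / (4 * \<theta>\<^sup>2) - DIM('a) / (2 * \<theta>)) * K y) * u y t
        - trunc e (K y) * (\<Sum>b\<in>Basis. q b y t)) = integral (cbox a c) (\<lambda>y. (\<Sum>b\<in>Basis. W b y) - Q y)"
    by simp
  also have "\<dots> = integral (cbox a c) (\<lambda>y. \<Sum>b\<in>Basis. W b y) - integral (cbox a c) Q"
    by (intro Henstock_Kurzweil_Integration.integral_diff integrable_continuous continuous_on_sum contW contQ)
  also have "integral (cbox a c) (\<lambda>y. \<Sum>b\<in>Basis. W b y) = (\<Sum>b\<in>Basis. integral (cbox a c) (W b))"
    by (intro Henstock_Kurzweil_Integration.integral_sum integrable_continuous contW) auto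
  also have "\<dots> = 0" using IW by simp
  finally show ?thesis unfolding Q_def by simp
qed

text \<open>Time t0 - \<theta> runs backwards, so \<open>u\<close> contributes - \<Delta>u; with the
  kernel's own \<theta>-derivative this is the integrand of Green's identity. A single box works
  because the support bound is uniform in \<theta>.\<close>

lemma truncated_average_deriv:
  fixes x0 :: 'a
  assumes "t0 \<le> 0" "0 < \<theta>1" "\<theta> \<in> {\<theta>1..\<theta>2}"
    and far: "\<And>r::'a. \<And>\<theta>. \<theta> \<in> {\<theta>1..\<theta>2} \<Longrightarrow> norm r > R \<Longrightarrow> heat_kernel \<theta> r \<le> e"
    and box: "cball x0 (R + 1) \<subseteq> cbox a c"
  shows "((\<lambda>\<theta>. integral (cbox a c) (\<lambda>y. trunc e (heat_kernel \<theta> (y - x0)) * u y (t0 - \<theta>)))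
    has_real_derivative - integral (cbox a c) (\<lambda>y. trunc2 e (heat_kernel \<theta> (y - x0)) *
      (norm (y - x0) / (2 * \<theta>) * heat_kernel \<theta> (y - x0))\<^sup>2 * u y (t0 - \<theta>))) (at \<theta> within {\<theta>1..\<theta>2})"
proof -
  let ?K = "\<lambda>\<theta> y. heat_kernel \<theta> (y - x0)"
  let ?D = "\<lambda>\<theta> y. trunc1 e (?K \<theta> y) * (((norm (y - x0))\<^sup>2 / (4 * \<theta>\<^sup>2) - DIM('a) / (2 * \<theta>)) * ?K \<theta> y) * u y (t0 - \<theta>)
        - trunc e (?K \<theta> y) * (\<Sum>b\<in>Basis. q b y (t0 - \<theta>))"
  have pos: "s > 0" "t0 - s \<le> 0" if "s \<in> {\<theta>1..\<theta>2}" for s using that assms by auto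
  have du: "((\<lambda>s. u y (t0 - s)) has_real_derivative - (\<Sum>b\<in>Basis. q b y (t0 - s))) (at s within {\<theta>1..\<theta>2})"
    if "s \<in> {\<theta>1..\<theta>2}" for s y
  proof -
    have "(u y has_real_derivative (\<Sum>b\<in>Basis. q b y (t0 - s))) (at (t0 - s) within (\<lambda>s. t0 - s) ` {\<theta>1..\<theta>2})"
      by (rule DERIV_subset[OF deriv_t]) (use pos that in auto)
    moreover have "((\<lambda>s. t0 - s) has_real_derivative -1) (at s within {\<theta>1..\<theta>2})"
      by (auto intro!: derivative_eq_intros)
    ultimately show ?thesis
      using DERIV_image_chain[where f="u y" and g="\<lambda>s. t0 - s"] by (force simp: o_def)
  qed
  have dT: "((\<lambda>s. trunc e (?K s y)) has_real_derivative
      trunc1 e (?K s y) * (((norm (y - x0))\<^sup>2 / (4 * s\<^sup>2) - DIM('a) / (2 * s)) * ?K s y)) (at s within {\<theta>1..\<theta>2})"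
    if "s \<in> {\<theta>1..\<theta>2}" for s y
    by (rule has_field_derivative_at_within)
      (rule DERIV_chain2[where f="trunc e", OF DERIV_trunc heat_kernel_deriv_time], use pos that heat_kernel_pos in auto)
  have "((\<lambda>\<theta>. integral (cbox a c) (\<lambda>y. trunc e (?K \<theta> y) * u y (t0 - \<theta>)))
    has_real_derivative integral (cbox a c) (?D \<theta>)) (at \<theta> within {\<theta>1..\<theta>2})"
  proof (rule leibniz_rule_field_derivative)
    show "((\<lambda>s. trunc e (?K s y) * u y (t0 - s)) has_real_derivative ?D s y) (at s within {\<theta>1..\<theta>2})"
      if "s \<in> {\<theta>1..\<theta>2}" for s y
      by (rule DERIV_cong[OF DERIV_mult[OF dT du]]) (use that in \<open>auto simp: algebra_simps\<close>)
    show "(\<lambda>y. trunc e (?K s y) * u y (t0 - s)) integrable_on cbox a c" if "s \<in> {\<theta>1..\<theta>2}" for s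
      by (intro integrable_continuous continuous_intros continuous_on_u) (use pos that heat_kernel_pos in auto)
    show "continuous_on ({\<theta>1..\<theta>2} \<times> cbox a c) (\<lambda>(s, y). ?D s y)"
      unfolding split_beta
      by (intro continuous_intros continuous_on_u continuous_on_q)
        (use pos in \<open>auto simp: less_imp_neq[symmetric] intro!: heat_kernel_pos\<close>)
  qed (use assms in auto)
  also have "integral (cbox a c) (?D \<theta>) = - integral (cbox a c) (\<lambda>y. trunc2 e (?K \<theta> y) *
      (norm (y - x0) / (2 * \<theta>) * ?K \<theta> y)\<^sup>2 * u y (t0 - \<theta>))"
    by (rule integral_heat_operator_truncated_kernel[where R=R]) (use assms pos in auto)
  finally show ?thesis .
qed

end

section \<open>Monotonicity of the averages\<close>

lemma nn_integral_eq_integral_cbox: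
  fixes f :: "'a::euclidean_space \<Rightarrow> real"
  assumes "continuous_on UNIV f" "\<And>y. f y \<ge> 0" "\<And>y. y \<notin> cbox a c \<Longrightarrow> f y = 0"
  shows "(\<integral>\<^sup>+ y. ennreal (f y) \<partial>lborel) = ennreal (integral (cbox a c) f)"
proof -
  have i: "set_integrable lborel (cbox a c) f"
    unfolding set_integrable_def
    by (rule borel_integrable_compact) (auto intro: continuous_on_subset[OF assms(1)])
  have e: "(\<lambda>y. indicator (cbox a c) y *\<^sub>R f y) = f" by (intro ext) (auto simp: indicator_def assms(3))
  have "integrable lborel f" using i unfolding set_integrable_def e .
  then have "(\<integral>\<^sup>+ y. ennreal (f y) \<partial>lborel) = ennreal (LINT y|lborel. f y)"
    by (rule nn_integral_eq_integral) (use assms in auto)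
  also have "(LINT y|lborel. f y) = integral (cbox a c) f"
    using set_borel_integral_eq_integral(2)[OF i] unfolding set_lebesgue_integral_def e .
  finally show ?thesis .
qed

context ancient_heat
begin

definition truncated_average :: "real \<Rightarrow> 'a \<Rightarrow> real \<Rightarrow> real \<Rightarrow> ennreal" where
  "truncated_average e x0 t0 \<theta> =
    (\<integral>\<^sup>+ y. ennreal (trunc e (heat_kernel \<theta> (y - x0)) * u y (t0 - \<theta>)) \<partial>lborel)"

text \<open>Valued in \<open>ennreal\<close> because finiteness is a result, obtained from
  \<open>average_le\<close>.\<close>

definition average :: "'a \<Rightarrow> real \<Rightarrow> real \<Rightarrow> ennreal" where
  "average x0 t0 \<theta> = (\<integral>\<^sup>+ y. ennreal (heat_kernel \<theta> (y - x0) * u y (t0 - \<theta>)) \<partial>lborel)"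

text \<open>The integral of \<beta>''(K) |\<nabla>K|^2 u, with |\<nabla>K| written out.\<close>

definition dissipation :: "real \<Rightarrow> 'a \<Rightarrow> real \<Rightarrow> real \<Rightarrow> ennreal" where
  "dissipation e x0 t0 \<theta> = (\<integral>\<^sup>+ y. ennreal (trunc2 e (heat_kernel \<theta> (y - x0)) *
      (norm (y - x0) / (2 * \<theta>) * heat_kernel \<theta> (y - x0))\<^sup>2 * u y (t0 - \<theta>)) \<partial>lborel)"

lemma continuous_on_u_slice: "t \<le> 0 \<Longrightarrow> continuous_on S (\<lambda>y. u y t)"
  by (intro continuous_on_u continuous_intros) auto

lemma measurable_u [measurable]: "t \<le> 0 \<Longrightarrow> (\<lambda>y. u y t) \<in> borel_measurable borel"
  by (intro borel_measurable_continuous_onI continuous_on_u_slice)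

text \<open>The mean value theorem replaces integration in \<theta>: a bound on the dissipation that
  is uniform in \<theta> over the interval suffices to use the identity at the unspecified
  intermediate point.\<close>

lemma truncated_average_diff:
  assumes "t0 \<le> 0" "0 < \<theta>1" "\<theta>1 < \<theta>2" "e > 0"
  obtains \<theta> where "\<theta> \<in> {\<theta>1<..<\<theta>2}"
    "truncated_average e x0 t0 \<theta>1 =
      truncated_average e x0 t0 \<theta>2 + ennreal (\<theta>2 - \<theta>1) * dissipation e x0 t0 \<theta>"
proof -
  obtain R where R: "\<And>(r::'a) \<theta>. 0 < \<theta> \<Longrightarrow> \<theta> \<le> \<theta>2 \<Longrightarrow> norm r > R \<Longrightarrow> heat_kernel \<theta> r \<le> e"
    using heat_kernel_le_far_uniform[OF assms(4)] by metis
  obtain a c where box: "cball x0 (R + 1) \<subseteq> cbox a c"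
    using bounded_subset_cbox_symmetric[OF bounded_cball] by metis
  let ?K = "\<lambda>\<theta> y. heat_kernel \<theta> (y - x0)"
  define F where "F \<theta> = integral (cbox a c) (\<lambda>y. trunc e (?K \<theta> y) * u y (t0 - \<theta>))" for \<theta>
  define D where "D \<theta> = integral (cbox a c) (\<lambda>y. trunc2 e (?K \<theta> y) *
      (norm (y - x0) / (2 * \<theta>) * ?K \<theta> y)\<^sup>2 * u y (t0 - \<theta>))" for \<theta>
  have out: "?K \<theta> y \<le> e" if "y \<notin> cbox a c" "0 < \<theta>" "\<theta> \<le> \<theta>2" for y \<theta>
  proof (rule R[OF that(2,3)])
    have "y \<notin> cball x0 (R + 1)" using that(1) box by blast
    then show "norm (y - x0) > R" by (simp add: dist_norm norm_minus_commute)
  qed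
  have F: "truncated_average e x0 t0 \<theta> = ennreal (F \<theta>)" if "0 < \<theta>" "\<theta> \<le> \<theta>2" for \<theta>
    unfolding truncated_average_def F_def
  proof (rule nn_integral_eq_integral_cbox)
    show "continuous_on UNIV (\<lambda>y. trunc e (?K \<theta> y) * u y (t0 - \<theta>))"
      by (intro continuous_intros continuous_on_u_slice) (use that assms in \<open>auto intro!: heat_kernel_pos\<close>)
  qed (use that assms nonneg out in \<open>auto intro!: mult_nonneg_nonneg trunc_nonneg simp: trunc_eq_0\<close>)
  have D: "dissipation e x0 t0 \<theta> = ennreal (D \<theta>)" if "0 < \<theta>" "\<theta> \<le> \<theta>2" for \<theta>
    unfolding dissipation_def D_def
  proof (rule nn_integral_eq_integral_cbox)
    show "continuous_on UNIV (\<lambda>y. trunc2 e (?K \<theta> y) * (norm (y - x0) / (2 * \<theta>) * ?K \<theta> y)\<^sup>2 * u y (t0 - \<theta>))"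
      by (intro continuous_intros continuous_on_u_slice) (use that assms in \<open>auto intro!: heat_kernel_pos\<close>)
  qed (use that assms nonneg out in \<open>auto intro!: mult_nonneg_nonneg trunc2_nonneg simp: trunc_eq_0\<close>)
  have dF: "(F has_real_derivative - D \<theta>) (at \<theta> within {\<theta>1..\<theta>2})" if "\<theta> \<in> {\<theta>1..\<theta>2}" for \<theta>
    unfolding F_def D_def
    by (rule truncated_average_deriv[where R=R]) (use that assms R box in auto)
  obtain \<theta> where th: "\<theta> \<in> {\<theta>1<..<\<theta>2}" "F \<theta>2 - F \<theta>1 = - D \<theta> * (\<theta>2 - \<theta>1)"
    using mvt_simple[OF assms(3), of F "\<lambda>\<theta>. (*) (- D \<theta>)"] dF unfolding has_field_derivative_def by auto
  have "D \<theta> \<ge> 0"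
    unfolding D_def
    by (rule Henstock_Kurzweil_Integration.integral_nonneg, intro integrable_continuous continuous_intros continuous_on_u_slice)
       (use th(1) assms nonneg in \<open>auto intro!: heat_kernel_pos mult_nonneg_nonneg trunc2_nonneg\<close>)
  moreover have "F \<theta>2 \<ge> 0"
    unfolding F_def
    by (rule Henstock_Kurzweil_Integration.integral_nonneg, intro integrable_continuous continuous_intros continuous_on_u_slice)
       (use assms nonneg in \<open>auto intro!: heat_kernel_pos mult_nonneg_nonneg trunc_nonneg\<close>)
  moreover have "F \<theta>1 = F \<theta>2 + (\<theta>2 - \<theta>1) * D \<theta>" using th(2) by (simp add: algebra_simps)
  ultimately have "truncated_average e x0 t0 \<theta>1 =
      truncated_average e x0 t0 \<theta>2 + ennreal (\<theta>2 - \<theta>1) * dissipation e x0 t0 \<theta>"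
    using assms th(1) by (simp add: F D ennreal_mult')
  then show ?thesis using that th(1) by blast
qed

lemma truncated_average_antimono:
  assumes "t0 \<le> 0" "0 < \<theta>1" "\<theta>1 \<le> \<theta>2" "e > 0"
  shows "truncated_average e x0 t0 \<theta>2 \<le> truncated_average e x0 t0 \<theta>1"
proof (cases "\<theta>1 = \<theta>2")
  case False
  then have "\<theta>1 < \<theta>2" using assms by simp
  from truncated_average_diff[OF assms(1,2) this assms(4), of x0] show ?thesis by (metis le_iff_add)
qed simp

lemma average_rescale:
  assumes "t0 \<le> 0" "\<theta> > 0"
  shows "average x0 t0 \<theta> = (\<integral>\<^sup>+ w. ennreal (exp (- (norm w)\<^sup>2 / 4) * u (x0 + sqrt \<theta> *\<^sub>R w) (t0 - \<theta>)) \<partial>lborel)"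
proof -
  have "t0 - \<theta> \<le> 0" using assms by simp
  have m: "(\<lambda>y. ennreal (heat_kernel \<theta> (y - x0) * u y (t0 - \<theta>))) \<in> borel_measurable borel"
    unfolding heat_kernel_def using \<open>t0 - \<theta> \<le> 0\<close> by measurable
  have "sqrt \<theta> > 0" using assms by simp
  show ?thesis
    unfolding average_def nn_integral_lborel_rescale[OF m \<open>sqrt \<theta> > 0\<close>, of x0]
  proof (intro nn_integral_cong)
    fix w :: 'a
    have "ennreal (sqrt \<theta> ^ DIM('a)) * ennreal (heat_kernel \<theta> (x0 + sqrt \<theta> *\<^sub>R w - x0) * u (x0 + sqrt \<theta> *\<^sub>R w) (t0 - \<theta>))
      = ennreal (sqrt \<theta> ^ DIM('a) * (heat_kernel \<theta> (sqrt \<theta> *\<^sub>R w) * u (x0 + sqrt \<theta> *\<^sub>R w) (t0 - \<theta>)))"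
      using assms by (subst ennreal_mult'[symmetric]) auto
    also have "sqrt \<theta> ^ DIM('a) * (heat_kernel \<theta> (sqrt \<theta> *\<^sub>R w) * u (x0 + sqrt \<theta> *\<^sub>R w) (t0 - \<theta>))
       = exp (- (norm w)\<^sup>2 / 4) * u (x0 + sqrt \<theta> *\<^sub>R w) (t0 - \<theta>)"
      using heat_kernel_rescale[OF assms(2), of w] by (simp add: mult.assoc[symmetric])
    finally show "ennreal (sqrt \<theta> ^ DIM('a)) * ennreal (heat_kernel \<theta> (x0 + sqrt \<theta> *\<^sub>R w - x0) * u (x0 + sqrt \<theta> *\<^sub>R w) (t0 - \<theta>))
      = ennreal (exp (- (norm w)\<^sup>2 / 4) * u (x0 + sqrt \<theta> *\<^sub>R w) (t0 - \<theta>))" .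
  qed
qed

lemma tendsto_u_rescaled:
  assumes "t0 \<le> 0" "\<And>k. \<delta> k > 0" "\<delta> \<longlonglongrightarrow> 0"
  shows "(\<lambda>k. u (x0 + sqrt (\<delta> k) *\<^sub>R w) (t0 - \<delta> k)) \<longlonglongrightarrow> u x0 t0"
proof -
  have "((\<lambda>k. (\<lambda>(x, t). u x t) (x0 + sqrt (\<delta> k) *\<^sub>R w, t0 - \<delta> k))) \<longlonglongrightarrow> (\<lambda>(x, t). u x t) (x0 + sqrt 0 *\<^sub>R w, t0 - 0)"
  proof (rule continuous_on_tendsto_compose[OF cont_u])
    show "((\<lambda>k. (x0 + sqrt (\<delta> k) *\<^sub>R w, t0 - \<delta> k)) \<longlonglongrightarrow> (x0 + sqrt 0 *\<^sub>R w, t0 - 0))"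
      by (intro tendsto_intros assms)
    show "\<forall>\<^sub>F k in sequentially. (x0 + sqrt (\<delta> k) *\<^sub>R w, t0 - \<delta> k) \<in> UNIV \<times> {..0}"
      using assms(1,2) by (auto intro!: always_eventually simp: less_imp_le add_increasing2 order_trans)
  qed (use assms in auto)
  then show ?thesis by simp
qed

text \<open>Compare with times shrinking to 0. The truncation confines everything to a fixed ball,
  where it may be replaced by the full kernel; after rescaling, \<open>u\<close> is evaluated on a
  compact set, and dominated convergence yields the Gaussian mass times the value at the
  centre.\<close>

lemma truncated_average_le:
  assumes "t0 \<le> 0" "0 < \<theta>" "e > 0"
  shows "truncated_average e x0 t0 \<theta> \<le> ennreal (gaussian_mass TYPE('a) * u x0 t0)"
proof -
  obtain R where R0: "R > 0" and R: "\<And>(r::'a) s. 0 < s \<Longrightarrow> s \<le> \<theta> \<Longrightarrow> norm r > R \<Longrightarrow> heat_kernel s r \<le> e"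
    using heat_kernel_le_far_uniform[OF assms(3)] by metis
  define \<delta> where "\<delta> k = \<theta> / real (Suc k)" for k
  have \<delta>: "\<delta> k > 0" "\<delta> k \<le> \<theta>" for k using assms by (auto simp: \<delta>_def field_simps)
  have \<delta>0: "\<delta> \<longlonglongrightarrow> 0"
    unfolding \<delta>_def using tendsto_mult[OF tendsto_const[of \<theta>] LIMSEQ_inverse_real_of_nat] by (simp add: field_simps)
  \<comment> \<open>Continuity bounds \<open>u\<close> on this compact cylinder, which contains
    every space-time point that the ball cut-off lets through.\<close>
  define S where "S = cball x0 R \<times> {t0 - \<theta>..t0}"
  have "compact S" unfolding S_def by (intro compact_Times) auto
  then have "compact ((\<lambda>(x, t). u x t) ` S)"
    using assms by (intro compact_continuous_image continuous_on_subset[OF cont_u]) (auto simp: S_def)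
  then obtain M where M: "\<And>x t. (x, t) \<in> S \<Longrightarrow> u x t \<le> M" "M > 0"
    by (metis (no_types, lifting) abs_le_D1 bounded_pos case_prod_conv compact_imp_bounded imageI real_norm_def)
  define f where "f k w = indicator (cball x0 R) (x0 + sqrt (\<delta> k) *\<^sub>R w) *
     (exp (- (norm w)\<^sup>2 / 4) * u (x0 + sqrt (\<delta> k) *\<^sub>R w) (t0 - \<delta> k))" for k w
  have le: "truncated_average e x0 t0 \<theta> \<le> (\<integral>\<^sup>+ w. ennreal (f k w) \<partial>lborel)" for k
  proof -
    have tk: "t0 - \<delta> k \<le> 0" using \<delta>[of k] assms by simp
    let ?g = "\<lambda>y. ennreal (indicator (cball x0 R) y * (heat_kernel (\<delta> k) (y - x0) * u y (t0 - \<delta> k)))"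
    have m: "?g \<in> borel_measurable borel"
    proof -
      note measurable_u[OF tk, measurable]
      have [measurable]: "cball x0 R \<in> sets borel" by simp
      show ?thesis unfolding heat_kernel_def by measurable
    qed
    have "truncated_average e x0 t0 \<theta> \<le> truncated_average e x0 t0 (\<delta> k)"
      by (rule truncated_average_antimono) (use assms \<delta> in auto)
    also have "\<dots> \<le> (\<integral>\<^sup>+ y. ?g y \<partial>lborel)"
      unfolding truncated_average_def
    proof (intro nn_integral_mono ennreal_leI)
      fix y
      show "trunc e (heat_kernel (\<delta> k) (y - x0)) * u y (t0 - \<delta> k)
        \<le> indicator (cball x0 R) y * (heat_kernel (\<delta> k) (y - x0) * u y (t0 - \<delta> k))"
      proof (cases "y \<in> cball x0 R")
        case True
        then show ?thesis using tk \<delta> assms by (auto intro!: mult_right_mono trunc_le heat_kernel_pos nonneg)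
      next
        case False
        then have "heat_kernel (\<delta> k) (y - x0) \<le> e"
          using \<delta> by (intro R) (auto simp: dist_norm norm_minus_commute)
        then show ?thesis using False by (simp add: trunc_eq_0)
      qed
    qed
    also have "\<dots> = (\<integral>\<^sup>+ w. ennreal (sqrt (\<delta> k) ^ DIM('a)) * ?g (x0 + sqrt (\<delta> k) *\<^sub>R w) \<partial>lborel)"
      by (rule nn_integral_lborel_rescale[OF m]) (use \<delta> in auto)
    also have "\<dots> = (\<integral>\<^sup>+ w. ennreal (f k w) \<partial>lborel)"
    proof (intro nn_integral_cong)
      fix w
      have "ennreal (sqrt (\<delta> k) ^ DIM('a)) * ?g (x0 + sqrt (\<delta> k) *\<^sub>R w) =
        ennreal (sqrt (\<delta> k) ^ DIM('a) * (indicator (cball x0 R) (x0 + sqrt (\<delta> k) *\<^sub>R w) *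
          (heat_kernel (\<delta> k) (sqrt (\<delta> k) *\<^sub>R w) * u (x0 + sqrt (\<delta> k) *\<^sub>R w) (t0 - \<delta> k))))"
        using \<delta>(1)[of k] by (subst ennreal_mult'[symmetric]) auto
      also have "sqrt (\<delta> k) ^ DIM('a) * (indicator (cball x0 R) (x0 + sqrt (\<delta> k) *\<^sub>R w) *
          (heat_kernel (\<delta> k) (sqrt (\<delta> k) *\<^sub>R w) * u (x0 + sqrt (\<delta> k) *\<^sub>R w) (t0 - \<delta> k))) = f k w"
        unfolding f_def heat_kernel_rescale[OF \<delta>(1)[of k], of w, symmetric] by (simp add: ac_simps)
      finally show "ennreal (sqrt (\<delta> k) ^ DIM('a)) * ?g (x0 + sqrt (\<delta> k) *\<^sub>R w) = ennreal (f k w)" .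
    qed
    finally show ?thesis .
  qed
  have "(\<lambda>k. \<integral>\<^sup>+ w. ennreal (f k w) \<partial>lborel) \<longlonglongrightarrow> (\<integral>\<^sup>+ w. ennreal (exp (- (norm (w::'a))\<^sup>2 / 4) * u x0 t0) \<partial>lborel)"
  proof (rule nn_integral_dominated_convergence[where w="\<lambda>w. ennreal (exp (- (norm w)\<^sup>2 / 4)) * ennreal M"])
    show "(\<lambda>w. ennreal (f k w)) \<in> borel_measurable lborel" for k
    proof -
      have tk: "t0 - \<delta> k \<le> 0" using \<delta>[of k] assms by simp
      have [measurable]: "cball x0 R \<in> sets borel" by simp
      have [measurable]: "(\<lambda>w. u (x0 + sqrt (\<delta> k) *\<^sub>R w) (t0 - \<delta> k)) \<in> borel_measurable borel"
        using tk by (intro borel_measurable_continuous_onI continuous_on_u continuous_intros) auto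
      show ?thesis unfolding f_def by measurable
    qed
    show "AE w in lborel. ennreal (f k w) \<le> ennreal (exp (- (norm w)\<^sup>2 / 4)) * ennreal M" for k
    proof (rule AE_I2)
      fix w
      have "f k w \<le> exp (- (norm w)\<^sup>2 / 4) * M"
      proof (cases "x0 + sqrt (\<delta> k) *\<^sub>R w \<in> cball x0 R")
        case True
        then have "u (x0 + sqrt (\<delta> k) *\<^sub>R w) (t0 - \<delta> k) \<le> M"
          using \<delta> less_imp_le[OF \<delta>(1)] by (intro M) (auto simp: S_def)
        then show ?thesis using True by (simp add: f_def)
      next
        case False
        then show ?thesis using M(2) by (simp add: f_def)
      qed
      then show "ennreal (f k w) \<le> ennreal (exp (- (norm w)\<^sup>2 / 4)) * ennreal M"
        by (simp add: ennreal_leI ennreal_mult'[symmetric])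
    qed
    show "(\<integral>\<^sup>+ w. ennreal (exp (- (norm (w::'a))\<^sup>2 / 4)) * ennreal M \<partial>lborel) < \<infinity>"
      
      by (subst nn_integral_multc, simp, unfold nn_integral_gaussian) (auto simp: ennreal_mult_less_top)
    show "AE w in lborel. (\<lambda>k. ennreal (f k w)) \<longlonglongrightarrow> ennreal (exp (- (norm w)\<^sup>2 / 4) * u x0 t0)"
    proof (rule AE_I2)
      fix w
      have "(\<lambda>k. exp (- (norm w)\<^sup>2 / 4) * u (x0 + sqrt (\<delta> k) *\<^sub>R w) (t0 - \<delta> k)) \<longlonglongrightarrow> exp (- (norm w)\<^sup>2 / 4) * u x0 t0"
        using assms \<delta> \<delta>0 by (intro tendsto_intros tendsto_u_rescaled) auto
      \<comment> \<open>For fixed \<open>w\<close> the point sqrt(\<delta>) w tends to 0, so the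
        ball cut-off is eventually 1.\<close>
      moreover have "\<forall>\<^sub>F k in sequentially. f k w = exp (- (norm w)\<^sup>2 / 4) * u (x0 + sqrt (\<delta> k) *\<^sub>R w) (t0 - \<delta> k)"
      proof -
        have "(\<lambda>k. norm (sqrt (\<delta> k) *\<^sub>R w)) \<longlonglongrightarrow> norm (sqrt 0 *\<^sub>R w)"
          by (intro tendsto_intros \<delta>0)
        then have "\<forall>\<^sub>F k in sequentially. norm (sqrt (\<delta> k) *\<^sub>R w) < R"
          using R0 by (intro order_tendstoD(2)) auto
        then show ?thesis
          by eventually_elim (simp add: f_def dist_norm)
      qed
      ultimately have "(\<lambda>k. f k w) \<longlonglongrightarrow> exp (- (norm w)\<^sup>2 / 4) * u x0 t0"
        using tendsto_cong by fastforce
      then show "(\<lambda>k. ennreal (f k w)) \<longlonglongrightarrow> ennreal (exp (- (norm w)\<^sup>2 / 4) * u x0 t0)"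
        by (rule tendsto_ennrealI)
    qed
  qed auto
  then have "truncated_average e x0 t0 \<theta> \<le> (\<integral>\<^sup>+ w. ennreal (exp (- (norm (w::'a))\<^sup>2 / 4) * u x0 t0) \<partial>lborel)"
    using le by (intro LIMSEQ_le_const) auto
  also have "\<dots> = ennreal (gaussian_mass TYPE('a) * u x0 t0)"
    using nonneg assms by (intro nn_integral_gaussian_times) auto
  finally show ?thesis .
qed

text \<open>Fatou's lemma as the truncation level tends to 0. The integrands converge pointwise to
  that of the full average, whose finiteness is still open here.\<close>

lemma average_le_liminf:
  assumes "t0 \<le> 0" "0 < \<theta>"
  shows "average x0 t0 \<theta> \<le> liminf (\<lambda>k. truncated_average (inverse (real (Suc k))) x0 t0 \<theta>)"
proof -
  have tk: "t0 - \<theta> \<le> 0" using assms by simp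
  define g where "g k y = ennreal (trunc (inverse (real (Suc k))) (heat_kernel \<theta> (y - x0)) * u y (t0 - \<theta>))" for k y
  have [measurable]: "g k \<in> borel_measurable borel" for k
    unfolding g_def trunc_def heat_kernel_def using measurable_u[OF tk] by measurable
  have "liminf (\<lambda>k. g k y) = ennreal (heat_kernel \<theta> (y - x0) * u y (t0 - \<theta>))" for y
  proof -
    have "filterlim (\<lambda>k. inverse (real (Suc k))) (at_right 0) sequentially"
      using LIMSEQ_inverse_real_of_nat by (auto simp: filterlim_at)
    then have "(\<lambda>k. trunc (inverse (real (Suc k))) (heat_kernel \<theta> (y - x0))) \<longlonglongrightarrow> heat_kernel \<theta> (y - x0)"
      using filterlim_compose[OF tendsto_trunc[OF heat_kernel_pos[OF assms(2)]]] by blast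
    then have "(\<lambda>k. g k y) \<longlonglongrightarrow> ennreal (heat_kernel \<theta> (y - x0) * u y (t0 - \<theta>))"
      unfolding g_def by (intro tendsto_ennrealI tendsto_intros)
    then show ?thesis by (intro lim_imp_Liminf) auto
  qed
  then have "average x0 t0 \<theta> = (\<integral>\<^sup>+ y. liminf (\<lambda>k. g k y) \<partial>lborel)"
    unfolding average_def by simp
  also have "\<dots> \<le> liminf (\<lambda>k. \<integral>\<^sup>+ y. g k y \<partial>lborel)"
    by (rule nn_integral_liminf) auto
  finally show ?thesis unfolding g_def truncated_average_def .
qed

lemma average_le:
  assumes "t0 \<le> 0" "0 < \<theta>"
  shows "average x0 t0 \<theta> \<le> ennreal (gaussian_mass TYPE('a) * u x0 t0)"
proof -
  have "liminf (\<lambda>k. truncated_average (inverse (real (Suc k))) x0 t0 \<theta>) \<le>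
    liminf (\<lambda>k. ennreal (gaussian_mass TYPE('a) * u x0 t0))"
    by (intro Liminf_mono always_eventually allI truncated_average_le assms) auto
  then show ?thesis using average_le_liminf[OF assms, of x0] by (simp add: Liminf_const)
qed

lemma truncated_average_le_average:
  assumes "t0 \<le> 0" "0 < \<theta>" "e > 0"
  shows "truncated_average e x0 t0 \<theta> \<le> average x0 t0 \<theta>"
  unfolding truncated_average_def average_def
  using assms by (intro nn_integral_mono ennreal_leI mult_right_mono trunc_le heat_kernel_pos nonneg) auto

text \<open>With h = - t0 the times t0 - \<theta> and 0 - (\<theta> + h) coincide. So the kernel
  inequality compares the dissipation with the average of the same slice seen from time 0, and
  \<open>average_le\<close> bounds that one by \<open>u x0 0\<close>. The hypothesis t0 < 0 is what
  makes \<open>h\<close> positive.\<close>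

lemma dissipation_le:
  assumes "t0 < 0" "0 < \<theta>1" "\<theta>1 \<le> \<theta>2"
  obtains a C where "a > 0" "C \<ge> 0" "\<And>e \<theta>. e > 0 \<Longrightarrow> \<theta> \<in> {\<theta>1..\<theta>2} \<Longrightarrow>
    dissipation e x0 t0 \<theta> \<le> ennreal (C * e powr a)"
proof -
  define h where "h = - t0"
  have h: "h > 0" using assms by (simp add: h_def)
  define a where "a = h / (2 * (\<theta>2 + h))"
  have a: "0 < a" "a \<le> 1" using assms h by (auto simp: a_def field_simps)
  obtain C where C: "C > 0" and K: "\<And>(r::'a) \<theta>. \<theta> \<in> {\<theta>1..\<theta>2} \<Longrightarrow>
    heat_kernel \<theta> r powr (1 - a) * (norm r / (2 * \<theta>))\<^sup>2 \<le> C * heat_kernel (\<theta> + h) r"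
    using heat_kernel_powr_le[OF assms(2,3) h, where 'a='a] unfolding a_def by blast
  let ?c = "gaussian_mass TYPE('a) * u x0 0"
  have c: "?c \<ge> 0" using gaussian_mass_pos[where 'a='a] nonneg by (simp add: less_imp_le)
  have "dissipation e x0 t0 \<theta> \<le> ennreal (6 * C * ?c * e powr a)" if "e > 0" "\<theta> \<in> {\<theta>1..\<theta>2}" for e \<theta>
  proof -
    have pos: "\<theta> > 0" using that assms by auto
    have tk: "t0 - \<theta> \<le> 0" using pos assms by simp
    have teq: "0 - (\<theta> + h) = t0 - \<theta>" by (simp add: h_def)
    let ?K = "\<lambda>\<theta> y. heat_kernel \<theta> (y - x0)"
    have "dissipation e x0 t0 \<theta> \<le> (\<integral>\<^sup>+ y. ennreal (6 * C * e powr a) * ennreal (?K (\<theta> + h) y * u y (0 - (\<theta> + h))) \<partial>lborel)"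
      unfolding dissipation_def teq
    proof (rule nn_integral_mono)
      fix y
      have Kp: "?K \<theta> y > 0" "?K (\<theta> + h) y > 0" using pos h by (auto intro!: heat_kernel_pos)
      have "trunc2 e (?K \<theta> y) * (norm (y - x0) / (2 * \<theta>) * ?K \<theta> y)\<^sup>2 =
        (trunc2 e (?K \<theta> y) * (?K \<theta> y)\<^sup>2) * (norm (y - x0) / (2 * \<theta>))\<^sup>2" by (simp add: power_mult_distrib power_divide algebra_simps)
      also have "\<dots> \<le> (6 * e powr a * ?K \<theta> y powr (1 - a)) * (norm (y - x0) / (2 * \<theta>))\<^sup>2"
        using that a Kp by (intro mult_right_mono trunc2_times_square_le) auto
      also have "\<dots> = 6 * e powr a * (?K \<theta> y powr (1 - a) * (norm (y - x0) / (2 * \<theta>))\<^sup>2)" by simp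
      also have "\<dots> \<le> 6 * e powr a * (C * ?K (\<theta> + h) y)"
        by (intro mult_left_mono K that) auto
      finally have "trunc2 e (?K \<theta> y) * (norm (y - x0) / (2 * \<theta>) * ?K \<theta> y)\<^sup>2 * u y (t0 - \<theta>)
        \<le> 6 * e powr a * (C * ?K (\<theta> + h) y) * u y (t0 - \<theta>)"
        by (rule mult_right_mono) (rule nonneg[OF tk])
      also have "\<dots> = (6 * C * e powr a) * (?K (\<theta> + h) y * u y (t0 - \<theta>))" by simp
      finally show "ennreal (trunc2 e (?K \<theta> y) * (norm (y - x0) / (2 * \<theta>) * ?K \<theta> y)\<^sup>2 * u y (t0 - \<theta>))
        \<le> ennreal (6 * C * e powr a) * ennreal (?K (\<theta> + h) y * u y (t0 - \<theta>))"
        using C by (simp add: ennreal_mult'[symmetric] ennreal_leI)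
    qed
    also have "\<dots> = ennreal (6 * C * e powr a) * average x0 0 (\<theta> + h)"
      unfolding average_def teq
      by (rule nn_integral_cmult) (unfold heat_kernel_def, use measurable_u[OF tk] in measurable)
    also have "\<dots> \<le> ennreal (6 * C * e powr a) * ennreal ?c"
      using pos h by (intro mult_left_mono average_le) auto
    also have "\<dots> = ennreal (6 * C * ?c * e powr a)"
      using C c by (simp add: ennreal_mult'[symmetric] ac_simps)
    finally show ?thesis .
  qed
  then show ?thesis using that[of a "6 * C * ?c"] a C c by simp
qed

text \<open>In \<open>truncated_average_diff\<close> the dissipation term is O(e^a) and disappears
  as \<open>e\<close> tends to 0, which leaves the inequality opposite to
  \<open>truncated_average_antimono\<close>.\<close>

lemma average_mono:
  assumes "t0 < 0" "0 < \<theta>1" "\<theta>1 < \<theta>2"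
  shows "average x0 t0 \<theta>1 \<le> average x0 t0 \<theta>2"
proof -
  obtain a C where aC: "a > 0" "C \<ge> 0" and D: "\<And>e \<theta>. e > 0 \<Longrightarrow> \<theta> \<in> {\<theta>1..\<theta>2} \<Longrightarrow>
    dissipation e x0 t0 \<theta> \<le> ennreal (C * e powr a)"
    using dissipation_le[of t0 \<theta>1 \<theta>2 x0] assms by (metis less_imp_le)
  let ?e = "\<lambda>k. inverse (real (Suc k))"
  have le: "truncated_average (?e k) x0 t0 \<theta>1 \<le> average x0 t0 \<theta>2 + ennreal (\<theta>2 - \<theta>1) * ennreal (C * ?e k powr a)" for k
  proof -
    have e: "?e k > 0" by simp
    obtain \<theta> where \<theta>: "\<theta> \<in> {\<theta>1<..<\<theta>2}" "truncated_average (?e k) x0 t0 \<theta>1 =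
      truncated_average (?e k) x0 t0 \<theta>2 + ennreal (\<theta>2 - \<theta>1) * dissipation (?e k) x0 t0 \<theta>"
      using truncated_average_diff[OF _ assms(2,3) e] assms(1) by (metis less_imp_le)
    show ?thesis
      unfolding \<theta>(2) using \<theta>(1) assms e
      by (intro add_mono mult_left_mono D truncated_average_le_average) auto
  qed
  have "(\<lambda>k. C * ?e k powr a) \<longlonglongrightarrow> C * 0"
  proof (intro tendsto_intros)
    show "(\<lambda>k. ?e k powr a) \<longlonglongrightarrow> 0"
      using tendsto_zero_powrI[OF LIMSEQ_inverse_real_of_nat tendsto_const _ aC(1)] by simp
  qed
  then have "(\<lambda>k. average x0 t0 \<theta>2 + ennreal (\<theta>2 - \<theta>1) * ennreal (C * ?e k powr a)) \<longlonglongrightarrow>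
    average x0 t0 \<theta>2 + ennreal (\<theta>2 - \<theta>1) * ennreal (C * 0)"
    by (intro tendsto_add tendsto_const ennreal_tendsto_cmult tendsto_ennrealI) auto
  then have lim: "liminf (\<lambda>k. average x0 t0 \<theta>2 + ennreal (\<theta>2 - \<theta>1) * ennreal (C * ?e k powr a)) = average x0 t0 \<theta>2"
    by (intro lim_imp_Liminf) auto
  have "average x0 t0 \<theta>1 \<le> liminf (\<lambda>k. truncated_average (?e k) x0 t0 \<theta>1)"
    using assms by (intro average_le_liminf) auto
  also have "\<dots> \<le> liminf (\<lambda>k. average x0 t0 \<theta>2 + ennreal (\<theta>2 - \<theta>1) * ennreal (C * ?e k powr a))"
    by (intro Liminf_mono always_eventually allI le)
  finally show ?thesis unfolding lim .
qed

text \<open>The lower bound starts from \<theta> near 0, where Fatou's lemma gives at least the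
  Gaussian mass times \<open>u x0 t0\<close>; \<open>average_mono\<close> carries it to the given
  \<theta>.\<close>

lemma average_eq:
  assumes "t0 < 0" "0 < \<theta>"
  shows "average x0 t0 \<theta> = ennreal (gaussian_mass TYPE('a) * u x0 t0)"
proof (rule antisym)
  show "average x0 t0 \<theta> \<le> ennreal (gaussian_mass TYPE('a) * u x0 t0)"
    using assms by (intro average_le) auto
  \<comment> \<open>The denominator starts at 2 so that every \<open>\<delta> k\<close> is strictly
    below \<open>\<theta>\<close>, as \<open>average_mono\<close> asks.\<close>
  define \<delta> where "\<delta> k = \<theta> * inverse (real (Suc (Suc k)))" for k
  have \<delta>: "\<delta> k > 0" "\<delta> k < \<theta>" for k
  proof -
    show "\<delta> k > 0" using assms by (simp add: \<delta>_def)
    have "inverse (real (Suc (Suc k))) < 1" by (simp add: field_simps)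
    then show "\<delta> k < \<theta>" using mult_strict_left_mono[OF _ assms(2)] unfolding \<delta>_def by fastforce
  qed
  have \<delta>0: "\<delta> \<longlonglongrightarrow> 0"
    unfolding \<delta>_def using tendsto_mult[OF tendsto_const[of \<theta>] LIMSEQ_Suc[OF LIMSEQ_inverse_real_of_nat]] by simp
  define g where "g k w = ennreal (exp (- (norm w)\<^sup>2 / 4) * u (x0 + sqrt (\<delta> k) *\<^sub>R w) (t0 - \<delta> k))" for k w
  have [measurable]: "g k \<in> borel_measurable borel" for k
  proof -
    have "t0 - \<delta> k \<le> 0" using \<delta>[of k] assms by simp
    then show ?thesis unfolding g_def using measurable_u by measurable
  qed
  have "(\<lambda>k. g k w) \<longlonglongrightarrow> ennreal (exp (- (norm w)\<^sup>2 / 4) * u x0 t0)" for w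
    unfolding g_def using assms \<delta> \<delta>0 by (intro tendsto_ennrealI tendsto_intros tendsto_u_rescaled) auto
  then have lim: "liminf (\<lambda>k. g k w) = ennreal (exp (- (norm w)\<^sup>2 / 4) * u x0 t0)" for w
    by (intro lim_imp_Liminf) auto
  have "ennreal (gaussian_mass TYPE('a) * u x0 t0) = (\<integral>\<^sup>+ w. liminf (\<lambda>k. g k w) \<partial>lborel)"
    unfolding lim using nonneg assms by (intro nn_integral_gaussian_times[symmetric]) auto
  also have "\<dots> \<le> liminf (\<lambda>k. \<integral>\<^sup>+ w. g k w \<partial>lborel)"
    by (rule nn_integral_liminf) auto
  also have "\<dots> = liminf (\<lambda>k. average x0 t0 (\<delta> k))"
    unfolding g_def using assms \<delta> by (subst average_rescale) auto
  also have "\<dots> \<le> liminf (\<lambda>k. average x0 t0 \<theta>)"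
    using assms \<delta> by (intro Liminf_mono always_eventually allI average_mono) auto
  finally show "ennreal (gaussian_mass TYPE('a) * u x0 t0) \<le> average x0 t0 \<theta>"
    by (simp add: Liminf_const)
qed

end

section \<open>The dilated measures and their exponential integrals\<close>

lemma heat_kernel_shift:
  fixes x y :: "'a::euclidean_space"
  assumes "T > 0" "t < 0"
  shows "exp (t * (norm (y /\<^sub>R (2 * T)))\<^sup>2 + x \<bullet> (y /\<^sub>R (2 * T))) * heat_kernel T y =
    sqrt (T / (T - t)) ^ DIM('a) * exp ((norm x)\<^sup>2 / (4 * (T - t))) *
      heat_kernel (T\<^sup>2 / (T - t)) (y - (T / (T - t)) *\<^sub>R x)"
proof -
  define d where "d = T - t"
  have d: "d > 0" "t = T - d" using assms by (auto simp: d_def)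
  let ?\<theta> = "T\<^sup>2 / d"
  have s: "sqrt ?\<theta> = T / sqrt d" "sqrt T * sqrt T = T" using assms by (auto simp: real_sqrt_divide)
  have n: "1 / sqrt T ^ DIM('a) = sqrt (T / d) ^ DIM('a) / sqrt ?\<theta> ^ DIM('a)"
  proof -
    have "1 / sqrt T = sqrt (T / d) / sqrt ?\<theta>"
      using assms d s by (simp add: real_sqrt_divide field_simps)
    then show ?thesis by (metis power_divide power_one)
  qed
  have sq: "(norm (y - (T / d) *\<^sub>R x))\<^sup>2 = (norm y)\<^sup>2 - 2 * (T / d) * (x \<bullet> y) + (T / d)\<^sup>2 * (norm x)\<^sup>2"
    unfolding power2_norm_eq_inner
    by (simp add: inner_diff_left inner_diff_right inner_commute power2_eq_square)
  \<comment> \<open>Completing the square in \<open>y\<close>. Since t - T = - d, the quadratic part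
    is - d |y|^2 / (4 T^2), so the exponential times the kernel is again a heat kernel, with
    parameter T^2 / d and centre (T / d) x.\<close>
  have e: "t * (norm (y /\<^sub>R (2 * T)))\<^sup>2 + x \<bullet> (y /\<^sub>R (2 * T)) + - (norm y)\<^sup>2 / (4 * T) =
     (norm x)\<^sup>2 / (4 * d) + - (norm (y - (T / d) *\<^sub>R x))\<^sup>2 / (4 * ?\<theta>)"
    unfolding sq d(2) using assms(1) d(1) by (simp add: power_mult_distrib power2_eq_square field_simps)
  have "exp (t * (norm (y /\<^sub>R (2 * T)))\<^sup>2 + x \<bullet> (y /\<^sub>R (2 * T))) * heat_kernel T y =
    exp (t * (norm (y /\<^sub>R (2 * T)))\<^sup>2 + x \<bullet> (y /\<^sub>R (2 * T)) + - (norm y)\<^sup>2 / (4 * T)) * (1 / sqrt T ^ DIM('a))"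
    unfolding heat_kernel_def exp_add by simp
  also have "\<dots> = sqrt (T / d) ^ DIM('a) * exp ((norm x)\<^sup>2 / (4 * d)) * heat_kernel ?\<theta> (y - (T / d) *\<^sub>R x)"
    unfolding e n exp_add heat_kernel_def by simp
  finally show ?thesis by (simp add: d_def)
qed

context ancient_heat
begin

text \<open>The scale 2T comes from the ratio G(y - x, T + t) / G(y, T): for large T its exponent is
  close to x \<bullet> y / (2T) + t |y|^2 / (4 T^2).\<close>

definition dilated_measure :: "real \<Rightarrow> 'a measure" where
  "dilated_measure T =
    distr (density lborel (\<lambda>y. ennreal (heat_kernel T y * u y (- T)))) borel (\<lambda>y. y /\<^sub>R (2 * T))"

lemma sets_dilated_measure [simp]: "sets (dilated_measure T) = sets borel"
  by (simp add: dilated_measure_def)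

lemma nn_integral_dilated_measure:
  assumes "T > 0" "f \<in> borel_measurable borel"
  shows "(\<integral>\<^sup>+ z. f z \<partial>dilated_measure T) =
    (\<integral>\<^sup>+ y. ennreal (heat_kernel T y * u y (- T)) * f (y /\<^sub>R (2 * T)) \<partial>lborel)"
proof -
  have [measurable]: "(\<lambda>y. u y (- T)) \<in> borel_measurable borel" using assms by (intro measurable_u) simp
  have [measurable]: "(\<lambda>y::'a. heat_kernel T y) \<in> borel_measurable borel" unfolding heat_kernel_def by measurable
  note assms(2)[measurable]
  have [measurable]: "(\<lambda>y. f (y /\<^sub>R (2 * T))) \<in> borel_measurable borel" by measurable
  show ?thesis
    unfolding dilated_measure_def by (simp add: nn_integral_distr nn_integral_density)
qed

lemma emeasure_dilated_measure_le:
  assumes "T > 0"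
  shows "emeasure (dilated_measure T) UNIV \<le> ennreal (gaussian_mass TYPE('a) * u 0 0)"
proof -
  have "emeasure (dilated_measure T) UNIV = (\<integral>\<^sup>+ z. 1 \<partial>dilated_measure T)"
    using sets_eq_imp_space_eq[OF sets_dilated_measure[of T]] by simp
  also have "\<dots> = average 0 0 T"
    using assms by (subst nn_integral_dilated_measure) (auto simp: average_def)
  also have "\<dots> \<le> ennreal (gaussian_mass TYPE('a) * u 0 0)" using assms by (intro average_le) auto
  finally show ?thesis .
qed

text \<open>An exact formula instead of an asymptotic one: the square completes to an average
  centred at a rescaled point of space-time, which \<open>average_eq\<close> evaluates because its
  time is still negative. All dependence on \<open>T\<close> then sits in factors with evident
  limits.\<close>

lemma exponential_integral_dilated_measure:
  assumes "T > 0" "t < 0"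
  shows "(\<integral>\<^sup>+ z. ennreal (exp (t * (norm z)\<^sup>2 + x \<bullet> z)) \<partial>dilated_measure T) =
    ennreal (sqrt (T / (T - t)) ^ DIM('a) * exp ((norm x)\<^sup>2 / (4 * (T - t))) *
      (gaussian_mass TYPE('a) * u ((T / (T - t)) *\<^sub>R x) (t * (T / (T - t)))))"
proof -
  define x' where "x' = (T / (T - t)) *\<^sub>R x"
  define t' where "t' = t * (T / (T - t))"
  define \<theta> where "\<theta> = T\<^sup>2 / (T - t)"
  define A where "A = sqrt (T / (T - t)) ^ DIM('a) * exp ((norm x)\<^sup>2 / (4 * (T - t)))"
  have d: "T - t > 0" using assms by simp
  have t': "t' < 0" unfolding t'_def using assms d by (intro mult_neg_pos) auto
  have \<theta>: "\<theta> > 0" unfolding \<theta>_def using assms d by simp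
  \<comment> \<open>The new average looks at the slice at time - T, the one that
    \<open>dilated_measure\<close> carries.\<close>
  have tt: "t' - \<theta> = - T"
  proof -
    have "(T - e) * (T / e) - T\<^sup>2 / e = - T" if "e > 0" for e
      using that by (simp add: field_simps power2_eq_square)
    from this[OF d] show ?thesis unfolding t'_def \<theta>_def by simp
  qed
  have A: "A \<ge> 0" using assms d by (simp add: A_def)
  have [measurable]: "(\<lambda>y. u y (- T)) \<in> borel_measurable borel" using assms by (intro measurable_u) simp
  have "(\<integral>\<^sup>+ z. ennreal (exp (t * (norm z)\<^sup>2 + x \<bullet> z)) \<partial>dilated_measure T) =
    (\<integral>\<^sup>+ y. ennreal (heat_kernel T y * u y (- T)) *
       ennreal (exp (t * (norm (y /\<^sub>R (2 * T)))\<^sup>2 + x \<bullet> (y /\<^sub>R (2 * T)))) \<partial>lborel)"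
    using assms by (intro nn_integral_dilated_measure) auto
  also have "\<dots> = (\<integral>\<^sup>+ y. ennreal A * ennreal (heat_kernel \<theta> (y - x') * u y (t' - \<theta>)) \<partial>lborel)"
  proof (intro nn_integral_cong)
    fix y
    let ?E = "exp (t * (norm (y /\<^sub>R (2 * T)))\<^sup>2 + x \<bullet> (y /\<^sub>R (2 * T)))"
    have "ennreal (heat_kernel T y * u y (- T)) * ennreal ?E = ennreal ((?E * heat_kernel T y) * u y (- T))"
      by (simp add: ennreal_mult''[symmetric] ac_simps)
    also have "(?E * heat_kernel T y) * u y (- T) = A * (heat_kernel \<theta> (y - x') * u y (t' - \<theta>))"
      unfolding heat_kernel_shift[OF assms] tt unfolding A_def \<theta>_def x'_def by simp
    finally show "ennreal (heat_kernel T y * u y (- T)) * ennreal ?E =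
      ennreal A * ennreal (heat_kernel \<theta> (y - x') * u y (t' - \<theta>))"
      using A by (simp add: ennreal_mult'[symmetric])
  qed
  also have "\<dots> = ennreal A * average x' t' \<theta>"
    unfolding average_def tt by (rule nn_integral_cmult) (unfold heat_kernel_def, measurable)
  also have "\<dots> = ennreal (A * (gaussian_mass TYPE('a) * u x' t'))"
    unfolding average_eq[OF t' \<theta>] using A by (rule ennreal_mult'[symmetric])
  finally show ?thesis unfolding A_def x'_def t'_def .
qed

lemma exponential_integral_dilated_measure_tendsto:
  assumes "t < 0"
  shows "(\<lambda>k. \<integral>\<^sup>+ z. ennreal (exp (t * (norm z)\<^sup>2 + x \<bullet> z)) \<partial>dilated_measure (real (Suc k)))
    \<longlonglongrightarrow> ennreal (gaussian_mass TYPE('a) * u x t)"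
proof -
  define l where "l k = real (Suc k) / (real (Suc k) - t)" for k
  have l: "l k \<ge> 0" for k using assms by (simp add: l_def)
  have l1: "l \<longlonglongrightarrow> 1"
  proof -
    have "filterlim (\<lambda>k. real (Suc k)) at_top sequentially"
      using filterlim_compose[OF filterlim_real_sequentially filterlim_Suc] .
    then have "filterlim (\<lambda>k. - t + real (Suc k)) at_top sequentially"
      by (rule filterlim_tendsto_add_at_top[OF tendsto_const])
    then have "(\<lambda>k. 1 - (- t) / (- t + real (Suc k))) \<longlonglongrightarrow> 1 - 0"
      by (intro tendsto_intros tendsto_divide_0[OF tendsto_const] filterlim_at_top_imp_at_infinity)
    moreover have "1 - (- t) / (- t + real (Suc k)) = l k" for k
      using assms by (simp add: l_def field_simps)
    ultimately show ?thesis by simp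
  qed
  have d0: "(\<lambda>k. (norm x)\<^sup>2 / (4 * (real (Suc k) - t))) \<longlonglongrightarrow> 0"
  proof -
    have "filterlim (\<lambda>k. real (Suc k)) at_top sequentially"
      using filterlim_compose[OF filterlim_real_sequentially filterlim_Suc] .
    then have "filterlim (\<lambda>k. - t + real (Suc k)) at_top sequentially"
      by (rule filterlim_tendsto_add_at_top[OF tendsto_const])
    then have "filterlim (\<lambda>k. 4 * (- t + real (Suc k))) at_top sequentially"
      by (rule filterlim_tendsto_pos_mult_at_top[OF tendsto_const, rotated]) simp
    then have "(\<lambda>k. (norm x)\<^sup>2 / (4 * (- t + real (Suc k)))) \<longlonglongrightarrow> 0"
      by (intro tendsto_divide_0[OF tendsto_const] filterlim_at_top_imp_at_infinity)
    then show ?thesis by simp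
  qed
  have "(\<lambda>k. (\<lambda>(x, t). u x t) (l k *\<^sub>R x, t * l k)) \<longlonglongrightarrow> (\<lambda>(x, t). u x t) (1 *\<^sub>R x, t * 1)"
  proof (rule continuous_on_tendsto_compose[OF cont_u])
    show "(\<lambda>k. (l k *\<^sub>R x, t * l k)) \<longlonglongrightarrow> (1 *\<^sub>R x, t * 1)"
      by (intro tendsto_intros l1)
    show "\<forall>\<^sub>F k in sequentially. (l k *\<^sub>R x, t * l k) \<in> UNIV \<times> {..0}"
      using assms l by (auto intro!: always_eventually mult_nonpos_nonneg)
  qed (use assms in auto)
  then have lu: "(\<lambda>k. u (l k *\<^sub>R x) (t * l k)) \<longlonglongrightarrow> u x t" by simp
  have "(\<lambda>k. sqrt (l k) ^ DIM('a) * exp ((norm x)\<^sup>2 / (4 * (real (Suc k) - t))) *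
      (gaussian_mass TYPE('a) * u (l k *\<^sub>R x) (t * l k))) \<longlonglongrightarrow>
      sqrt 1 ^ DIM('a) * exp 0 * (gaussian_mass TYPE('a) * u x t)"
    by (intro tendsto_intros l1 lu d0)
  then have "(\<lambda>k. sqrt (l k) ^ DIM('a) * exp ((norm x)\<^sup>2 / (4 * (real (Suc k) - t))) *
      (gaussian_mass TYPE('a) * u (l k *\<^sub>R x) (t * l k))) \<longlonglongrightarrow> gaussian_mass TYPE('a) * u x t" by simp
  then show ?thesis
    unfolding l_def by (subst exponential_integral_dilated_measure) (auto intro: tendsto_ennrealI assms)
qed

end

section \<open>Measures from weights on nested cells\<close>

definition basis_seq :: "nat \<Rightarrow> 'a::second_countable_topology set" where
  "basis_seq = (SOME b. topological_basis (range b))"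

lemma topological_basis_seq: "topological_basis (range basis_seq)"
proof -
  obtain B :: "'a set set" where B: "countable B" "topological_basis B"
    using ex_countable_basis by blast
  have "B \<noteq> {}"
  proof
    assume "B = {}"
    then have "topological_basis ({} :: 'a set set)" using B by simp
    then show False using topological_basisE[of "{}" UNIV undefined] by auto
  qed
  then have "range (from_nat_into B) = B" using B(1) by (rule range_from_nat_into)
  then have "topological_basis (range (from_nat_into B))" using B(2) by simp
  then show ?thesis unfolding basis_seq_def
    by (rule someI[where P="\<lambda>b. topological_basis (range b)"])
qed

lemma open_basis_seq: "open (basis_seq k)"
  using topological_basis_open[OF topological_basis_seq] by blast

text \<open>The first \<open>k\<close> binary digits of the address of \<open>y\<close>, where digit \<open>j\<close> records whether \<open>y\<close>
  lies in the \<open>j\<close>-th basic open set.\<close>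

fun code :: "nat \<Rightarrow> 'a::second_countable_topology \<Rightarrow> nat" where
  "code 0 y = 0"
| "code (Suc k) y = 2 * code k y + of_bool (y \<in> basis_seq k)"

lemma code_less: "code k y < 2 ^ k"
  by (induction k) auto

lemma code_div: "code (Suc k) y div 2 = code k y"
  by simp

lemma code_div_power: "code (k + m) y div 2 ^ m = code k y"
proof (induction m)
  case (Suc m)
  have "code (k + Suc m) y div 2 ^ Suc m = (code (Suc (k + m)) y div 2) div 2 ^ m"
    by (simp only: add_Suc_right power_Suc div_mult2_eq)
  then show ?case using Suc by (simp only: code_div)
qed simp

lemma code_mem_iff:
  assumes "code l y = code l z" "k < l"
  shows "y \<in> basis_seq k \<longleftrightarrow> z \<in> basis_seq k"
proof -
  have "code (Suc k) y = code (Suc k) z"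
    using code_div_power[of "Suc k" "l - Suc k" y] code_div_power[of "Suc k" "l - Suc k" z] assms by simp
  moreover have "code k y = code k z"
    using code_div_power[of k "l - k" y] code_div_power[of k "l - k" z] assms by simp
  ultimately show ?thesis by (auto split: if_splits simp: of_bool_def)
qed

lemma code_measurable [measurable]: "code k \<in> measurable borel (count_space UNIV)"
proof (induction k)
  case (Suc k)
  note Suc[measurable]
  have [measurable]: "basis_seq k \<in> sets borel" by (rule borel_open[OF open_basis_seq])
  show ?case unfolding code.simps by measurable
qed simp

text \<open>Finitely many basic sets of diameter below \<delta> cover the compact set. Once
  \<open>k\<close> exceeds their indices, equal codes put both points into a common member; only
  \<open>y\<close> is required to lie in \<open>K\<close>.\<close>

lemma code_separates:
  fixes K :: "'a::{second_countable_topology, metric_space} set"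
  assumes "compact K" "\<delta> > 0"
  obtains k where "\<And>y z. y \<in> K \<Longrightarrow> code k y = code k z \<Longrightarrow> dist y z < \<delta>"
proof -
  define J where "J = {j. \<forall>y\<in>basis_seq j. \<forall>z\<in>basis_seq j. dist y (z::'a) < \<delta>}"
  have "K \<subseteq> (\<Union>j\<in>J. basis_seq j)"
  proof
    fix x assume "x \<in> K"
    have "open (ball x (\<delta> / 2))" "x \<in> ball x (\<delta> / 2)" using assms by auto
    then obtain b where b: "b \<in> range basis_seq" "x \<in> b" "b \<subseteq> ball x (\<delta> / 2)"
      using topological_basisE[OF topological_basis_seq] by metis
    then obtain j where j: "b = basis_seq j" by auto
    have "dist y z < \<delta>" if "y \<in> b" "z \<in> b" for y z
    proof -
      have "dist x y < \<delta> / 2" "dist x z < \<delta> / 2" using that b(3) by auto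
      then show ?thesis by (metis dist_commute dist_triangle_half_l)
    qed
    then have "j \<in> J" unfolding J_def using j by auto
    then show "x \<in> (\<Union>j\<in>J. basis_seq j)" using b j by auto
  qed
  then obtain J' where J': "J' \<subseteq> J" "finite J'" "K \<subseteq> (\<Union>j\<in>J'. basis_seq j)"
    using compactE_image[OF assms(1), of J basis_seq] open_basis_seq by metis
  then obtain k where k: "\<And>j. j \<in> J' \<Longrightarrow> j < k" by (meson finite_nat_set_iff_bounded J'(2))
  have "dist y z < \<delta>" if yz: "y \<in> K" "code k y = code k z" for y z
  proof -
    obtain j where j: "j \<in> J'" "y \<in> basis_seq j" using yz J' by auto
    then have "z \<in> basis_seq j" using code_mem_iff[OF yz(2) k[OF j(1)]] by simp
    then show ?thesis using j J'(1) unfolding J_def by auto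
  qed
  then show ?thesis using that by blast
qed

text \<open>Arbitrary if the cell misses \<open>K\<close>; wherever representatives are summed, such
  cells carry weight 0.\<close>

definition representative :: "'a::second_countable_topology set \<Rightarrow> nat \<Rightarrow> nat \<Rightarrow> 'a" where
  "representative K k i = (SOME y. y \<in> K \<and> code k y = i)"

lemma representative:
  assumes "y \<in> K"
  shows "representative K k (code k y) \<in> K" "code k (representative K k (code k y)) = code k y"
proof -
  have "\<exists>z. z \<in> K \<and> code k z = code k y" using assms by blast
  then have "representative K k (code k y) \<in> K \<and> code k (representative K k (code k y)) = code k y"
    unfolding representative_def by (rule someI_ex)
  then show "representative K k (code k y) \<in> K" "code k (representative K k (code k y)) = code k y" by auto
qed

lemma code_div_power_le: "k \<le> l \<Longrightarrow> code l y div 2 ^ (l - k) = code k y"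
  using code_div_power[of k "l - k" y] by simp

lemma representative_tendsto:
  fixes K :: "'a::{second_countable_topology, metric_space} set"
  assumes "compact K" "y \<in> K"
  shows "(\<lambda>k. representative K k (code k y)) \<longlonglongrightarrow> y"
proof (rule metric_LIMSEQ_I)
  fix \<delta> :: real assume "\<delta> > 0"
  with assms obtain k where k: "\<And>y z. y \<in> K \<Longrightarrow> code k y = code k z \<Longrightarrow> dist y z < \<delta>"
    using code_separates by metis
  have "dist (representative K l (code l y)) y < \<delta>" if "l \<ge> k" for l
  proof (rule k)
    show "representative K l (code l y) \<in> K" using assms by (simp add: representative)
    show "code k (representative K l (code l y)) = code k y"
      using code_div_power_le[OF that] representative(2)[OF assms(2), of l] by metis
  qed
  then show "\<exists>k. \<forall>l\<ge>k. dist (representative K l (code l y)) y < \<delta>" by blast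
qed

text \<open>Consistent weights on the cells of all levels come from a measure: cut \<open>[0, d 0 0)\<close> into
  consecutive intervals of lengths \<open>d k i\<close>, send a point to the sequence of the cells whose
  intervals contain it, and push Lebesgue measure forward under the limit point of these cells.\<close>

lemma measure_of_consistent_weights:
  fixes K :: "'a::{second_countable_topology, metric_space} set"
  assumes K: "compact K" and nonneg: "\<And>k i. d k i \<ge> (0::real)"
    and cons: "\<And>k i. d k i = d (Suc k) (2 * i) + d (Suc k) (2 * i + 1)"
    and cell: "\<And>k i. d k i \<noteq> 0 \<Longrightarrow> \<exists>y\<in>K. code k y = i"
  obtains \<kappa> where "sets \<kappa> = sets (restrict_space borel K)"
    "emeasure \<kappa> (space \<kappa>) = ennreal (d 0 0)"
    "\<And>f. continuous_on K f \<Longrightarrow> (\<lambda>k. \<Sum>i<2^k. d k i * f (representative K k i)) \<longlonglongrightarrow> (\<integral>y. f y \<partial>\<kappa>)"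
proof -
  define D where "D = d 0 0"
  define A where "A k i = (\<Sum>j<i. d k j)" for k i
  have A_mono: "A k i \<le> A k j" if "i \<le> j" for k i j
    unfolding A_def using that nonneg by (intro sum_mono2) auto
  have A0: "A k 0 = 0" for k by (simp add: A_def)
  have A_Suc: "A k (Suc i) = A k i + d k i" for k i by (simp add: A_def)
  have A_double: "A (Suc k) (2 * i) = A k i" for k i
  proof (induction i)
    case (Suc i)
    have "A (Suc k) (2 * Suc i) = A (Suc k) (2 * i) + (d (Suc k) (2 * i) + d (Suc k) (2 * i + 1))"
      by (simp add: A_Suc)
    then show ?case using Suc cons[of k i] by (simp add: A_Suc)
  qed (simp add: A0)
  have A_top: "A k (2 ^ k) = D" for k
  proof (induction k)
    case 0 then show ?case by (simp add: A_def D_def)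
  next
    case (Suc k) then show ?case using A_double[of k "2 ^ k"] by simp
  qed
  \<comment> \<open>For \<open>u\<close> in \<open>{0..<D}\<close> this is the interval containing
    \<open>u\<close>. An interval of length 0 contains no point, so cells of weight 0 are never
    selected.\<close>
  define idx where "idx k u = (LEAST i. u < A k (Suc i))" for k u
  have idx: "A k (idx k u) \<le> u" "u < A k (Suc (idx k u))" "idx k u < 2 ^ k" if "u \<in> {0..<D}" for k u
  proof -
    have "u < A k (Suc (2 ^ k - 1))" using that by (simp add: A_top)
    then have 1: "u < A k (Suc (idx k u))" "idx k u \<le> 2 ^ k - 1"
      unfolding idx_def by (rule LeastI, rule Least_le)
    then show "u < A k (Suc (idx k u))" by simp
    have "(0::nat) < 2 ^ k" by simp
    with 1(2) show "idx k u < 2 ^ k" by linarith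
    show "A k (idx k u) \<le> u"
    proof (cases "idx k u")
      case 0 then show ?thesis using that by (simp add: A0)
    next
      case (Suc j)
      then have "\<not> u < A k (Suc j)" using not_less_Least[of j "\<lambda>i. u < A k (Suc i)"] unfolding idx_def by auto
      then show ?thesis using Suc by simp
    qed
  qed
  have idx_unique: "idx k u = i" if "A k i \<le> u" "u < A k (Suc i)" for k u i
  proof (rule antisym)
    show "idx k u \<le> i" unfolding idx_def using that(2) by (rule Least_le)
    have "u < A k (Suc (idx k u))" unfolding idx_def using that(2) by (rule LeastI)
    then show "i \<le> idx k u" using A_mono[of "Suc (idx k u)" i k] that(1) by fastforce
  qed
  \<comment> \<open>By \<open>A_double\<close> the intervals of level k + 1 subdivide those of level
    k, in the same way as \<open>code\<close> loses its last digit under division by 2.\<close>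
  have idx_div: "idx (Suc k) u div 2 = idx k u" if "u \<in> {0..<D}" for k u
  proof (rule idx_unique[symmetric])
    let ?j = "idx (Suc k) u"
    have "2 * (?j div 2) \<le> ?j" by simp
    from A_mono[OF this, of "Suc k"] show "A k (?j div 2) \<le> u"
      unfolding A_double using idx(1)[OF that, of "Suc k"] by linarith
    have "Suc ?j \<le> 2 * Suc (?j div 2)" by presburger
    from A_mono[OF this, of "Suc k"] have "A (Suc k) (Suc ?j) \<le> A k (Suc (?j div 2))"
      unfolding A_double .
    then show "u < A k (Suc (?j div 2))" using idx(2)[OF that, of "Suc k"] by linarith
  qed
  have idx_div_power: "idx (k + m) u div 2 ^ m = idx k u" if "u \<in> {0..<D}" for k m u
  proof (induction m)
    case (Suc m)
    have "idx (k + Suc m) u div 2 ^ Suc m = (idx (Suc (k + m)) u div 2) div 2 ^ m"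
      by (simp only: add_Suc_right power_Suc div_mult2_eq)
    then show ?case using Suc idx_div[OF that] by simp
  qed simp
  define X where "X k u = representative K k (idx k u)" for k u
  have X: "X k u \<in> K" "code k (X k u) = idx k u" if "u \<in> {0..<D}" for k u
  proof -
    have "d k (idx k u) \<noteq> 0" using idx(1,2)[OF that, of k] by (simp add: A_Suc)
    then obtain y where "y \<in> K" "code k y = idx k u" using cell by blast
    then show "X k u \<in> K" "code k (X k u) = idx k u" unfolding X_def using representative by metis+
  qed
  have X_code: "code k (X (k + m) u) = idx k u" if "u \<in> {0..<D}" for k m u
    using code_div_power[of k m "X (k + m) u"] idx_div_power[OF that, of k m] X(2)[OF that, of "k + m"] by simp
  have ex: "\<exists>x\<in>K. (\<lambda>k. X k u) \<longlonglongrightarrow> x" if u: "u \<in> {0..<D}" for u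
  proof -
    \<comment> \<open>From level k on, all \<open>X m u\<close> share their first k digits, so
      \<open>code_separates\<close> controls their mutual distances.\<close>
    have "Cauchy (\<lambda>k. X k u)"
    proof (rule metric_CauchyI)
      fix \<delta> :: real assume "\<delta> > 0"
      with K obtain k where k: "\<And>y z. y \<in> K \<Longrightarrow> code k y = code k z \<Longrightarrow> dist y z < \<delta>"
        using code_separates by metis
      have "dist (X m u) (X n u) < \<delta>" if "m \<ge> k" "n \<ge> k" for m n
        using X_code[OF u, of k "m - k"] X_code[OF u, of k "n - k"] that
        by (intro k X u) auto
      then show "\<exists>M. \<forall>m\<ge>M. \<forall>n\<ge>M. dist (X m u) (X n u) < \<delta>" by blast
    qed
    then obtain x where "x \<in> K" "(\<lambda>k. X k u) \<longlonglongrightarrow> x"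
      using completeE[OF compact_imp_complete[OF K], of "\<lambda>k. X k u"] X(1)[OF u] by blast
    then show ?thesis by blast
  qed
  \<comment> \<open>A limit of points of a cell may lie outside it. Therefore \<kappa> is
    characterised by integrals of continuous functions and not by its values on cells.\<close>
  define Y where "Y u = lim (\<lambda>k. X k u)" for u
  have Y: "Y u \<in> K" "(\<lambda>k. X k u) \<longlonglongrightarrow> Y u" if "u \<in> {0..<D}" for u
    using ex[OF that] limI unfolding Y_def by metis+
  define M where "M = restrict_space lborel {0..<D}"
  have spM: "space M = {0..<D}" by (simp add: M_def space_restrict_space)
  have eM: "emeasure M (space M) = ennreal D"
    using nonneg[of 0 0] by (simp add: M_def emeasure_restrict_space space_restrict_space D_def)
  interpret M: finite_measure M by (rule finite_measureI) (simp add: eM)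
  have idx_meas: "idx k \<in> measurable borel (count_space UNIV)" for k
    unfolding idx_def by measurable
  have X_meas: "X k \<in> measurable M borel" for k
    unfolding X_def M_def
    by (rule measurable_compose[of "idx k" _ "count_space UNIV"])
       (auto intro: measurable_restrict_space1 simp: idx_meas)
  have Y_meas: "Y \<in> measurable M borel"
    by (rule borel_measurable_LIMSEQ_metric[where f=X, OF X_meas]) (auto simp: spM Y(2))
  have Xr: "X k \<in> measurable M (restrict_space borel K)" for k
    by (rule measurable_restrict_space2[OF _ X_meas]) (auto simp: spM X)
  have Yr: "Y \<in> measurable M (restrict_space borel K)"
    by (rule measurable_restrict_space2[OF _ Y_meas]) (auto simp: spM Y)
  define \<kappa> where "\<kappa> = distr M (restrict_space borel K) Y"
  have "sets \<kappa> = sets (restrict_space borel K)" by (simp add: \<kappa>_def)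
  moreover have "emeasure \<kappa> (space \<kappa>) = ennreal (d 0 0)"
  proof -
    have "emeasure \<kappa> (space \<kappa>) = emeasure M (Y -` space (restrict_space borel K) \<inter> space M)"
      unfolding \<kappa>_def space_distr using Yr by (rule emeasure_distr) simp
    also have "Y -` space (restrict_space borel K) \<inter> space M = space M"
      using measurable_space[OF Yr] by auto
    finally show ?thesis by (simp add: eM D_def)
  qed
  moreover have "(\<lambda>k. \<Sum>i<2^k. d k i * f (representative K k i)) \<longlonglongrightarrow> (\<integral>y. f y \<partial>\<kappa>)"
    if f: "continuous_on K f" for f
  proof -
    have fm: "f \<in> borel_measurable (restrict_space borel K)"
      by (rule borel_measurable_continuous_on_restrict[OF f])
    obtain B where B: "\<And>y. y \<in> K \<Longrightarrow> norm (f y) \<le> B"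
      using compact_imp_bounded[OF compact_continuous_image[OF f K]] unfolding bounded_iff by auto
    have "(\<lambda>k. \<integral>u. f (X k u) \<partial>M) \<longlonglongrightarrow> (\<integral>u. f (Y u) \<partial>M)"
    proof (rule integral_dominated_convergence[where w="\<lambda>_. B"])
      show "(\<lambda>u. f (Y u)) \<in> borel_measurable M" "\<And>k. (\<lambda>u. f (X k u)) \<in> borel_measurable M"
        using measurable_compose[OF Yr fm] measurable_compose[OF Xr fm] by auto
      show "AE u in M. (\<lambda>k. f (X k u)) \<longlonglongrightarrow> f (Y u)"
        by (rule AE_I2) (auto simp: spM intro!: continuous_on_tendsto_compose[OF f] Y X always_eventually)
      show "\<And>k. AE u in M. norm (f (X k u)) \<le> B"
        by (rule AE_I2) (use B X(1) in \<open>auto simp: spM\<close>)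
    qed simp
    \<comment> \<open>\<open>X k\<close> is constant on the interval of cell \<open>i\<close>, whose
      length is \<open>d k i\<close>.\<close>
    moreover have "(\<integral>u. f (X k u) \<partial>M) = (\<Sum>i<2^k. d k i * f (representative K k i))" for k
    proof -
      have "(\<integral>u. f (X k u) \<partial>M) = (\<integral>u. indicator {0..<D} u *\<^sub>R f (X k u) \<partial>lborel)"
        unfolding M_def by (subst integral_restrict_space) auto
      also have "\<dots> = (\<integral>u. (\<Sum>i<2^k. f (representative K k i) * indicator {A k i..<A k (Suc i)} u) \<partial>lborel)"
      proof (rule Bochner_Integration.integral_cong[OF refl])
        fix u :: real
        show "indicator {0..<D} u *\<^sub>R f (X k u) =
          (\<Sum>i<2^k. f (representative K k i) * indicator {A k i..<A k (Suc i)} u)"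
        proof (cases "u \<in> {0..<D}")
          case True
          have "(\<Sum>i<2^k. f (representative K k i) * indicator {A k i..<A k (Suc i)} u) =
            (\<Sum>i<2^k. if i = idx k u then f (X k u) else 0)"
          proof (intro sum.cong refl)
            fix i
            show "f (representative K k i) * indicator {A k i..<A k (Suc i)} u = (if i = idx k u then f (X k u) else 0)"
            proof (cases "i = idx k u")
              case True
              have "u \<in> {A k i..<A k (Suc i)}" using idx(1,2)[OF \<open>u \<in> {0..<D}\<close>, of k] True by simp
              then show ?thesis using True by (simp add: X_def)
            next
              case False
              have "u \<notin> {A k i..<A k (Suc i)}" using idx_unique[of k i u] False by auto
              then show ?thesis using False by simp
            qed
          qed
          also have "\<dots> = f (X k u)" using idx(3)[OF True, of k] by simp
          finally show ?thesis using True by simp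
        next
          case False
          have "u \<notin> {A k i..<A k (Suc i)}" if "i < 2 ^ k" for i
            using False A_mono[of 0 i k] A_mono[of "Suc i" "2 ^ k" k] that by (auto simp: A0 A_top)
          then show ?thesis using False by simp
        qed
      qed
      also have "\<dots> = (\<Sum>i<2^k. (\<integral>u. f (representative K k i) * indicator {A k i..<A k (Suc i)} u \<partial>lborel))"
        by (intro Bochner_Integration.integral_sum integrable_mult_right integrable_real_indicator)
          (use A_mono in auto)
      also have "\<dots> = (\<Sum>i<2^k. d k i * f (representative K k i))"
        using nonneg by (intro sum.cong) (auto simp: A_Suc)
      finally show ?thesis .
    qed
    moreover have "(\<integral>y. f y \<partial>\<kappa>) = (\<integral>u. f (Y u) \<partial>M)"
      unfolding \<kappa>_def by (rule integral_distr[OF Yr fm])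
    ultimately show ?thesis by simp
  qed
  ultimately show ?thesis using that by blast
qed

section \<open>Weak and vague compactness of bounded sequences of measures\<close>

lemma integral_representative_code:
  fixes K :: "'a::{second_countable_topology, metric_space} set"
  assumes "finite_measure m" "sets m = sets borel"
  shows "(\<integral>y. f (representative K k (code k y)) \<partial>m) =
    (\<Sum>i<2^k. measure m {y. code k y = i} * f (representative K k i))"
    "integrable m (\<lambda>y. f (representative K k (code k y)) :: real)"
proof -
  interpret finite_measure m by fact
  have [measurable_cong]: "sets m = sets borel" by fact
  have sp: "space m = UNIV" using sets_eq_imp_space_eq[OF assms(2)] by simp
  have S: "{y. code k y = i} \<in> sets m" for i
    by (subst assms(2)) measurable
  have e: "f (representative K k (code k y)) = (\<Sum>i<2^k. f (representative K k i) * indicator {y. code k y = i} y)" for y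
  proof -
    have "(\<Sum>i<2^k. f (representative K k i) * indicator {y. code k y = i} y) =
      (\<Sum>i<2^k. if i = code k y then f (representative K k (code k y)) else 0)"
      by (intro sum.cong) (auto simp: indicator_def)
    then show ?thesis using code_less[of k y] by simp
  qed
  have i: "integrable m (\<lambda>y. f (representative K k i) * indicator {y. code k y = i} y)" for i
    using S by (intro integrable_mult_right integrable_real_indicator) (auto simp: emeasure_finite less_top[symmetric])
  show "integrable m (\<lambda>y. f (representative K k (code k y)))"
    unfolding e using i by (intro Bochner_Integration.integrable_sum) auto
  show "(\<integral>y. f (representative K k (code k y)) \<partial>m) =
    (\<Sum>i<2^k. measure m {y. code k y = i} * f (representative K k i))"
    unfolding e using i S by (subst Bochner_Integration.integral_sum) (auto simp: sp intro!: sum.cong)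
qed

lemma measure_code_split:
  assumes "finite_measure m" "sets m = sets borel"
  shows "measure m {y. code k y = i} = measure m {y. code (Suc k) y = 2 * i} + measure m {y. code (Suc k) y = 2 * i + 1}"
proof -
  interpret finite_measure m by fact
  have S: "{y. code k y = i} \<in> sets m" for i k
    by (subst assms(2)) measurable
  have "{y. code k y = i} = {y. code (Suc k) y = 2 * i} \<union> {y. code (Suc k) y = 2 * i + 1}"
  proof (rule set_eqI)
    fix y
    have "2 * c + of_bool b = 2 * i \<or> 2 * c + of_bool b = 2 * i + 1 \<longleftrightarrow> c = i" for c :: nat and b
      by (cases b) (simp_all, presburger+)
    then show "y \<in> {y. code k y = i} \<longleftrightarrow> y \<in> {y. code (Suc k) y = 2 * i} \<union> {y. code (Suc k) y = 2 * i + 1}"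
      by simp
  qed
  moreover have "{y. code (Suc k) y = 2 * i} \<inter> {y. code (Suc k) y = 2 * i + 1} = {}" by auto
  ultimately show ?thesis using finite_measure_Union[OF S S] by metis
qed

text \<open>Helly selection with nested cells in place of intervals. The limits of the cell weights
  are again consistent and define the limit measure. At a fine level a continuous function is
  uniformly close on \<open>K\<close> to its cell-wise constant version, whose integrals converge
  because the weights do.\<close>

lemma weakly_convergent_subsequence_compact:
  fixes K :: "'a::{second_countable_topology, metric_space} set"
  assumes K: "compact K" and sets: "\<And>j. sets (m j) = sets borel"
    and mass: "\<And>j. emeasure (m j) UNIV \<le> ennreal C" and C: "C \<ge> 0"
    and supp: "\<And>j. AE y in m j. y \<in> K"
  obtains r \<kappa> where "strict_mono (r :: nat \<Rightarrow> nat)" "sets \<kappa> = sets (restrict_space borel K)"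
    "emeasure \<kappa> (space \<kappa>) \<le> ennreal C"
    "\<And>f :: 'a \<Rightarrow> real. continuous_on K f \<Longrightarrow> f \<in> borel_measurable borel \<Longrightarrow>
       (\<lambda>j. \<integral>y. f y \<partial>m (r j)) \<longlonglongrightarrow> (\<integral>y. f y \<partial>\<kappa>)"
proof -
  have sp: "space (m j) = UNIV" for j using sets_eq_imp_space_eq[OF sets] by simp
  have fin: "finite_measure (m j)" for j
    by (rule finite_measureI) (use mass[of j] sp in \<open>auto simp: top_unique\<close>)
  define w where "w j p = measure (m j) {y. code (fst p) y = snd p}" for j and p :: "nat \<times> nat"
  have mC: "measure (m j) UNIV \<le> C" for j
    using enn2real_mono[OF mass[of j]] C by (simp add: measure_def)
  have wC: "w j p \<le> C" for j p
    unfolding w_def by (rule order_trans[OF _ mC])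
      (use finite_measure.finite_measure_mono[OF fin, of _ UNIV] sets in auto)
  \<comment> \<open>A diagonal argument: the cells of all levels are countably many and their
    weights are bounded, so one subsequence serves them all.\<close>
  obtain r where r: "strict_mono (r :: nat \<Rightarrow> nat)" "\<And>p. \<exists>l. (\<lambda>j. w (r j) p) \<longlonglongrightarrow> l"
    using function_convergent_subsequence[of "UNIV :: (nat \<times> nat) set" w C] wC
    by (auto simp: w_def)
  define d where "d k i = lim (\<lambda>j. w (r j) (k, i))" for k i
  have d: "(\<lambda>j. w (r j) (k, i)) \<longlonglongrightarrow> d k i" for k i
    unfolding d_def using r(2) convergent_def convergent_LIMSEQ_iff by blast
  have d0: "d k i \<ge> 0" for k i by (rule LIMSEQ_le_const[OF d]) (auto simp: w_def)
  have dC: "d k i \<le> C" for k i by (rule LIMSEQ_le_const2[OF d]) (use wC in auto)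
  have cons: "d k i = d (Suc k) (2 * i) + d (Suc k) (2 * i + 1)" for k i
  proof (rule LIMSEQ_unique[OF d])
    have "w j (k, i) = w j (Suc k, 2 * i) + w j (Suc k, 2 * i + 1)" for j
      unfolding w_def fst_conv snd_conv by (rule measure_code_split[OF fin sets])
    then show "(\<lambda>j. w (r j) (k, i)) \<longlonglongrightarrow> d (Suc k) (2 * i) + d (Suc k) (2 * i + 1)"
      using tendsto_add[OF d d] by simp
  qed
  have cell: "\<exists>y\<in>K. code k y = i" if "d k i \<noteq> 0" for k i
  proof (rule ccontr)
    assume "\<not> (\<exists>y\<in>K. code k y = i)"
    then have "w j (k, i) = 0" for j
    proof -
      have "AE y in m j. y \<notin> {y. code k y = i}"
        using supp[of j] \<open>\<not> (\<exists>y\<in>K. code k y = i)\<close> by auto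
      moreover have "{y. code k y = i} \<in> sets (m j)" by (subst sets) measurable
      ultimately have "{y. code k y = i} \<in> null_sets (m j)" by (simp add: AE_iff_null_sets)
      then show ?thesis by (simp add: w_def measure_def null_setsD1)
    qed
    then have "(\<lambda>j. 0) \<longlonglongrightarrow> d k i" using d[of k i] by simp
    then show False using that LIMSEQ_unique tendsto_const by metis
  qed
  obtain \<kappa> where \<kappa>: "sets \<kappa> = sets (restrict_space borel K)" "emeasure \<kappa> (space \<kappa>) = ennreal (d 0 0)"
    "\<And>f. continuous_on K f \<Longrightarrow> (\<lambda>k. \<Sum>i<2^k. d k i * f (representative K k i)) \<longlonglongrightarrow> (\<integral>y. f y \<partial>\<kappa>)"
  proof (rule measure_of_consistent_weights[of K d, OF K d0 cons])
    show "\<exists>y\<in>K. code k y = i" if "d k i \<noteq> 0" for k i using that by (rule cell)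
  qed (rule that; assumption)
  have "(\<lambda>j. \<integral>y. f y \<partial>m (r j)) \<longlonglongrightarrow> (\<integral>y. f y \<partial>\<kappa>)"
    if f: "continuous_on K f" "f \<in> borel_measurable borel" for f :: "'a \<Rightarrow> real"
  proof (rule LIMSEQ_I)
    fix e :: real assume e: "e > 0"
    \<comment> \<open>Three errors add up to \<epsilon> (C + 2): \<epsilon> C from discretising
      \<open>f\<close>, and \<epsilon> each from the convergence of the weights and of the sums. The
      denominator C + 3 makes the total strictly smaller than \<open>e\<close>.\<close>
    define \<epsilon> where "\<epsilon> = e / (C + 3)"
    have \<epsilon>: "\<epsilon> > 0" "\<epsilon> * (C + 2) < e" using e C by (auto simp: \<epsilon>_def field_simps)
    obtain B where B: "\<And>y. y \<in> K \<Longrightarrow> norm (f y) \<le> B"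
      using compact_imp_bounded[OF compact_continuous_image[OF f(1) K]] unfolding bounded_iff by auto
    obtain \<delta> where \<delta>: "\<delta> > 0" "\<And>y z. y \<in> K \<Longrightarrow> z \<in> K \<Longrightarrow> dist y z < \<delta> \<Longrightarrow> dist (f y) (f z) < \<epsilon>"
      using compact_uniformly_continuous[OF f(1) K] \<epsilon>(1) unfolding uniformly_continuous_on_def by metis
    obtain k0 where k0: "\<And>y z. y \<in> K \<Longrightarrow> code k0 y = code k0 z \<Longrightarrow> dist y z < \<delta>"
      using code_separates[OF K \<delta>(1)] by metis
    define s where "s k = (\<Sum>i<2^k. d k i * f (representative K k i))" for k
    obtain N where N: "\<And>k. k \<ge> N \<Longrightarrow> norm (s k - (\<integral>y. f y \<partial>\<kappa>)) < \<epsilon>"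
      using LIMSEQ_D[OF \<kappa>(3)[OF f(1)] \<epsilon>(1)] unfolding s_def by auto
    define k where "k = max N k0"
    define S where "S j = (\<Sum>i<2^k. w j (k, i) * f (representative K k i))" for j
    have "(\<lambda>j. S (r j)) \<longlonglongrightarrow> s k" unfolding S_def s_def by (intro tendsto_intros d)
    then obtain M where M: "\<And>j. j \<ge> M \<Longrightarrow> norm (S (r j) - s k) < \<epsilon>" using LIMSEQ_D \<epsilon>(1) by metis
    have diff: "norm ((\<integral>y. f y \<partial>m j) - S j) \<le> \<epsilon> * C" for j
    proof -
      interpret finite_measure "m j" by (rule fin)
      have fm: "f \<in> borel_measurable (m j)" using f(2) measurable_cong_sets[OF sets refl] by blast
      have fi: "integrable (m j) f"
        by (rule integrable_const_bound[where B=B]) (use supp[of j] B fm in auto)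
      note R = integral_representative_code[OF fin[of j] sets[of j], where f=f and K=K and k=k]
      have "(\<integral>y. f y \<partial>m j) - S j = (\<integral>y. f y - f (representative K k (code k y)) \<partial>m j)"
        unfolding S_def w_def using R fi by simp
      also have "norm \<dots> \<le> (\<integral>y. norm (f y - f (representative K k (code k y))) \<partial>m j)"
        by (rule integral_norm_bound)
      also have "\<dots> \<le> (\<integral>y. \<epsilon> \<partial>m j)"
      proof (rule integral_mono_AE)
        show "integrable (m j) (\<lambda>y. norm (f y - f (representative K k (code k y))))"
          using fi R(2) by (intro integrable_norm Bochner_Integration.integrable_diff)
        show "AE y in m j. norm (f y - f (representative K k (code k y))) \<le> \<epsilon>"
          using supp[of j]
        proof eventually_elim
          case (elim y)
          have "code k0 (representative K k (code k y)) = code k0 y"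
            using code_div_power_le[of k0 k] representative(2)[OF elim, of k] unfolding k_def
            by (metis max.cobounded2)
          then have "dist y (representative K k (code k y)) < \<delta>" using k0 elim by metis
          then have "dist (f y) (f (representative K k (code k y))) < \<epsilon>"
            using \<delta>(2)[OF elim representative(1)[OF elim]] by blast
          then show ?case by (simp add: dist_norm)
        qed
      qed simp
      also have "\<dots> = \<epsilon> * measure (m j) UNIV" by (simp add: sp)
      also have "\<dots> \<le> \<epsilon> * C" using mC \<epsilon>(1) by (intro mult_left_mono) auto
      finally show ?thesis .
    qed
    have "norm ((\<integral>y. f y \<partial>m (r j)) - (\<integral>y. f y \<partial>\<kappa>)) < e" if "j \<ge> M" for j
    proof -
      have "norm (s k - (\<integral>y. f y \<partial>\<kappa>)) < \<epsilon>" by (rule N) (simp add: k_def)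
      moreover have "norm (S (r j) - s k) < \<epsilon>" by (rule M[OF that])
      moreover have "\<epsilon> * C + \<epsilon> + \<epsilon> < e" using \<epsilon>(2) by (simp add: algebra_simps)
      ultimately show ?thesis using diff[of "r j"] by (simp only: real_norm_def)
    qed
    then show "\<exists>M. \<forall>j\<ge>M. norm ((\<integral>y. f y \<partial>m (r j)) - (\<integral>y. f y \<partial>\<kappa>)) < e" by blast
  qed
  moreover have "emeasure \<kappa> (space \<kappa>) \<le> ennreal C" unfolding \<kappa>(2) by (rule ennreal_leI[OF dC])
  ultimately show ?thesis by (intro that[OF r(1) \<kappa>(1)])
qed

text \<open>Vague compactness follows from the compact case by viewing \<open>'a\<close> as the open unit ball.\<close>

lemma vaguely_convergent_subsequence:
  fixes m :: "nat \<Rightarrow> 'a::euclidean_space measure"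
  assumes sets: "\<And>j. sets (m j) = sets borel"
    and mass: "\<And>j. emeasure (m j) UNIV \<le> ennreal C" and C: "C \<ge> 0"
  obtains r \<nu> where "strict_mono (r :: nat \<Rightarrow> nat)" "sets \<nu> = sets borel" "emeasure \<nu> UNIV \<le> ennreal C"
    "\<And>f :: 'a \<Rightarrow> real. continuous_on UNIV f \<Longrightarrow> (f \<longlongrightarrow> 0) at_infinity \<Longrightarrow>
       (\<lambda>j. \<integral>z. f z \<partial>m (r j)) \<longlonglongrightarrow> (\<integral>z. f z \<partial>\<nu>)"
proof -
  let ?K = "cball (0::'a) 1"
  \<comment> \<open>A homeomorphism onto the open unit ball with inverse \<open>\<Psi>\<close>;
    infinity becomes the unit sphere.\<close>
  define \<Phi> where "\<Phi> z = z /\<^sub>R (1 + norm z)" for z :: 'a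
  define \<Psi> where "\<Psi> w = w /\<^sub>R (1 - norm w)" for w :: 'a
  have pos: "1 + norm z > 0" for z :: 'a using norm_ge_zero[of z] by linarith
  have norm\<Phi>: "norm (\<Phi> z) = norm z / (1 + norm z)" for z
    using pos[of z] by (simp add: \<Phi>_def divide_inverse_commute)
  have \<Phi>1: "norm (\<Phi> z) < 1" for z unfolding norm\<Phi> using pos[of z] by (simp add: field_simps)
  have \<Psi>\<Phi>: "\<Psi> (\<Phi> z) = z" for z
  proof -
    have "1 - norm z / (1 + norm z) = 1 / (1 + norm z)" using pos[of z] by (simp add: field_simps)
    then show ?thesis unfolding \<Psi>_def norm\<Phi> using pos[of z] by (simp add: \<Phi>_def)
  qed
  have \<Phi>c: "continuous_on UNIV \<Phi>"
    unfolding \<Phi>_def by (intro continuous_intros) (use pos in \<open>auto simp: less_imp_neq[symmetric]\<close>)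
  have \<Phi>m [measurable]: "\<Phi> \<in> borel_measurable borel" by (rule borel_measurable_continuous_onI[OF \<Phi>c])
  have \<Psi>m [measurable]: "\<Psi> \<in> borel_measurable borel" unfolding \<Psi>_def by measurable
  have \<Psi>c: "continuous_on (ball 0 1) \<Psi>" unfolding \<Psi>_def by (intro continuous_intros) auto
  define m' where "m' j = distr (m j) borel \<Phi>" for j
  have sp: "space (m j) = UNIV" for j using sets_eq_imp_space_eq[OF sets] by simp
  have \<Phi>mj: "\<Phi> \<in> measurable (m j) borel" for j using \<Phi>m measurable_cong_sets[OF sets refl] by blast
  have "sets (m' j) = sets borel" for j by (simp add: m'_def)
  moreover have "emeasure (m' j) UNIV \<le> ennreal C" for j
    using mass[of j] \<Phi>mj by (simp add: m'_def emeasure_distr sp)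
  moreover have "AE y in m' j. y \<in> ?K" for j
    unfolding m'_def by (subst AE_distr_iff[OF \<Phi>mj]) (use \<Phi>1 in \<open>auto intro!: less_imp_le\<close>)
  ultimately obtain r \<kappa> where r: "strict_mono (r :: nat \<Rightarrow> nat)" and \<kappa>: "sets \<kappa> = sets (restrict_space borel ?K)"
    "emeasure \<kappa> (space \<kappa>) \<le> ennreal C"
    and lim: "\<And>f :: 'a \<Rightarrow> real. continuous_on ?K f \<Longrightarrow> f \<in> borel_measurable borel \<Longrightarrow>
       (\<lambda>j. \<integral>y. f y \<partial>m' (r j)) \<longlonglongrightarrow> (\<integral>y. f y \<partial>\<kappa>)"
    using weakly_convergent_subsequence_compact[OF compact_cball _ _ C, of m' 0 1] by metis
  have sp\<kappa>: "space \<kappa> = ?K" using sets_eq_imp_space_eq[OF \<kappa>(1)] by (simp add: space_restrict_space)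
  have ballK: "ball 0 1 \<in> sets \<kappa>"
    unfolding \<kappa>(1) sets_restrict_space by (auto intro!: image_eqI[of _ _ "ball 0 1"])
  \<comment> \<open>Restricting to the open ball discards whatever mass has escaped to
    infinity.\<close>
  define \<nu> where "\<nu> = distr (restrict_space \<kappa> (ball 0 1)) borel \<Psi>"
  have \<Psi>r: "\<Psi> \<in> measurable (restrict_space \<kappa> (ball 0 1)) borel"
    using \<Psi>m \<kappa>(1) by (metis measurable_cong_sets measurable_restrict_space1)
  have "sets \<nu> = sets borel" by (simp add: \<nu>_def)
  moreover have "emeasure \<nu> UNIV \<le> ennreal C"
  proof -
    have sb: "ball 0 1 \<inter> space \<kappa> = ball 0 1" by (auto simp: sp\<kappa>)
    have "emeasure \<nu> UNIV = emeasure (restrict_space \<kappa> (ball 0 1)) (ball 0 1)"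
      using \<Psi>r sb by (simp add: \<nu>_def emeasure_distr space_restrict_space)
    also have "\<dots> = emeasure \<kappa> (ball 0 1)"
      by (rule emeasure_restrict_space) (use ballK sb in auto)
    also have "\<dots> \<le> emeasure \<kappa> (space \<kappa>)" by (rule emeasure_space)
    finally show ?thesis using \<kappa>(2) by (rule order_trans)
  qed
  moreover have "(\<lambda>j. \<integral>z. f z \<partial>m (r j)) \<longlonglongrightarrow> (\<integral>z. f z \<partial>\<nu>)"
    if f: "continuous_on UNIV f" "(f \<longlongrightarrow> 0) at_infinity" for f :: "'a \<Rightarrow> real"
  proof -
    have fm [measurable]: "f \<in> borel_measurable borel" by (rule borel_measurable_continuous_onI[OF f(1)])
    \<comment> \<open>Since \<open>f\<close> vanishes at infinity, its transplant to the ball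
      extends continuously by 0 to the boundary sphere.\<close>
    define g where "g w = indicator (ball 0 1) w * f (\<Psi> w)" for w
    have [measurable]: "ball (0::'a) 1 \<in> sets borel" by simp
    have [measurable]: "(\<lambda>w. f (\<Psi> w)) \<in> borel_measurable borel" by (rule measurable_compose[OF \<Psi>m fm])
    have gm: "g \<in> borel_measurable borel" unfolding g_def by measurable
    have "continuous_on ?K g"
    proof (rule continuous_on_eq_continuous_within[THEN iffD2], rule ballI)
      fix w assume w: "w \<in> ?K"
      show "continuous (at w within ?K) g"
      proof (cases "norm w < 1")
        case True
        have "continuous_on (ball 0 1) (\<lambda>w. f (\<Psi> w))"
          by (rule continuous_on_compose2[OF f(1) \<Psi>c]) auto
        then have "continuous_on (ball 0 1) g"
          by (rule continuous_on_eq) (simp add: g_def)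
        then have "continuous (at w) g" using True by (simp add: continuous_on_eq_continuous_at)
        then show ?thesis by (rule continuous_at_imp_continuous_at_within)
      next
        case False
        then have w1: "norm w = 1" "g w = 0" using w by (auto simp: g_def)
        show ?thesis unfolding continuous_within_eps_delta
        proof (intro allI impI)
          fix e :: real assume e: "e > 0"
          obtain M where M: "M > 0" "\<And>z. norm z \<ge> M \<Longrightarrow> norm (f z) < e"
            using tendstoD[OF f(2) e] unfolding eventually_at_infinity_pos by auto
          \<comment> \<open>A point of the open ball closer than 1 / (1 + M) to the sphere is mapped
            by \<open>\<Psi>\<close> to a point of norm at least M.\<close>
          have "dist (g w') (g w) < e" if w': "w' \<in> ?K" "dist w' w < 1 / (1 + M)" for w'
          proof (cases "norm w' < 1")
            case True
            have "1 - norm w' \<le> dist w' w"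
              using norm_triangle_ineq3[of w' w] w1(1) by (simp add: dist_norm)
            then have a: "1 - norm w' < 1 / (1 + M)" using w'(2) by linarith
            then have "(1 - norm w') * (1 + M) < 1" using M(1) by (simp add: field_simps)
            then have "M * (1 - norm w') \<le> norm w'" by (simp add: algebra_simps)
            then have "M \<le> norm w' / (1 - norm w')" using True by (simp add: field_simps)
            also have "\<dots> = norm (\<Psi> w')" using True by (simp add: \<Psi>_def divide_inverse_commute)
            finally have "norm (f (\<Psi> w')) < e" by (rule M(2))
            then show ?thesis using True w1 by (simp add: g_def)
          qed (use e w1 in \<open>simp add: g_def\<close>)
          then show "\<exists>d>0. \<forall>w'\<in>?K. dist w' w < d \<longrightarrow> dist (g w') (g w) < e"
            using M(1) by (intro exI[of _ "1 / (1 + M)"]) auto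
        qed
      qed
    qed
    then have "(\<lambda>j. \<integral>y. g y \<partial>m' (r j)) \<longlonglongrightarrow> (\<integral>y. g y \<partial>\<kappa>)" using lim gm by blast
    moreover have "(\<integral>y. g y \<partial>m' j) = (\<integral>z. f z \<partial>m j)" for j
      unfolding m'_def by (subst integral_distr[OF \<Phi>mj gm]) (simp add: g_def \<Phi>1 \<Psi>\<Phi>)
    moreover have "(\<integral>y. g y \<partial>\<kappa>) = (\<integral>z. f z \<partial>\<nu>)"
    proof -
      have "(\<integral>z. f z \<partial>\<nu>) = (\<integral>y. f (\<Psi> y) \<partial>restrict_space \<kappa> (ball 0 1))"
        unfolding \<nu>_def by (rule integral_distr[OF \<Psi>r fm])
      also have "\<dots> = (\<integral>y. indicator (ball 0 1) y *\<^sub>R f (\<Psi> y) \<partial>\<kappa>)"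
        by (rule integral_restrict_space) (use ballK sp\<kappa> in \<open>auto simp: Int_absorb2\<close>)
      finally show ?thesis by (simp add: g_def)
    qed
    ultimately show ?thesis by simp
  qed
  ultimately show ?thesis using that[of r \<nu>] r by blast
qed

section \<open>Exponential representation\<close>

text \<open>Complete the square in |z|. The bound is uniform in \<open>z\<close>; it gives
  integrability against finite measures and the boundedness that the disintegration
  requires.\<close>

lemma gaussian_exponential_le:
  fixes x z :: "'a::real_inner"
  assumes "t < 0"
  shows "t * (norm z)\<^sup>2 + x \<bullet> z \<le> (norm x)\<^sup>2 / (4 * (- t))"
proof -
  have "x \<bullet> z \<le> norm x * norm z" by (rule norm_cauchy_schwarz)
  moreover have "t * (norm z)\<^sup>2 + norm x * norm z \<le> (norm x)\<^sup>2 / (4 * (- t))"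
  proof -
    have "0 \<le> (norm x + 2 * t * norm z)\<^sup>2" by simp
    then have "(t * (norm z)\<^sup>2 + norm x * norm z) * (4 * (- t)) \<le> (norm x)\<^sup>2"
      by (simp add: power2_eq_square algebra_simps)
    then show ?thesis using assms by (subst pos_le_divide_eq) auto
  qed
  ultimately show ?thesis by linarith
qed

lemma gaussian_exponential_tendsto_0:
  fixes x :: "'a::real_inner"
  assumes "t < 0"
  shows "((\<lambda>z. exp (t * (norm z)\<^sup>2 + x \<bullet> z)) \<longlongrightarrow> 0) at_infinity"
proof (rule Lim_null_comparison)
  show "((\<lambda>z::'a. exp (- norm z)) \<longlongrightarrow> 0) at_infinity"
    by (rule filterlim_compose[OF exp_at_bot])
      (rule filterlim_compose[OF filterlim_uminus_at_bot_at_top filterlim_norm_at_top])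
  show "\<forall>\<^sub>F z in at_infinity. norm (exp (t * (norm z)\<^sup>2 + x \<bullet> z)) \<le> exp (- norm z)"
    unfolding eventually_at_infinity
  proof (intro exI allI impI)
    fix z :: 'a assume z: "(norm x + 1) / (- t) \<le> norm z"
    have "norm x + 1 \<le> - t * norm z" using z assms by (simp add: field_simps)
    then have "(t * norm z + norm x) * norm z \<le> - 1 * norm z" by (intro mult_right_mono) auto
    moreover have "x \<bullet> z \<le> norm x * norm z" by (rule norm_cauchy_schwarz)
    ultimately have "t * (norm z)\<^sup>2 + x \<bullet> z \<le> - norm z"
      by (simp add: power2_eq_square algebra_simps)
    then show "norm (exp (t * (norm z)\<^sup>2 + x \<bullet> z)) \<le> exp (- norm z)" by simp
  qed
qed

text \<open>For t < 0 the exponentials are continuous and vanish at infinity, so they are admissible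
  test functions for the vague limit, and the limits computed for the dilated measures pass to
  it.\<close>

lemma (in ancient_heat) exponential_representation:
  obtains \<nu> where "finite_measure \<nu>" "sets \<nu> = sets borel"
    "\<And>x t. t < 0 \<Longrightarrow> (\<integral>\<^sup>+ z. ennreal (exp (t * (norm z)\<^sup>2 + x \<bullet> z)) \<partial>\<nu>) = ennreal (u x t)"
proof -
  define c where "c = gaussian_mass TYPE('a)"
  have c: "c > 0" unfolding c_def by (rule gaussian_mass_pos)
  define m where "m j = dilated_measure (real (Suc j))" for j
  have sets_m: "sets (m j) = sets borel" for j by (simp add: m_def)
  have mass: "emeasure (m j) UNIV \<le> ennreal (c * u 0 0)" for j
    unfolding m_def c_def by (rule emeasure_dilated_measure_le) simp
  have cu: "c * u 0 0 \<ge> 0" using c nonneg by (simp add: less_imp_le)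
  obtain r \<nu>\<^sub>0 where r: "strict_mono (r :: nat \<Rightarrow> nat)" and \<nu>0: "sets \<nu>\<^sub>0 = sets borel"
      "emeasure \<nu>\<^sub>0 UNIV \<le> ennreal (c * u 0 0)"
    and lim: "\<And>f :: 'a \<Rightarrow> real. continuous_on UNIV f \<Longrightarrow> (f \<longlongrightarrow> 0) at_infinity \<Longrightarrow>
       (\<lambda>j. \<integral>z. f z \<partial>m (r j)) \<longlonglongrightarrow> (\<integral>z. f z \<partial>\<nu>\<^sub>0)"
    by (rule vaguely_convergent_subsequence[of m "c * u 0 0", OF sets_m mass cu]) (rule that; assumption)
  have sp0: "space \<nu>\<^sub>0 = UNIV" using sets_eq_imp_space_eq[OF \<nu>0(1)] by simp
  interpret \<nu>0: finite_measure \<nu>\<^sub>0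
    by (rule finite_measureI) (use \<nu>0(2) sp0 in \<open>auto simp: top_unique\<close>)
  have E: "(\<integral>\<^sup>+ z. ennreal (exp (t * (norm z)\<^sup>2 + x \<bullet> z)) \<partial>\<nu>\<^sub>0) = ennreal (c * u x t)" if t: "t < 0" for x t
  proof -
    define f where "f z = exp (t * (norm z)\<^sup>2 + x \<bullet> z)" for z
    have fm: "f \<in> borel_measurable M" if "sets M = sets borel" for M
    proof -
      have "f \<in> borel_measurable borel" unfolding f_def by measurable
      then show ?thesis using measurable_cong_sets[OF that refl] by blast
    qed
    have fpos: "f z \<ge> 0" for z by (simp add: f_def)
    have cut: "c * u x t \<ge> 0" using c nonneg t by (simp add: less_imp_le)
    have "(\<lambda>j. \<integral>\<^sup>+ z. ennreal (f z) \<partial>m j) \<longlonglongrightarrow> ennreal (c * u x t)"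
      unfolding f_def m_def c_def by (rule exponential_integral_dilated_measure_tendsto[OF t])
    then have "(\<lambda>j. \<integral>\<^sup>+ z. ennreal (f z) \<partial>m (r j)) \<longlonglongrightarrow> ennreal (c * u x t)"
      using LIMSEQ_subseq_LIMSEQ[OF _ r] by (auto simp: o_def)
    then have "(\<lambda>j. enn2real (\<integral>\<^sup>+ z. ennreal (f z) \<partial>m (r j))) \<longlonglongrightarrow> c * u x t"
      by (rule tendsto_enn2real) (rule cut)
    \<comment> \<open>Bochner and nonnegative integrals are matched through \<open>enn2real\<close>
      before any integrability is known; an infinite integral would give 0 on both sides.\<close>
    moreover have "enn2real (\<integral>\<^sup>+ z. ennreal (f z) \<partial>m j) = (\<integral>z. f z \<partial>m j)" for j
      by (rule integral_eq_nn_integral[symmetric, OF fm[OF sets_m]]) (simp add: f_def)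
    ultimately have "(\<lambda>j. \<integral>z. f z \<partial>m (r j)) \<longlonglongrightarrow> c * u x t" by simp
    moreover have "(\<lambda>j. \<integral>z. f z \<partial>m (r j)) \<longlonglongrightarrow> (\<integral>z. f z \<partial>\<nu>\<^sub>0)"
      unfolding f_def by (intro lim gaussian_exponential_tendsto_0 t continuous_intros)
    ultimately have "(\<integral>z. f z \<partial>\<nu>\<^sub>0) = c * u x t" using LIMSEQ_unique by blast
    moreover have "integrable \<nu>\<^sub>0 f"
    proof (rule \<nu>0.integrable_const_bound[where B="exp ((norm x)\<^sup>2 / (4 * (- t)))"])
      show "AE z in \<nu>\<^sub>0. norm (f z) \<le> exp ((norm x)\<^sup>2 / (4 * (- t)))"
        unfolding f_def by (rule AE_I2) (use gaussian_exponential_le[OF t, of _ x] in simp)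
    qed (rule fm[OF \<nu>0(1)])
    ultimately have "(\<integral>\<^sup>+ z. ennreal (f z) \<partial>\<nu>\<^sub>0) = ennreal (c * u x t)"
      using nn_integral_eq_integral[of \<nu>\<^sub>0 f] by (simp add: fpos)
    then show ?thesis unfolding f_def .
  qed
  define \<nu> where "\<nu> = density \<nu>\<^sub>0 (\<lambda>_. ennreal (1 / c))"
  have nnd: "(\<integral>\<^sup>+ z. f z \<partial>\<nu>) = ennreal (1 / c) * (\<integral>\<^sup>+ z. f z \<partial>\<nu>\<^sub>0)" if "f \<in> borel_measurable borel" for f :: "'a \<Rightarrow> ennreal"
  proof -
    have "f \<in> borel_measurable \<nu>\<^sub>0" using that measurable_cong_sets[OF \<nu>0(1) refl] by blast
    then show ?thesis unfolding \<nu>_def by (simp add: nn_integral_density nn_integral_cmult)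
  qed
  show ?thesis
  proof (rule that[of \<nu>])
    show "sets \<nu> = sets borel" by (simp add: \<nu>_def \<nu>0)
    have "emeasure \<nu> (space \<nu>) = (\<integral>\<^sup>+ z. 1 \<partial>\<nu>)" by simp
    also have "\<dots> = ennreal (1 / c) * emeasure \<nu>\<^sub>0 (space \<nu>\<^sub>0)" by (subst nnd) auto
    finally show "finite_measure \<nu>"
      using \<nu>0.emeasure_finite[of "space \<nu>\<^sub>0"]
      by (intro finite_measureI) (auto simp: ennreal_mult_eq_top_iff)
    fix x :: 'a and t :: real assume t: "t < 0"
    have "(\<integral>\<^sup>+ z. ennreal (exp (t * (norm z)\<^sup>2 + x \<bullet> z)) \<partial>\<nu>) = ennreal (1 / c) * ennreal (c * u x t)"
      by (subst nnd) (auto simp: E[OF t])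
    also have "\<dots> = ennreal (1 / c * (c * u x t))" using c by (simp add: ennreal_mult'[symmetric])
    finally show "(\<integral>\<^sup>+ z. ennreal (exp (t * (norm z)\<^sup>2 + x \<bullet> z)) \<partial>\<nu>) = ennreal (u x t)" using c by simp
  qed
qed

section \<open>Disintegration over a compact fibre\<close>

lemma sum_double:
  fixes h :: "nat \<Rightarrow> 'a::comm_monoid_add"
  shows "(\<Sum>i<2 * n. h i) = (\<Sum>i<n. h (2 * i) + h (2 * i + 1))"
  by (induction n) (auto simp: ac_simps)

text \<open>The weight of a cell given s is a Radon-Nikodym derivative. Countably many cells leave a
  single exceptional null set; off it the weights are consistent and define \<open>\<mu> s\<close>.
  The integral identity holds by construction for functions that are constant in \<open>y\<close> on
  cells, and the general case follows by refining them.\<close>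

lemma disintegration_compact:
  fixes K :: "'b::{second_countable_topology, metric_space} set" and \<sigma> :: "'a \<Rightarrow> 'c"
  assumes fin: "finite_measure \<nu>" and K: "compact K"
    and \<sigma>: "\<sigma> \<in> measurable \<nu> S" and \<xi>: "\<xi> \<in> measurable \<nu> borel" "\<And>z. z \<in> space \<nu> \<Longrightarrow> \<xi> z \<in> K"
  obtains \<mu> where "\<And>s. sets (\<mu> s) = sets (restrict_space borel K)"
    "\<forall>(f :: 'c \<Rightarrow> 'b \<Rightarrow> real) B. (\<forall>s\<in>space S. continuous_on K (f s)) \<longrightarrow>
       (\<forall>y\<in>K. (\<lambda>s. f s y) \<in> borel_measurable S) \<longrightarrow>
       (\<forall>s\<in>space S. \<forall>y\<in>K. 0 \<le> f s y \<and> f s y \<le> B) \<longrightarrow>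
       (\<lambda>s. \<integral>\<^sup>+ y. ennreal (f s y) \<partial>\<mu> s) \<in> borel_measurable S \<and>
       (\<integral>\<^sup>+ s. (\<integral>\<^sup>+ y. ennreal (f s y) \<partial>\<mu> s) \<partial>distr \<nu> S \<sigma>) = (\<integral>\<^sup>+ z. ennreal (f (\<sigma> z) (\<xi> z)) \<partial>\<nu>)"
proof -
  interpret \<nu>: finite_measure \<nu> by (rule fin)
  note \<sigma>[measurable] \<xi>(1)[measurable]
  define \<rho> where "\<rho> = distr \<nu> S \<sigma>"
  have sets_\<rho> [measurable_cong, simp]: "sets \<rho> = sets S" by (simp add: \<rho>_def)
  have sp\<rho>: "space \<rho> = space S" by (simp add: \<rho>_def)
  interpret \<rho>: finite_measure \<rho> unfolding \<rho>_def by (rule \<nu>.finite_measure_distr[OF \<sigma>])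
  define I where "I k i z = (indicator {y. code k y = i} (\<xi> z) :: ennreal)" for k i z
  have cs [measurable]: "{y. code k y = i} \<in> sets (borel :: 'b measure)" for k i by measurable
  have Im [measurable]: "I k i \<in> borel_measurable \<nu>" for k i unfolding I_def by measurable
  \<comment> \<open>The \<sigma>-image of the part of \<nu> where \<xi> lies in cell
    \<open>i\<close>. Its density with respect to \<rho> is the conditional probability of that
    cell.\<close>
  define N where "N k i = distr (density \<nu> (I k i)) S \<sigma>" for k i
  have sN [simp]: "sets (N k i) = sets S" for k i by (simp add: N_def)
  have nnN: "(\<integral>\<^sup>+ s. h s \<partial>N k i) = (\<integral>\<^sup>+ z. I k i z * h (\<sigma> z) \<partial>\<nu>)" if [measurable]: "h \<in> borel_measurable S" for h k i
    unfolding N_def by (simp add: nn_integral_distr nn_integral_density)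
  have eN: "emeasure (N k i) A = (\<integral>\<^sup>+ z. I k i z * indicator A (\<sigma> z) \<partial>\<nu>)" if "A \<in> sets S" for A k i
    using nnN[of "indicator A" k i] that by simp
  have ac: "absolutely_continuous \<rho> (N k i)" for k i
    unfolding absolutely_continuous_def
  proof
    fix A assume A: "A \<in> null_sets \<rho>"
    then have A': "A \<in> sets S" by auto
    have "emeasure (N k i) A \<le> (\<integral>\<^sup>+ z. indicator A (\<sigma> z) \<partial>\<nu>)"
      unfolding eN[OF A'] by (intro nn_integral_mono) (auto simp: I_def indicator_def)
    also have "\<dots> = (\<integral>\<^sup>+ s. indicator A s \<partial>\<rho>)" unfolding \<rho>_def using A' by (subst nn_integral_distr) auto
    also have "\<dots> = 0" using A A' by (simp add: null_setsD1)
    finally show "A \<in> null_sets (N k i)" using A' by (simp add: null_sets_def)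
  qed
  define D where "D k i = RN_deriv \<rho> (N k i)" for k i
  have Dm [measurable]: "D k i \<in> borel_measurable S" for k i
    unfolding D_def using borel_measurable_RN_deriv[of \<rho>] measurable_cong_sets[OF sets_\<rho> refl] by blast
  have Dm\<rho>: "D k i \<in> borel_measurable \<rho>" for k i unfolding D_def by simp
  have dens: "density \<rho> (D k i) = N k i" for k i
    unfolding D_def by (rule \<rho>.density_RN_deriv[OF ac]) simp
  have nnD: "(\<integral>\<^sup>+ s. D k i s * h s \<partial>\<rho>) = (\<integral>\<^sup>+ z. I k i z * h (\<sigma> z) \<partial>\<nu>)" if h [measurable]: "h \<in> borel_measurable S" for h k i
    unfolding nnN[OF h, symmetric] dens[symmetric] using Dm\<rho> by (subst nn_integral_density) auto
  have nnD1: "(\<integral>\<^sup>+ s. D k i s \<partial>\<rho>) = (\<integral>\<^sup>+ z. I k i z \<partial>\<nu>)" for k i using nnD[of "\<lambda>_. 1" k i] by simp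
  have splitI: "I k i z = I (Suc k) (2 * i) z + I (Suc k) (2 * i + 1) z" for k i z
  proof -
    have "2 * c + of_bool b = 2 * i \<longleftrightarrow> c = i \<and> \<not> b" "2 * c + of_bool b = 2 * i + 1 \<longleftrightarrow> c = i \<and> b" for c i :: nat and b
      by (cases b; simp; presburger)+
    then show ?thesis unfolding I_def indicator_def by simp
  qed
  have AE1: "AE s in \<rho>. D k i s = D (Suc k) (2 * i) s + D (Suc k) (2 * i + 1) s" for k i
  proof (rule \<rho>.density_unique)
    show "density \<rho> (D k i) = density \<rho> (\<lambda>s. D (Suc k) (2 * i) s + D (Suc k) (2 * i + 1) s)"
    proof (rule measure_eqI)
      fix A assume "A \<in> sets (density \<rho> (D k i))"
      then have A [measurable]: "A \<in> sets S" by simp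
      have "emeasure (density \<rho> (\<lambda>s. D (Suc k) (2 * i) s + D (Suc k) (2 * i + 1) s)) A =
        (\<integral>\<^sup>+ s. D (Suc k) (2 * i) s * indicator A s + D (Suc k) (2 * i + 1) s * indicator A s \<partial>\<rho>)"
        by (subst emeasure_density) (auto simp: distrib_right)
      also have "\<dots> = (\<integral>\<^sup>+ z. I (Suc k) (2 * i) z * indicator A (\<sigma> z) \<partial>\<nu>) + (\<integral>\<^sup>+ z. I (Suc k) (2 * i + 1) z * indicator A (\<sigma> z) \<partial>\<nu>)"
        by (subst nn_integral_add) (auto simp: nnD)
      also have "\<dots> = (\<integral>\<^sup>+ z. I (Suc k) (2 * i) z * indicator A (\<sigma> z) + I (Suc k) (2 * i + 1) z * indicator A (\<sigma> z) \<partial>\<nu>)"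
        by (rule nn_integral_add[symmetric]) measurable
      also have "\<dots> = (\<integral>\<^sup>+ z. I k i z * indicator A (\<sigma> z) \<partial>\<nu>)"
        unfolding splitI[of k i] distrib_right ..
      also have "\<dots> = emeasure (density \<rho> (D k i)) A" unfolding dens eN[OF A] ..
      finally show "emeasure (density \<rho> (D k i)) A = emeasure (density \<rho> (\<lambda>s. D (Suc k) (2 * i) s + D (Suc k) (2 * i + 1) s)) A" by simp
    qed simp
  qed measurable
  have AE2: "AE s in \<rho>. D k i s = 0" if "\<not> (\<exists>y\<in>K. code k y = i)" for k i
  proof -
    have "(\<integral>\<^sup>+ s. D k i s \<partial>\<rho>) = (\<integral>\<^sup>+ z. 0 \<partial>\<nu>)"
      unfolding nnD1 by (rule nn_integral_cong) (use \<xi>(2) that in \<open>auto simp: I_def indicator_def\<close>)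
    then show ?thesis using Dm\<rho> by (simp add: nn_integral_0_iff_AE)
  qed
  have AE3: "AE s in \<rho>. D k i s \<noteq> \<infinity>" for k i
  proof (rule nn_integral_PInf_AE[OF Dm\<rho>])
    have "(\<integral>\<^sup>+ s. D k i s \<partial>\<rho>) \<le> (\<integral>\<^sup>+ z. 1 \<partial>\<nu>)"
      unfolding nnD1 by (intro nn_integral_mono) (auto simp: I_def indicator_def)
    also have "\<dots> < \<infinity>" by (simp add: \<nu>.emeasure_finite less_top[symmetric])
    finally show "(\<integral>\<^sup>+ s. D k i s \<partial>\<rho>) \<noteq> \<infinity>" by simp
  qed
  \<comment> \<open>Level 0 has one cell, which is the whole space, so \<open>N 0 0\<close> is
    \<rho>: off a null set the conditional measures will have mass 1.\<close>
  have AE4: "AE s in \<rho>. D 0 0 s = 1"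
  proof (rule \<rho>.density_unique)
    have "I 0 0 = (\<lambda>z. 1)" by (simp add: I_def fun_eq_iff)
    then have "N 0 0 = \<rho>" by (simp add: N_def \<rho>_def density_1)
    then show "density \<rho> (D 0 0) = density \<rho> (\<lambda>_. 1)" by (simp add: dens density_1)
  qed measurable
  \<comment> \<open>Densities are determined only up to null sets; countability of the cells lets
    all these properties hold together almost everywhere.\<close>
  define P where "P s \<longleftrightarrow> (\<forall>k i. D k i s = D (Suc k) (2 * i) s + D (Suc k) (2 * i + 1) s \<and>
    ((\<not> (\<exists>y\<in>K. code k y = i)) \<longrightarrow> D k i s = 0) \<and> D k i s \<noteq> \<infinity>) \<and> D 0 0 s = 1" for s
  have "AE s in \<rho>. P s"
    unfolding P_def using AE1 AE2 AE3 AE4 by (auto simp: AE_all_countable)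
  then obtain Z where Z: "Z \<in> null_sets \<rho>" "{s \<in> space \<rho>. \<not> P s} \<subseteq> Z"
    by (metis AE_E null_setsI)
  define G where "G = space S - Z"
  have Gm [measurable]: "G \<in> sets S" using Z(1) by (auto simp: G_def)
  have GP: "P s" if "s \<in> G" for s using that Z(2) by (auto simp: G_def sp\<rho>)
  have GPa: "D k i s = D (Suc k) (2 * i) s + D (Suc k) (2 * i + 1) s" if "s \<in> G" for s k i
    using GP[OF that] unfolding P_def by blast
  have GPb: "D k i s = 0" if "s \<in> G" "\<not> (\<exists>y\<in>K. code k y = i)" for s k i
    using GP[OF that(1)] that(2) unfolding P_def by blast
  have GPc: "D k i s < top" if "s \<in> G" for s k i
  proof -
    have "D k i s \<noteq> \<infinity>" using GP[OF that] unfolding P_def by blast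
    then show ?thesis by (simp add: less_top)
  qed
  have GPd: "D 0 0 s = 1" if "s \<in> G" for s
    using GP[OF that] unfolding P_def by blast
  have AEG: "AE s in \<rho>. s \<in> G"
    using AE_not_in[OF Z(1)] by (rule AE_mp) (auto simp: G_def sp\<rho>)
  \<comment> \<open>Zero weights on the exceptional set keep consistency valid for every s; there
    \<open>\<mu> s\<close> is the zero measure.\<close>
  define d where "d s k i = (if s \<in> G then enn2real (D k i s) else 0)" for s k i
  have dm [measurable]: "(\<lambda>s. d s k i) \<in> borel_measurable S" for k i unfolding d_def by measurable
  have d0: "d s k i \<ge> 0" for s k i by (simp add: d_def)
  have dcons: "d s k i = d s (Suc k) (2 * i) + d s (Suc k) (2 * i + 1)" for s k i
  proof (cases "s \<in> G")
    case True
    have "enn2real (D k i s) = enn2real (D (Suc k) (2 * i) s) + enn2real (D (Suc k) (2 * i + 1) s)"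
      unfolding GPa[OF True, of k i] by (rule enn2real_plus[OF GPc[OF True] GPc[OF True]])
    then show ?thesis using True by (simp add: d_def)
  qed (simp add: d_def)
  have dcell: "\<exists>y\<in>K. code k y = i" if "d s k i \<noteq> 0" for s k i
  proof (rule ccontr)
    assume "\<not> (\<exists>y\<in>K. code k y = i)"
    then have "d s k i = 0" unfolding d_def using GPb[of s k i] by auto
    then show False using that by simp
  qed
  have dtop: "d s 0 0 \<le> 1" for s unfolding d_def using GPd[of s] by auto
  have dsum: "(\<Sum>i<2^k. d s k i) = d s 0 0" for s k
  proof (induction k)
    case (Suc k)
    have "(\<Sum>i<2^Suc k. d s (Suc k) i) = (\<Sum>i<2^k. d s (Suc k) (2 * i) + d s (Suc k) (2 * i + 1))"
      unfolding power_Suc by (rule sum_double)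
    also have "\<dots> = (\<Sum>i<2^k. d s k i)" by (rule sum.cong[OF refl]) (rule dcons[symmetric])
    finally show ?case using Suc by simp
  qed simp
  have "\<forall>s. \<exists>\<kappa>. sets \<kappa> = sets (restrict_space borel K) \<and> emeasure \<kappa> (space \<kappa>) = ennreal (d s 0 0) \<and>
    (\<forall>f. continuous_on K f \<longrightarrow> (\<lambda>k. \<Sum>i<2^k. d s k i * f (representative K k i)) \<longlonglongrightarrow> (\<integral>y. f y \<partial>\<kappa>))"
  proof
    fix s
    show "\<exists>\<kappa>. sets \<kappa> = sets (restrict_space borel K) \<and> emeasure \<kappa> (space \<kappa>) = ennreal (d s 0 0) \<and>
      (\<forall>f. continuous_on K f \<longrightarrow> (\<lambda>k. \<Sum>i<2^k. d s k i * f (representative K k i)) \<longlonglongrightarrow> (\<integral>y. f y \<partial>\<kappa>))"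
    proof (rule measure_of_consistent_weights[of K "d s", OF K d0 dcons])
      show "\<exists>y\<in>K. code k y = i" if "d s k i \<noteq> 0" for k i using that by (rule dcell)
    qed blast
  qed
  from choice[OF this] obtain \<mu> where \<mu>_all: "\<forall>s. sets (\<mu> s) = sets (restrict_space borel K) \<and>
    emeasure (\<mu> s) (space (\<mu> s)) = ennreal (d s 0 0) \<and>
    (\<forall>f. continuous_on K f \<longrightarrow> (\<lambda>k. \<Sum>i<2^k. d s k i * f (representative K k i)) \<longlonglongrightarrow> (\<integral>y. f y \<partial>\<mu> s))" ..
  have \<mu>: "sets (\<mu> s) = sets (restrict_space borel K)" "emeasure (\<mu> s) (space (\<mu> s)) = ennreal (d s 0 0)"
    "continuous_on K f \<Longrightarrow> (\<lambda>k. \<Sum>i<2^k. d s k i * f (representative K k i)) \<longlonglongrightarrow> (\<integral>y. f y \<partial>\<mu> s)" for s f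
    using spec[OF \<mu>_all, of s] by blast+
  have sp\<mu>: "space (\<mu> s) = K" for s using sets_eq_imp_space_eq[OF \<mu>(1)] by (simp add: space_restrict_space)
  have fin\<mu>: "finite_measure (\<mu> s)" for s by (rule finite_measureI) (simp add: \<mu>(2))
  have main: "(\<lambda>s. \<integral>\<^sup>+ y. ennreal (f s y) \<partial>\<mu> s) \<in> borel_measurable S \<and>
       (\<integral>\<^sup>+ s. (\<integral>\<^sup>+ y. ennreal (f s y) \<partial>\<mu> s) \<partial>\<rho>) = (\<integral>\<^sup>+ z. ennreal (f (\<sigma> z) (\<xi> z)) \<partial>\<nu>)"
    if fc: "\<And>s. s \<in> space S \<Longrightarrow> continuous_on K (f s)"
      and fm: "\<And>y. y \<in> K \<Longrightarrow> (\<lambda>s. f s y) \<in> borel_measurable S"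
      and fB: "\<And>s y. s \<in> space S \<Longrightarrow> y \<in> K \<Longrightarrow> 0 \<le> f s y \<and> f s y \<le> B"
    for f :: "'c \<Rightarrow> 'b \<Rightarrow> real" and B
  proof -
    \<comment> \<open>These sums link both sides: for fixed s they tend to the inner integral, and
      integrated over s they give the \<nu>-integral with \<xi> z replaced by the representative of
      its cell.\<close>
    define g where "g k s = (\<Sum>i<2^k. d s k i * f s (representative K k i))" for k s
    define J where "J s = (\<integral>y. f s y \<partial>\<mu> s)" for s
    have rep: "representative K k i \<in> K" if "\<exists>y\<in>K. code k y = i" for k i
      using that representative(1) by blast
    have tm [measurable]: "(\<lambda>s. d s k i * f s (representative K k i)) \<in> borel_measurable S" for k i
    proof (cases "\<exists>y\<in>K. code k y = i")
      case True
      note fm[OF rep[OF True], measurable]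
      show ?thesis by measurable
    next
      case False
      then have "d s k i = 0" for s using dcell by blast
      then show ?thesis by simp
    qed
    have gm [measurable]: "g k \<in> borel_measurable S" for k unfolding g_def by measurable
    have term0: "0 \<le> d s k i * f s (representative K k i) \<and> d s k i * f s (representative K k i) \<le> d s k i * B"
      if "s \<in> space S" for s k i
    proof (cases "d s k i = 0")
      case False
      then have "0 \<le> f s (representative K k i) \<and> f s (representative K k i) \<le> B"
        using dcell rep fB[OF that] by blast
      then show ?thesis using d0[of s k i] by (auto intro: mult_left_mono)
    qed simp
    have g0: "0 \<le> g k s" if "s \<in> space S" for k s unfolding g_def using term0[OF that] by (intro sum_nonneg) auto
    have gB: "g k s \<le> \<bar>B\<bar>" if "s \<in> space S" for k s
    proof -
      have "g k s \<le> (\<Sum>i<2^k. d s k i * B)" unfolding g_def using term0[OF that] by (intro sum_mono) auto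
      also have "\<dots> = d s 0 0 * B" unfolding dsum[of s k, symmetric] by (simp add: sum_distrib_right)
      also have "\<dots> \<le> d s 0 0 * \<bar>B\<bar>" using d0[of s 0 0] by (intro mult_left_mono) auto
      also have "\<dots> \<le> 1 * \<bar>B\<bar>" using dtop[of s] by (intro mult_right_mono) auto
      finally show ?thesis by simp
    qed
    have glim: "(\<lambda>k. g k s) \<longlonglongrightarrow> J s" if "s \<in> space S" for s
      unfolding g_def J_def by (rule \<mu>(3)[OF fc[OF that]])
    have Jm [measurable]: "J \<in> borel_measurable S"
      by (rule borel_measurable_LIMSEQ_metric[where f=g, OF gm glim])
    have inner: "(\<integral>\<^sup>+ y. ennreal (f s y) \<partial>\<mu> s) = ennreal (J s)" if s: "s \<in> space S" for s
      unfolding J_def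
    proof (rule nn_integral_eq_integral)
      have "f s \<in> borel_measurable (restrict_space borel K)"
        by (rule borel_measurable_continuous_on_restrict[OF fc[OF s]])
      then have "f s \<in> borel_measurable (\<mu> s)" using measurable_cong_sets[OF \<mu>(1) refl] by blast
      then show "integrable (\<mu> s) (f s)"
        by (intro finite_measure.integrable_const_bound[OF fin\<mu>, where B=B])
          (use fB[OF s] in \<open>auto simp: sp\<mu>\<close>)
    qed (use fB[OF s] in \<open>auto simp: sp\<mu>\<close>)
    have "(\<lambda>s. \<integral>\<^sup>+ y. ennreal (f s y) \<partial>\<mu> s) \<in> borel_measurable S"
      using measurable_cong[of S "\<lambda>s. \<integral>\<^sup>+ y. ennreal (f s y) \<partial>\<mu> s" "\<lambda>s. ennreal (J s)" borel] inner by simp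
    moreover have "(\<integral>\<^sup>+ s. (\<integral>\<^sup>+ y. ennreal (f s y) \<partial>\<mu> s) \<partial>\<rho>) = (\<integral>\<^sup>+ z. ennreal (f (\<sigma> z) (\<xi> z)) \<partial>\<nu>)"
    proof -
      have "(\<integral>\<^sup>+ s. (\<integral>\<^sup>+ y. ennreal (f s y) \<partial>\<mu> s) \<partial>\<rho>) = (\<integral>\<^sup>+ s. ennreal (J s) \<partial>\<rho>)"
        by (rule nn_integral_cong) (simp add: inner sp\<rho>)
      also have "\<dots> = (\<integral>\<^sup>+ z. ennreal (f (\<sigma> z) (\<xi> z)) \<partial>\<nu>)"
      proof (rule LIMSEQ_unique)
      show "(\<lambda>k. \<integral>\<^sup>+ s. ennreal (g k s) \<partial>\<rho>) \<longlonglongrightarrow> (\<integral>\<^sup>+ s. ennreal (J s) \<partial>\<rho>)"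
      proof (rule nn_integral_dominated_convergence[where w="\<lambda>_. ennreal \<bar>B\<bar>"])
        show "AE s in \<rho>. ennreal (g k s) \<le> ennreal \<bar>B\<bar>" for k
          by (rule AE_I2) (auto simp: sp\<rho> intro!: ennreal_leI gB)
        show "(\<integral>\<^sup>+ s. ennreal \<bar>B\<bar> \<partial>\<rho>) < \<infinity>"
          unfolding nn_integral_const infinity_ennreal_def ennreal_mult_less_top
          using \<rho>.emeasure_finite[of "space \<rho>"] less_top by (metis ennreal_less_top infinity_ennreal_def)
        show "AE s in \<rho>. (\<lambda>k. ennreal (g k s)) \<longlonglongrightarrow> ennreal (J s)"
          by (rule AE_I2) (auto simp: sp\<rho> intro!: tendsto_ennrealI glim)
      qed measurable
      have geq: "(\<integral>\<^sup>+ s. ennreal (g k s) \<partial>\<rho>) = (\<integral>\<^sup>+ z. ennreal (f (\<sigma> z) (representative K k (code k (\<xi> z)))) \<partial>\<nu>)" for k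
      proof -
        have "(\<integral>\<^sup>+ s. ennreal (g k s) \<partial>\<rho>) = (\<integral>\<^sup>+ s. (\<Sum>i<2^k. ennreal (d s k i * f s (representative K k i))) \<partial>\<rho>)"
          unfolding g_def by (rule nn_integral_cong) (use term0 in \<open>auto simp: sum_ennreal sp\<rho>\<close>)
        also have "\<dots> = (\<Sum>i<2^k. \<integral>\<^sup>+ s. ennreal (d s k i * f s (representative K k i)) \<partial>\<rho>)"
          by (rule nn_integral_sum) measurable
        also have "\<dots> = (\<Sum>i<2^k. \<integral>\<^sup>+ z. I k i z * ennreal (f (\<sigma> z) (representative K k i)) \<partial>\<nu>)"
        proof (rule sum.cong[OF refl])
          fix i
          show "(\<integral>\<^sup>+ s. ennreal (d s k i * f s (representative K k i)) \<partial>\<rho>) =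
            (\<integral>\<^sup>+ z. I k i z * ennreal (f (\<sigma> z) (representative K k i)) \<partial>\<nu>)"
          proof (cases "\<exists>y\<in>K. code k y = i")
            case True
            note fm[OF rep[OF True], measurable]
            have "(\<integral>\<^sup>+ s. ennreal (d s k i * f s (representative K k i)) \<partial>\<rho>) =
              (\<integral>\<^sup>+ s. D k i s * ennreal (f s (representative K k i)) \<partial>\<rho>)"
            proof (rule nn_integral_cong_AE)
              show "AE s in \<rho>. ennreal (d s k i * f s (representative K k i)) = D k i s * ennreal (f s (representative K k i))"
                using AEG
              proof eventually_elim
                case (elim s)
                have "ennreal (d s k i) = D k i s" using elim GPc[OF elim] by (simp add: d_def ennreal_enn2real)
                then show ?case using d0[of s k i] by (simp add: ennreal_mult')
              qed
            qed
            also have "\<dots> = (\<integral>\<^sup>+ z. I k i z * ennreal (f (\<sigma> z) (representative K k i)) \<partial>\<nu>)"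
              by (rule nnD) measurable
            finally show ?thesis .
          next
            case False
            then have "d s k i = 0" for s using dcell by blast
            moreover have "(\<integral>\<^sup>+ z. I k i z * ennreal (f (\<sigma> z) (representative K k i)) \<partial>\<nu>) = (\<integral>\<^sup>+ z. 0 \<partial>\<nu>)"
              using False \<xi>(2) by (intro nn_integral_cong) (auto simp: I_def indicator_def)
            ultimately show ?thesis by simp
          qed
        qed
        also have "\<dots> = (\<integral>\<^sup>+ z. (\<Sum>i<2^k. I k i z * ennreal (f (\<sigma> z) (representative K k i))) \<partial>\<nu>)"
        proof (rule nn_integral_sum[symmetric])
          fix i
          show "(\<lambda>z. I k i z * ennreal (f (\<sigma> z) (representative K k i))) \<in> borel_measurable \<nu>"
          proof (cases "\<exists>y\<in>K. code k y = i")
            case True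
            note fm[OF rep[OF True], measurable]
            show ?thesis by measurable
          next
            case False
            then have I0: "I k i z = 0" if "z \<in> space \<nu>" for z using \<xi>(2)[OF that] by (auto simp: I_def indicator_def)
            show ?thesis by (subst measurable_cong[where g="\<lambda>_. 0"]) (simp_all add: I0)
          qed
        qed
        also have "\<dots> = (\<integral>\<^sup>+ z. ennreal (f (\<sigma> z) (representative K k (code k (\<xi> z)))) \<partial>\<nu>)"
        proof (rule nn_integral_cong)
          fix z
          have "(\<Sum>i<2^k. I k i z * ennreal (f (\<sigma> z) (representative K k i))) =
            (\<Sum>i<2^k. if i = code k (\<xi> z) then ennreal (f (\<sigma> z) (representative K k (code k (\<xi> z)))) else 0)"
            by (rule sum.cong) (auto simp: I_def)
          then show "(\<Sum>i<2^k. I k i z * ennreal (f (\<sigma> z) (representative K k i))) =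
            ennreal (f (\<sigma> z) (representative K k (code k (\<xi> z))))" using code_less[of k "\<xi> z"] by simp
        qed
        finally show ?thesis .
      qed
      show "(\<lambda>k. \<integral>\<^sup>+ s. ennreal (g k s) \<partial>\<rho>)
          \<longlonglongrightarrow> (\<integral>\<^sup>+ z. ennreal (f (\<sigma> z) (\<xi> z)) \<partial>\<nu>)"
        unfolding geq
      proof (rule nn_integral_dominated_convergence[where w="\<lambda>_. ennreal \<bar>B\<bar>"])
        have \<sigma>S: "\<sigma> z \<in> space S" if "z \<in> space \<nu>" for z using measurable_space[OF \<sigma> that] .
        \<comment> \<open>\<open>f\<close> is measurable in s and continuous in y. Discretising y
          gives a finite sum of measurable terms, and measurability of the undiscretised integrand
          follows in the limit.\<close>
        have meas [measurable]: "(\<lambda>z. f (\<sigma> z) (representative K k (code k (\<xi> z)))) \<in> borel_measurable \<nu>" for k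
        proof -
          have "(\<lambda>z. \<Sum>i<2^k. indicator {y. code k y = i} (\<xi> z) * f (\<sigma> z) (representative K k i)) \<in> borel_measurable \<nu>"
          proof (rule borel_measurable_sum)
            fix i
            show "(\<lambda>z. indicator {y. code k y = i} (\<xi> z) * f (\<sigma> z) (representative K k i)) \<in> borel_measurable \<nu>"
            proof (cases "\<exists>y\<in>K. code k y = i")
              case True
              note fm[OF rep[OF True], measurable]
              show ?thesis by measurable
            next
              case False
              then have I0: "indicat_real {y. code k y = i} (\<xi> z) = 0" if "z \<in> space \<nu>" for z
                using \<xi>(2)[OF that] by (auto simp: indicator_def)
              show ?thesis by (subst measurable_cong[where g="\<lambda>_. 0"]) (simp_all add: I0)
            qed
          qed
          moreover have "(\<Sum>i<2^k. indicator {y. code k y = i} (\<xi> z) * f (\<sigma> z) (representative K k i)) =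
            f (\<sigma> z) (representative K k (code k (\<xi> z)))" for z
          proof -
            have "(\<Sum>i<2^k. indicator {y. code k y = i} (\<xi> z) * f (\<sigma> z) (representative K k i)) =
              (\<Sum>i<2^k. if i = code k (\<xi> z) then f (\<sigma> z) (representative K k (code k (\<xi> z))) else 0)"
              by (rule sum.cong) auto
            then show ?thesis using code_less[of k "\<xi> z"] by simp
          qed
          ultimately show ?thesis by simp
        qed
        have lim: "(\<lambda>k. f (\<sigma> z) (representative K k (code k (\<xi> z)))) \<longlonglongrightarrow> f (\<sigma> z) (\<xi> z)" if "z \<in> space \<nu>" for z
          by (rule continuous_on_tendsto_compose[OF fc[OF \<sigma>S[OF that]] representative_tendsto[OF K \<xi>(2)[OF that]]])
            (use \<xi>(2)[OF that] in \<open>auto intro!: always_eventually representative\<close>)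
        show "AE z in \<nu>. (\<lambda>k. ennreal (f (\<sigma> z) (representative K k (code k (\<xi> z))))) \<longlonglongrightarrow> ennreal (f (\<sigma> z) (\<xi> z))"
          by (rule AE_I2) (intro tendsto_ennrealI lim)
        have [measurable]: "(\<lambda>z. f (\<sigma> z) (\<xi> z)) \<in> borel_measurable \<nu>"
          by (rule borel_measurable_LIMSEQ_metric[OF meas]) (rule lim)
        show "(\<lambda>z. ennreal (f (\<sigma> z) (\<xi> z))) \<in> borel_measurable \<nu>" by measurable
        show "(\<lambda>z. ennreal (f (\<sigma> z) (representative K k (code k (\<xi> z))))) \<in> borel_measurable \<nu>" for k
          by measurable
        show "AE z in \<nu>. ennreal (f (\<sigma> z) (representative K k (code k (\<xi> z)))) \<le> ennreal \<bar>B\<bar>" for k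
        proof (rule AE_I2)
          fix z assume z: "z \<in> space \<nu>"
          have "f (\<sigma> z) (representative K k (code k (\<xi> z))) \<le> B"
            using fB[OF \<sigma>S[OF z] representative(1)[OF \<xi>(2)[OF z]]] by blast
          then show "ennreal (f (\<sigma> z) (representative K k (code k (\<xi> z)))) \<le> ennreal \<bar>B\<bar>"
            by (intro ennreal_leI) linarith
        qed
        show "(\<integral>\<^sup>+ z. ennreal \<bar>B\<bar> \<partial>\<nu>) < \<infinity>"
          unfolding nn_integral_const infinity_ennreal_def ennreal_mult_less_top
          using \<nu>.emeasure_finite[of "space \<nu>"] less_top by (metis ennreal_less_top infinity_ennreal_def)
      qed measurable
      qed
      finally show ?thesis .
    qed
    ultimately show ?thesis by blast
  qed
  show ?thesis
  proof (rule that[of \<mu>], rule \<mu>(1), intro allI impI)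
    fix f :: "'c \<Rightarrow> 'b \<Rightarrow> real" and B
    assume "\<forall>s\<in>space S. continuous_on K (f s)" "\<forall>y\<in>K. (\<lambda>s. f s y) \<in> borel_measurable S"
      "\<forall>s\<in>space S. \<forall>y\<in>K. 0 \<le> f s y \<and> f s y \<le> B"
    then show "(\<lambda>s. \<integral>\<^sup>+ y. ennreal (f s y) \<partial>\<mu> s) \<in> borel_measurable S \<and>
       (\<integral>\<^sup>+ s. (\<integral>\<^sup>+ y. ennreal (f s y) \<partial>\<mu> s) \<partial>distr \<nu> S \<sigma>) = (\<integral>\<^sup>+ z. ennreal (f (\<sigma> z) (\<xi> z)) \<partial>\<nu>)"
      by (intro main[of f B, unfolded \<rho>_def]) blast+
  qed
qed

section \<open>Laplace transforms and conclusion\<close>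

text \<open>The square yields differentiability, and the exponential growth is mild enough to be
  absorbed by part of the damping in a Laplace integral.\<close>

lemma exp_taylor2_bound: "\<bar>exp x - 1 - x\<bar> \<le> x\<^sup>2 * exp \<bar>x :: real\<bar>"
proof -
  have l: "exp x - 1 - x \<ge> 0" using exp_ge_add_one_self[of x] by linarith
  have "exp x * (1 - x) \<le> exp x * exp (- x)"
    using exp_ge_add_one_self[of "- x"] by (intro mult_left_mono) auto
  then have "exp x - 1 - x \<le> x * (exp x - 1)" by (simp add: exp_minus algebra_simps)
  also have "\<dots> \<le> x\<^sup>2 * exp \<bar>x\<bar>"
  proof (cases "x \<ge> 0")
    case True
    have "exp x * (1 - x) \<le> 1" using \<open>exp x * (1 - x) \<le> exp x * exp (- x)\<close> by (simp add: exp_minus)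
    then have "exp x - 1 \<le> x * exp x" by (simp add: algebra_simps)
    then have "x * (exp x - 1) \<le> x * (x * exp x)" using True by (rule mult_left_mono)
    then show ?thesis using True by (simp add: power2_eq_square ac_simps)
  next
    case False
    have "- x * (1 - exp x) \<le> - x * (- x)"
    proof (rule mult_left_mono)
      show "1 - exp x \<le> - x" using exp_ge_add_one_self[of x] by linarith
    qed (use False in simp)
    then have "x * (exp x - 1) \<le> x\<^sup>2 * 1" by (simp add: power2_eq_square algebra_simps)
    also have "\<dots> \<le> x\<^sup>2 * exp \<bar>x\<bar>" by (intro mult_left_mono) auto
    finally show ?thesis .
  qed
  finally show ?thesis using l by simp
qed

text \<open>The k-th derivative is (-1)^k times the moment \<open>\<Phi> k\<close>, which is
  nonnegative. All moments are finite because a power of \<open>W\<close> costs only half of the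
  damping. The separate weight \<open>g\<close> makes room for exp (x \<bullet> z), integrable after
  damping by hypothesis.\<close>

lemma completely_monotone_laplace_transform:
  assumes W: "W \<in> borel_measurable M" "\<And>y. W y \<ge> 0"
    and g: "g \<in> borel_measurable M" "\<And>y. g y \<ge> 0"
    and int: "\<And>t. t > 0 \<Longrightarrow> integrable M (\<lambda>y. exp (- t * W y) * g y)"
    and f: "\<And>t. t > 0 \<Longrightarrow> f t = (\<integral>y. exp (- t * W y) * g y \<partial>M)"
  shows "completely_monotone f"
proof -
  note [measurable] = W(1) g(1)
  define \<Phi> where "\<Phi> k t = (\<integral>y. W y ^ k * (exp (- t * W y) * g y) \<partial>M)" for k t
  have int_power: "integrable M (\<lambda>y. W y ^ k * (exp (- t * W y) * g y))" if t: "t > 0" for k t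
  proof (cases "k = 0")
    case True then show ?thesis using int[OF t] by simp
  next
    case False
    \<comment> \<open>From \<open>power_le_exp\<close> at (t/2) W y: the constant that bounds W^k by
      exp ((t/2) W).\<close>
    define C where "C = (2 * real k / t) ^ k"
    have "W y ^ k \<le> C * exp (t / 2 * W y)" for y
    proof -
      have "(t / 2 * W y / k) ^ k \<le> exp (t / 2 * W y)"
        using t W False by (intro power_le_exp) auto
      then have "C * (t / 2 * W y / k) ^ k \<le> C * exp (t / 2 * W y)"
        using t by (intro mult_left_mono) (auto simp: C_def)
      moreover have "C * (t / 2 * W y / k) ^ k = W y ^ k"
        unfolding C_def power_mult_distrib[symmetric] using t False by simp
      ultimately show ?thesis by simp
    qed
    then have le: "W y ^ k * (exp (- t * W y) * g y) \<le> C * (exp (- (t / 2) * W y) * g y)" for y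
    proof -
      have "W y ^ k * (exp (- t * W y) * g y) \<le> C * exp (t / 2 * W y) * (exp (- t * W y) * g y)"
        using g \<open>\<And>y. W y ^ k \<le> C * exp (t / 2 * W y)\<close> by (intro mult_right_mono) auto
      also have "\<dots> = C * (exp (t / 2 * W y + - t * W y) * g y)" by (simp only: exp_add ac_simps)
      also have "t / 2 * W y + - t * W y = - (t / 2) * W y" by simp
      finally show ?thesis .
    qed
    show ?thesis
    proof (rule Bochner_Integration.integrable_bound)
      show "integrable M (\<lambda>y. C * (exp (- (t / 2) * W y) * g y))"
        using int[of "t / 2"] t by (intro integrable_mult_right) auto
      show "AE y in M. norm (W y ^ k * (exp (- t * W y) * g y)) \<le> norm (C * (exp (- (t / 2) * W y) * g y))"
        using le W g t by (intro AE_I2) (auto simp: abs_mult C_def)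
    qed measurable
  qed
  have deriv: "(\<Phi> k has_real_derivative - \<Phi> (Suc k) t) (at t)" if t: "t > 0" for k t
  proof -
    \<comment> \<open>For |h| \<le> t/2 the factor exp |h W| uses up at most half of the damping, so
      one moment of order k + 2 at t/2 controls the quadratic error for all such
      \<open>h\<close>.\<close>
    define B where "B = \<Phi> (k + 2) (t / 2)"
    have err: "\<bar>\<Phi> k (t + h) - \<Phi> k t + h * \<Phi> (Suc k) t\<bar> \<le> h\<^sup>2 * B" if h: "\<bar>h\<bar> \<le> t / 2" "h \<noteq> 0" for h
    proof -
      have th: "t + h > 0" using t h by linarith
      let ?e = "\<lambda>y. W y ^ k * (exp (- (t + h) * W y) * g y) - W y ^ k * (exp (- t * W y) * g y)
          + h * (W y ^ Suc k * (exp (- t * W y) * g y))"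
      have 1: "\<Phi> k (t + h) - \<Phi> k t + h * \<Phi> (Suc k) t = (\<integral>y. ?e y \<partial>M)"
        unfolding \<Phi>_def using int_power[OF th, of k] int_power[OF t, of k] int_power[OF t, of "Suc k"]
        by (subst Bochner_Integration.integral_add) (auto simp del: power_Suc)
      have 2: "\<bar>\<integral>y. ?e y \<partial>M\<bar> \<le> (\<integral>y. h\<^sup>2 * (W y ^ (k + 2) * (exp (- (t / 2) * W y) * g y)) \<partial>M)"
        unfolding real_norm_def[symmetric]
      proof (rule order_trans[OF integral_norm_bound integral_mono])
        show "integrable M (\<lambda>y. norm (?e y))"
          using int_power[OF th, of k] int_power[OF t, of k] int_power[OF t, of "Suc k"]
          by (intro integrable_norm Bochner_Integration.integrable_add Bochner_Integration.integrable_diff integrable_mult_right)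
        show "integrable M (\<lambda>y. h\<^sup>2 * (W y ^ (k + 2) * (exp (- (t / 2) * W y) * g y)))"
          using int_power[of "t / 2" "k + 2"] t by (intro integrable_mult_right) auto
        fix y
        define x where "x = - h * W y"
        have "?e y = W y ^ k * exp (- t * W y) * g y * (exp x - 1 - x)"
        proof -
          have "exp (- (t + h) * W y) = exp (- t * W y) * exp x"
            by (simp add: x_def exp_add[symmetric] algebra_simps)
          then show ?thesis by (simp add: x_def algebra_simps)
        qed
        also have "\<bar>\<dots>\<bar> = W y ^ k * exp (- t * W y) * g y * \<bar>exp x - 1 - x\<bar>"
          using W g by (simp add: abs_mult)
        also have "\<dots> \<le> W y ^ k * exp (- t * W y) * g y * (x\<^sup>2 * exp \<bar>x\<bar>)"
          using W g by (intro mult_left_mono exp_taylor2_bound) auto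
        also have "\<dots> = h\<^sup>2 * (W y ^ (k + 2) * (exp (- t * W y + \<bar>x\<bar>) * g y))"
        proof -
          have "x\<^sup>2 = h\<^sup>2 * (W y)\<^sup>2" by (simp add: x_def power_mult_distrib)
          then show ?thesis by (simp only: exp_add power_add ac_simps)
        qed
        also have "\<dots> \<le> h\<^sup>2 * (W y ^ (k + 2) * (exp (- (t / 2) * W y) * g y))"
        proof (intro mult_left_mono mult_right_mono)
          have "\<bar>x\<bar> \<le> t / 2 * W y" 
            using mult_right_mono[OF h(1) W(2)[of y]] W(2)[of y] by (simp add: x_def abs_mult)
          then show "exp (- t * W y + \<bar>x\<bar>) \<le> exp (- (t / 2) * W y)" by simp
        qed (use W g in auto)
        finally show "norm (?e y) \<le> h\<^sup>2 * (W y ^ (k + 2) * (exp (- (t / 2) * W y) * g y))" by simp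
      qed
      have 3: "(\<integral>y. h\<^sup>2 * (W y ^ (k + 2) * (exp (- (t / 2) * W y) * g y)) \<partial>M) = h\<^sup>2 * B"
        unfolding B_def \<Phi>_def by (rule integral_mult_right_zero)
      show ?thesis using 2 unfolding 1[symmetric] 3 .
    qed
    have "((\<lambda>h. (\<Phi> k (t + h) - \<Phi> k t) / h - (- \<Phi> (Suc k) t)) \<longlongrightarrow> 0) (at 0)"
    proof (rule Lim_null_comparison)
      show "((\<lambda>h::real. \<bar>h\<bar> * B) \<longlongrightarrow> 0) (at 0)"
        by (rule tendsto_eq_rhs[OF tendsto_mult[OF tendsto_rabs[OF tendsto_ident_at] tendsto_const]]) simp
      show "\<forall>\<^sub>F h in at 0. norm ((\<Phi> k (t + h) - \<Phi> k t) / h - (- \<Phi> (Suc k) t)) \<le> \<bar>h\<bar> * B"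
        unfolding eventually_at
      proof (intro exI[of _ "t / 2"] conjI ballI impI)
        fix h :: real assume h: "h \<noteq> 0 \<and> dist h 0 < t / 2"
        have "(\<Phi> k (t + h) - \<Phi> k t) / h - (- \<Phi> (Suc k) t) = (\<Phi> k (t + h) - \<Phi> k t + h * \<Phi> (Suc k) t) / h"
          using h by (simp add: field_simps)
        also have "norm \<dots> = \<bar>\<Phi> k (t + h) - \<Phi> k t + h * \<Phi> (Suc k) t\<bar> / \<bar>h\<bar>" by simp
        also have "\<dots> \<le> h\<^sup>2 * B / \<bar>h\<bar>"
          using err[of h] h by (intro divide_right_mono) auto
        also have "\<dots> = \<bar>h\<bar> * B" using h by (simp add: power2_eq_square abs_if)
        finally show "norm ((\<Phi> k (t + h) - \<Phi> k t) / h - (- \<Phi> (Suc k) t)) \<le> \<bar>h\<bar> * B" .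
      qed (use t in simp)
    qed
    then show ?thesis unfolding DERIV_def by (rule LIM_zero_cancel)
  qed
  have iter: "(deriv ^^ k) f t = (- 1) ^ k * \<Phi> k t \<and>
      ((deriv ^^ k) f has_real_derivative (- 1) ^ Suc k * \<Phi> (Suc k) t) (at t)" if "t > 0" for k t
    using that
  proof (induction k arbitrary: t)
    case 0
    have "(f has_real_derivative - \<Phi> (Suc 0) t) (at t)"
      \<comment> \<open>\<open>f\<close> agrees with \<open>\<Phi> 0\<close> only for positive
        arguments; these form an open set, so the derivative carries over.\<close>
      by (rule has_field_derivative_transform_within_open[OF deriv[OF 0, of 0], where S="{0<..}"])
        (use 0 f in \<open>auto simp: \<Phi>_def\<close>)
    then show ?case using f[OF 0] by (simp add: \<Phi>_def)
  next
    case (Suc k)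
    have e: "(deriv ^^ Suc k) f s = (- 1) ^ Suc k * \<Phi> (Suc k) s" if "s > 0" for s
      using Suc.IH[OF that] DERIV_imp_deriv by simp blast
    have "((\<lambda>s. (- 1) ^ Suc k * \<Phi> (Suc k) s) has_real_derivative (- 1) ^ Suc k * - \<Phi> (Suc (Suc k)) t) (at t)"
      by (rule DERIV_cmult[OF deriv[OF Suc.prems]])
    then have "((deriv ^^ Suc k) f has_real_derivative (- 1) ^ Suc k * - \<Phi> (Suc (Suc k)) t) (at t)"
      by (rule has_field_derivative_transform_within_open[where S="{0<..}"]) (use Suc.prems e in auto)
    then show ?case using e[OF Suc.prems] by simp
  qed
  show ?thesis unfolding completely_monotone_def
  proof (intro allI impI conjI)
    fix k and t :: real assume t: "t > 0"
    show "(deriv ^^ k) f differentiable at t"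
      using iter[OF t, of k] real_differentiable_def by blast
    have "(- 1) ^ k * (deriv ^^ k) f t = \<Phi> k t"
      using iter[OF t, of k] by (simp add: mult.assoc[symmetric] power_add[symmetric] mult_2[symmetric])
    also have "\<dots> \<ge> 0" unfolding \<Phi>_def using W g by (intro Bochner_Integration.integral_nonneg) auto
    finally show "0 \<le> (- 1) ^ k * (deriv ^^ k) f t" by simp
  qed
qed

text \<open>Monotone convergence in both integrals. Measurability of the inner integral is only
  known for the approximations and passes to the limit as a supremum; this serves the passage from t
  < 0 to t = 0.\<close>

lemma nn_integral_kernel_monotone_limit:
  fixes f :: "nat \<Rightarrow> 'a \<Rightarrow> 'b \<Rightarrow> ennreal"
  assumes mono: "\<And>k s y. s \<in> space \<rho> \<Longrightarrow> f k s y \<le> f (Suc k) s y"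
    and lim: "\<And>s y. s \<in> space \<rho> \<Longrightarrow> (\<lambda>k. f k s y) \<longlonglongrightarrow> g s y"
    and meas: "\<And>k s. s \<in> space \<rho> \<Longrightarrow> f k s \<in> borel_measurable (\<mu> s)"
    and inner: "\<And>k. (\<lambda>s. \<integral>\<^sup>+ y. f k s y \<partial>\<mu> s) \<in> borel_measurable \<rho>"
  shows "(\<lambda>s. \<integral>\<^sup>+ y. g s y \<partial>\<mu> s) \<in> borel_measurable \<rho>"
    "(\<lambda>k. \<integral>\<^sup>+ s. (\<integral>\<^sup>+ y. f k s y \<partial>\<mu> s) \<partial>\<rho>) \<longlonglongrightarrow> (\<integral>\<^sup>+ s. (\<integral>\<^sup>+ y. g s y \<partial>\<mu> s) \<partial>\<rho>)"
proof -
  let ?F = "\<lambda>k s. \<integral>\<^sup>+ y. f k s y \<partial>\<mu> s"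
  have Fmono: "?F k s \<le> ?F (Suc k) s" if "s \<in> space \<rho>" for k s
    by (rule nn_integral_mono) (rule mono[OF that])
  have eq: "(\<integral>\<^sup>+ y. g s y \<partial>\<mu> s) = (SUP k. ?F k s)" if s: "s \<in> space \<rho>" for s
  proof (rule LIMSEQ_unique)
    show "(\<lambda>k. ?F k s) \<longlonglongrightarrow> (SUP k. ?F k s)"
      by (rule LIMSEQ_SUP) (rule incseq_SucI, rule Fmono[OF s])
    show "(\<lambda>k. ?F k s) \<longlonglongrightarrow> (\<integral>\<^sup>+ y. g s y \<partial>\<mu> s)"
      by (rule nn_integral_LIMSEQ) (auto intro!: incseq_SucI le_funI mono[OF s] meas[OF s] lim[OF s])
  qed
  have SUPm: "(\<lambda>s. SUP k. ?F k s) \<in> borel_measurable \<rho>"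
    by (rule borel_measurable_SUP) (auto intro: inner)
  then show "(\<lambda>s. \<integral>\<^sup>+ y. g s y \<partial>\<mu> s) \<in> borel_measurable \<rho>"
    by (subst measurable_cong[OF eq])
  have "(\<integral>\<^sup>+ s. (\<integral>\<^sup>+ y. g s y \<partial>\<mu> s) \<partial>\<rho>) = (\<integral>\<^sup>+ s. (SUP k. ?F k s) \<partial>\<rho>)"
    by (rule nn_integral_cong) (rule eq)
  also have "\<dots> = (SUP k. \<integral>\<^sup>+ s. ?F k s \<partial>\<rho>)"
    by (rule nn_integral_monotone_convergence_SUP_AE) (auto intro: Fmono inner)
  finally have e: "(\<integral>\<^sup>+ s. (\<integral>\<^sup>+ y. g s y \<partial>\<mu> s) \<partial>\<rho>) = (SUP k. \<integral>\<^sup>+ s. ?F k s \<partial>\<rho>)" .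
  show "(\<lambda>k. \<integral>\<^sup>+ s. ?F k s \<partial>\<rho>) \<longlonglongrightarrow> (\<integral>\<^sup>+ s. (\<integral>\<^sup>+ y. g s y \<partial>\<mu> s) \<partial>\<rho>)"
    unfolding e by (rule LIMSEQ_SUP) (intro incseq_SucI nn_integral_mono Fmono)
qed

text \<open>Equality in \<open>ennreal\<close> includes finiteness of the iterated integral.
  Measurability of the inner integral is asserted alongside, so that the outer nonnegative integral
  has its usual meaning.\<close>

theorem theorem1p1:
  fixes u :: "real ^ 'n \<Rightarrow> real \<Rightarrow> real"
  assumes "ancient_heat_solution u"
    and "\<And>x t. t \<le> 0 \<Longrightarrow> u x t \<ge> 0"
  shows "(\<forall>x. completely_monotone (\<lambda>t. u x (- t))) \<and>
    (\<exists>(\<mu> :: real \<Rightarrow> (real ^ 'n) measure) (\<rho> :: real measure).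
       (\<forall>s\<ge>0. borel_measure_on (sphere 0 1) (\<mu> s)) \<and>
       borel_measure_on {0..} \<rho> \<and>
       (\<forall>x. \<forall>t\<le>0.
          (\<lambda>s. \<integral>\<^sup>+ \<xi>. ennreal (exp (t * s + sqrt s * (x \<bullet> \<xi>))) \<partial>\<mu> s) \<in> borel_measurable \<rho> \<and>
          ennreal (u x t) =
            (\<integral>\<^sup>+ s. (\<integral>\<^sup>+ \<xi>. ennreal (exp (t * s + sqrt s * (x \<bullet> \<xi>))) \<partial>\<mu> s) \<partial>\<rho>)))"
proof -
  obtain p q where pq: "ancient_heat u p q"
    using ancient_heat_solution_imp_ancient_heat[OF assms] by blast
  interpret ancient_heat u p q by (rule pq)
  obtain \<nu> where fin: "finite_measure \<nu>" and sets_\<nu>: "sets \<nu> = sets borel"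
    and rep: "\<And>x t. t < 0 \<Longrightarrow> (\<integral>\<^sup>+ z. ennreal (exp (t * (norm z)\<^sup>2 + x \<bullet> z)) \<partial>\<nu>) = ennreal (u x t)"
    using exponential_representation by blast
  have m\<nu>: "f \<in> borel_measurable \<nu>" if "f \<in> borel_measurable borel" for f :: "real ^ 'n \<Rightarrow> 'c::topological_space"
    using that measurable_cong_sets[OF sets_\<nu> refl] by blast
  have CM: "completely_monotone (\<lambda>t. u x (- t))" for x
  proof (rule completely_monotone_laplace_transform[where M=\<nu> and W="\<lambda>z. (norm z)\<^sup>2" and g="\<lambda>z. exp (x \<bullet> z)"])
    fix t :: real assume t: "t > 0"
    let ?f = "\<lambda>z. exp (- t * (norm z)\<^sup>2) * exp (x \<bullet> z)"
    have f: "(\<integral>\<^sup>+ z. ennreal (?f z) \<partial>\<nu>) = ennreal (u x (- t))"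
      using rep[of "- t" x] t unfolding exp_add by simp
    have fm: "?f \<in> borel_measurable \<nu>" by (rule m\<nu>) measurable
    show "integrable \<nu> ?f"
      by (rule integrableI_nn_integral_finite[OF fm _ f]) (use t assms(2) in auto)
    have "(\<integral>z. ?f z \<partial>\<nu>) = enn2real (\<integral>\<^sup>+ z. ennreal (?f z) \<partial>\<nu>)"
      by (rule integral_eq_nn_integral[OF fm]) auto
    then show "u x (- t) = (\<integral>z. ?f z \<partial>\<nu>)" unfolding f using t assms(2) by simp
  qed (auto intro!: m\<nu>)
  \<comment> \<open>The direction assigned to z = 0. It is met only at s = 0, where sqrt s removes
    it from the exponent; an atom of \<nu> at the origin thus becomes an atom of
    \<open>\<rho>\<close> at 0.\<close>
  obtain b :: "real ^ 'n" where b: "norm b = 1" using nonempty_Basis norm_Basis by blast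
  define S where "S = restrict_space borel {0::real..}"
  define \<sigma> where "\<sigma> z = (norm z)\<^sup>2" for z :: "real ^ 'n"
  define \<xi> where "\<xi> z = (if z = 0 then b else z /\<^sub>R norm z)" for z
  have spS: "space S = {0..}" by (simp add: S_def space_restrict_space)
  have "\<sigma> \<in> borel_measurable borel" unfolding \<sigma>_def by measurable
  then have \<sigma>: "\<sigma> \<in> measurable \<nu> S"
    unfolding S_def by (intro measurable_restrict_space2 m\<nu>) (auto simp: \<sigma>_def)
  have \<xi>: "\<xi> \<in> borel_measurable \<nu>" unfolding \<xi>_def by (rule m\<nu>) measurable
  have \<xi>K: "\<xi> z \<in> sphere 0 1" for z using b by (simp add: \<xi>_def)
  obtain \<mu> where \<mu>: "\<And>s. sets (\<mu> s) = sets (restrict_space borel (sphere 0 1))"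
    and dis: "\<forall>(f :: real \<Rightarrow> real ^ 'n \<Rightarrow> real) B. (\<forall>s\<in>space S. continuous_on (sphere 0 1) (f s)) \<longrightarrow>
       (\<forall>y\<in>sphere 0 1. (\<lambda>s. f s y) \<in> borel_measurable S) \<longrightarrow>
       (\<forall>s\<in>space S. \<forall>y\<in>sphere 0 1. 0 \<le> f s y \<and> f s y \<le> B) \<longrightarrow>
       (\<lambda>s. \<integral>\<^sup>+ y. ennreal (f s y) \<partial>\<mu> s) \<in> borel_measurable S \<and>
       (\<integral>\<^sup>+ s. (\<integral>\<^sup>+ y. ennreal (f s y) \<partial>\<mu> s) \<partial>distr \<nu> S \<sigma>) = (\<integral>\<^sup>+ z. ennreal (f (\<sigma> z) (\<xi> z)) \<partial>\<nu>)"
    by (rule disintegration_compact[OF fin compact_sphere \<sigma> \<xi> \<xi>K]) (rule that; assumption)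
  define \<rho> where "\<rho> = distr \<nu> S \<sigma>"
  have sets_\<rho>: "sets \<rho> = sets S" by (simp add: \<rho>_def)
  have sp\<rho>: "space \<rho> = {0..}" by (simp add: \<rho>_def spS)
  have m\<rho>: "f \<in> borel_measurable \<rho> \<longleftrightarrow> f \<in> borel_measurable S" for f :: "real \<Rightarrow> ennreal"
    using measurable_cong_sets[OF sets_\<rho> refl] by blast
  define F where "F t x s = (\<integral>\<^sup>+ y. ennreal (exp (t * s + sqrt s * (x \<bullet> y))) \<partial>\<mu> s)" for t x s
  have neg: "F t x \<in> borel_measurable \<rho> \<and> ennreal (u x t) = (\<integral>\<^sup>+ s. F t x s \<partial>\<rho>)" if t: "t < 0" for t x
  proof -
    let ?f = "\<lambda>s y. exp (t * s + sqrt s * (x \<bullet> y))"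
    have 1: "continuous_on (sphere 0 1) (?f s)" for s by (intro continuous_intros)
    have 2: "(\<lambda>s. ?f s y) \<in> borel_measurable S" for y
      unfolding S_def by (rule measurable_restrict_space1) measurable
    \<comment> \<open>The Gaussian bound at the point sqrt s times y, of norm sqrt s. For x \<noteq>
      0 it degenerates as t tends to 0, so t = 0 is treated separately.\<close>
    have 3: "0 \<le> ?f s y \<and> ?f s y \<le> exp ((norm x)\<^sup>2 / (4 * (- t)))"
      if "s \<in> space S" "y \<in> sphere 0 1" for s y
      using gaussian_exponential_le[OF t, of "sqrt s *\<^sub>R y" x] that by (simp add: spS)
    have 4: "?f (\<sigma> z) (\<xi> z) = exp (t * (norm z)\<^sup>2 + x \<bullet> z)" for z
      by (simp add: \<sigma>_def \<xi>_def)
    show ?thesis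
      using dis[rule_format, of ?f, OF 1 2 3] unfolding F_def m\<rho> unfolding \<rho>_def 4 rep[OF t] by simp
  qed
  have zero: "F 0 x \<in> borel_measurable \<rho> \<and> ennreal (u x 0) = (\<integral>\<^sup>+ s. F 0 x s \<partial>\<rho>)" for x
  proof -
    \<comment> \<open>Times increasing to 0. As s \<ge> 0 on the space of \<open>\<rho>\<close>, the
      integrands increase as well, so monotone convergence applies without a bound, and continuity
      of \<open>u\<close> at time 0 identifies the limit.\<close>
    define \<tau> where "\<tau> k = - inverse (real (Suc k))" for k
    have \<tau>: "\<tau> k < 0" "\<tau> k \<le> \<tau> (Suc k)" for k
      by (auto simp: \<tau>_def le_imp_inverse_le)
    have \<tau>0: "\<tau> \<longlonglongrightarrow> 0" unfolding \<tau>_def using tendsto_minus[OF LIMSEQ_inverse_real_of_nat] by simp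
    let ?f = "\<lambda>k s y. ennreal (exp (\<tau> k * s + sqrt s * (x \<bullet> y)))"
    have mono: "?f k s y \<le> ?f (Suc k) s y" if "s \<in> space \<rho>" for k s y
      using that \<tau>(2)[of k] by (auto simp: sp\<rho> intro!: ennreal_leI mult_right_mono)
    have lim: "(\<lambda>k. ?f k s y) \<longlonglongrightarrow> ennreal (exp (0 * s + sqrt s * (x \<bullet> y)))" for s y
      by (intro tendsto_intros tendsto_ennrealI \<tau>0)
    have meas: "?f k s \<in> borel_measurable (\<mu> s)" for k s
    proof -
      have "?f k s \<in> borel_measurable (restrict_space borel (sphere 0 1))"
        by (rule measurable_restrict_space1) measurable
      then show ?thesis using measurable_cong_sets[OF \<mu> refl] by blast
    qed
    have inner: "(\<lambda>s. \<integral>\<^sup>+ y. ?f k s y \<partial>\<mu> s) \<in> borel_measurable \<rho>" for k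
      using neg[of "\<tau> k" x, OF \<tau>(1)] unfolding F_def by blast
    note L = nn_integral_kernel_monotone_limit[of \<rho> ?f, OF mono lim meas inner]
    have "(\<lambda>k. ennreal (u x (\<tau> k))) \<longlonglongrightarrow> (\<integral>\<^sup>+ s. F 0 x s \<partial>\<rho>)"
    proof -
      have "ennreal (u x (\<tau> k)) = (\<integral>\<^sup>+ s. F (\<tau> k) x s \<partial>\<rho>)" for k
        using neg[of "\<tau> k" x, OF \<tau>(1)] by blast
      then show ?thesis using L(2) unfolding F_def by simp
    qed
    moreover have "(\<lambda>k. ennreal (u x (\<tau> k))) \<longlonglongrightarrow> ennreal (u x 0)"
    proof (rule tendsto_ennrealI)
      have "(\<lambda>k. (\<lambda>(x, t). u x t) (x, \<tau> k)) \<longlonglongrightarrow> (\<lambda>(x, t). u x t) (x, 0)"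
        by (rule continuous_on_tendsto_compose[OF cont_u])
          (use \<tau>(1) in \<open>auto intro!: tendsto_Pair \<tau>0 always_eventually less_imp_le\<close>)
      then show "(\<lambda>k. u x (\<tau> k)) \<longlonglongrightarrow> u x 0" by simp
    qed
    ultimately have "ennreal (u x 0) = (\<integral>\<^sup>+ s. F 0 x s \<partial>\<rho>)" using LIMSEQ_unique by blast
    moreover have "F 0 x \<in> borel_measurable \<rho>" using L(1) unfolding F_def .
    ultimately show ?thesis by blast
  qed
  have "F t x \<in> borel_measurable \<rho> \<and> ennreal (u x t) = (\<integral>\<^sup>+ s. F t x s \<partial>\<rho>)" if "t \<le> 0" for t x
    using neg[of t x] zero[of x] that by (cases "t = 0") auto
  moreover have "borel_measure_on (sphere 0 1) (\<mu> s)" for s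
    unfolding borel_measure_on_def using \<mu>[of s] sets_eq_imp_space_eq[OF \<mu>[of s]]
    by (simp add: space_restrict_space)
  moreover have "borel_measure_on {0..} \<rho>"
    unfolding borel_measure_on_def using sp\<rho> sets_\<rho> by (simp add: S_def)
  ultimately show ?thesis using CM unfolding F_def by blast
qed

end
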